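(* Let $\mathbb{G}$ be a Carnot group of rank $m$ and let $\Omega\subseteq\mathbb{G}$ be a domain. Let $(H_j)_{j\in\mathbb{N}}$ and $H_\infty$ be functions from $\Omega\times\mathbb{R}^m$ to $\mathbb{R}$ satisfying (H) with a uniform choice of $\alpha$ (the same $\alpha>1$ in (H3) for all of them). For every $j\in\mathbb{N}$ let $u_j\in C(\Omega)$ be a Monge solution to $H_j(x,Xu_j)=0$ on $\Omega$. Let $d_{\sigma_j^\star}$ be the optical length function on $\Omega$ associated to $H_j$ and $d_{\sigma_\infty^\star}$ the one associated to $H_\infty$, and assume that $d_{\sigma_j^\star}\to d_{\sigma_\infty^\star}$ locally uniformly on $\Omega\times\Omega$ as $j\to\infty$. Assume that there exists $u_\infty\in C(\Omega)$ such that $u_j\to u_\infty$ locally uniformly on $\Omega$. Then $u_\infty$ is a Monge solution to $H_\infty(x,Xu_\infty)=0$ on $\Omega$.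
   Context: Carnot groups. A Carnot group $\mathbb{G}$ of dimension $n$, rank $m$ and step $k$ is a connected, simply connected $n$-dimensional Lie group whose Lie algebra $\mathfrak g$ of left-invariant vector fields is stratified: $\mathfrak g=\mathfrak g_1\oplus\dots\oplus\mathfrak g_k$, $[\mathfrak g_1,\mathfrak g_i]=\mathfrak g_{i+1}$ for $i<k$, $\mathfrak g_k\neq\{0\}$, $[\mathfrak g_1,\mathfrak g_k]=\{0\}$, with $\dim\mathfrak g_1=m$. An adapted basis $X_1,\dots,X_n$ of $\mathfrak g$ is fixed (consecutive blocks are bases of $\mathfrak g_1,\dots,\mathfrak g_k$), and $\mathbb{G}$ is identified with $\mathbb{R}^n$ via exponential coordinates $(y_1,\dots,y_n)\mapsto\exp(y_1X_1+\dots+y_nX_n)$. A domain is an open connected set. Horizontal curves. An absolutely continuous curve $\gamma:[0,T]\to\mathbb{G}$ is horizontal if there is $a=(a_1,\dots,a_m)\in L^\infty((0,T),\mathbb{R}^m)$ with $\dot\gamma(t)=\sum_{i=1}^m a_i(t)X_i(\gamma(t))$ for a.e. $t$; one then identifies $\dot\gamma(t)$ with $a(t)\in\mathbb{R}^m$. It is sub-unit if $\|a\|_\infty\le1$. The Carnot–Carathéodory distance on a domain $\Omega$ is $d_\Omega(x,y)=\inf\{\int_0^T|\dot\gamma(t)|\,dt:\ \gamma:[0,T]\to\Omega\text{ sub-unit},\ T>0,\ \gamma(0)=x,\ \gamma(T)=y\}$. Assumptions (H) on $H:\Omega\times\mathbb{R}^m\to\mathbb{R}$: (H1) $H$ is Borel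 measurable; (H2) for every $x\in\Omega$ the set $Z(x)=\{p\in\mathbb{R}^m: H(x,p)\le0\}$ is closed and convex and $\partial Z(x)=\{p\in\mathbb{R}^m:H(x,p)=0\}$; (H3) there is $\alpha>1$ such that $\hat B_{1/\alpha}(0)\subset Z(x)\subset\hat B_\alpha(0)$ for every $x\in\Omega$, where $\hat B_\rho(0)$ is the open Euclidean ball of radius $\rho$ in $\mathbb{R}^m$. Optical length associated to $H$. $\sigma^\star(x,p)=\sup\{\langle-\xi,p\rangle:\xi\in Z(x)\}$ for $x\in\Omega$, $p\in\mathbb{R}^m$, and $d_{\sigma^\star}(x,y)=\inf\{\int_0^1\sigma^\star(\gamma(t),\dot\gamma(t))\,dt:\ \gamma:[0,1]\to\Omega\text{ horizontal},\ \gamma(0)=x,\ \gamma(1)=y\}$ for $x,y\in\Omega$. Monge solutions. $u\in C(\Omega)$ is a Monge solution to $H(x,Xu)=0$ in $\Omega$ if for every $x_0\in\Omega$, $\liminf_{x\to x_0}\frac{u(x)-u(x_0)+d_{\sigma^\star}(x_0,x)}{d_\Omega(x_0,x)}=0$, where $d_{\sigma^\star}$ is the optical length function associated to $H$. *)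

theory Defs
  imports "HOL-Analysis.Analysis" "HOL-Algebra.Group"
begin

section \<open>Smooth maps and vector fields on Euclidean space\<close>

primrec C_k :: "nat \<Rightarrow> ('a::euclidean_space \<Rightarrow> 'b::euclidean_space) \<Rightarrow> bool" where
  "C_k 0 f \<longleftrightarrow> continuous_on UNIV f"
| "C_k (Suc k) f \<longleftrightarrow>
     (\<forall>x. f differentiable (at x)) \<and> (\<forall>v. C_k k (\<lambda>x. frechet_derivative f (at x) v))"

definition smooth :: "('a::euclidean_space \<Rightarrow> 'b::euclidean_space) \<Rightarrow> bool" where
  "smooth f \<longleftrightarrow> (\<forall>k. C_k k f)"

type_synonym 'n vfield = "real ^ 'n \<Rightarrow> real ^ 'n"

text \<open>In coordinates, the commutator of the derivations \<open>Y\<close> and \<open>Z\<close> is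
  \<open>DZ Y - DY Z\<close>.\<close>

definition bracket :: "'n::finite vfield \<Rightarrow> 'n vfield \<Rightarrow> 'n vfield" where
  "bracket Y Z =
     (\<lambda>x. frechet_derivative Z (at x) (Y x) - frechet_derivative Y (at x) (Z x))"

text \<open>Real linear span of a set of vector fields; function types are not an instance of
  \<open>real_vector\<close>, so the library's span does not apply.\<close>

definition fields_span :: "'n::finite vfield set \<Rightarrow> 'n vfield set" where
  "fields_span S = {\<lambda>x. \<Sum>Y\<in>F. c Y *\<^sub>R Y x | F c. finite F \<and> F \<subseteq> S}"

section \<open>Carnot groups in exponential coordinates\<close>

text \<open>A Lie group whose underlying manifold is the (connected, simply connected) space
  \<open>real ^ 'n\<close>.\<close>

locale euclidean_lie_group = group G for G :: "(real ^ 'n::finite) monoid" (structure) +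
  assumes carrier_UNIV: "carrier G = UNIV"
    and smooth_mult: "smooth (\<lambda>(x, y). x \<otimes> y)"
    and smooth_inv: "smooth (\<lambda>x. inv x)"

definition lie_algebra :: "(real ^ 'n::finite) monoid \<Rightarrow> 'n vfield set" where
  "lie_algebra G =
     {Y. smooth Y \<and>
         (\<forall>x y. frechet_derivative (\<lambda>z. x \<otimes>\<^bsub>G\<^esub> z) (at y) (Y y) = Y (x \<otimes>\<^bsub>G\<^esub> y))}"

text \<open>\<open>p = exp Y\<close>: the integral curve of \<open>Y\<close> issuing from the identity is at \<open>p\<close> at
  time 1.\<close>

definition is_exp :: "(real ^ 'n::finite) monoid \<Rightarrow> 'n vfield \<Rightarrow> real ^ 'n \<Rightarrow> bool" where
  "is_exp G Y p \<longleftrightarrow>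
     (\<exists>\<gamma>. \<gamma> 0 = \<one>\<^bsub>G\<^esub> \<and> (\<forall>t. (\<gamma> has_vector_derivative Y (\<gamma> t)) (at t)) \<and> \<gamma> (1::real) = p)"

definition layer :: "('n::finite \<Rightarrow> 'n vfield) \<Rightarrow> ('n \<Rightarrow> nat) \<Rightarrow> nat \<Rightarrow> 'n vfield set" where
  "layer X deg i = fields_span (X ` {j. deg j = i})"

text \<open>The basis \<open>X\<close> of the Lie algebra is adapted to the stratification: the fields \<open>X j\<close> with
  \<open>deg j = i\<close> form a basis of the \<open>i\<close>-th layer. The coordinates are labelled by \<open>'n\<close>
  without an order, so \<open>deg\<close> replaces the convention that the layers occupy consecutive blocks
  of indices. The rank is \<open>CARD('m)\<close>, and \<open>hor\<close> enumerates the labels of the first layer.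
  The assumption \<open>exp_coordinates\<close> says that the point \<open>y\<close> is
  \<open>exp (y\<^sub>1 X\<^sub>1 + ... + y\<^sub>n X\<^sub>n)\<close>.\<close>

locale carnot_group = euclidean_lie_group G for G :: "(real ^ 'n::finite) monoid" (structure) +
  fixes X :: "'n \<Rightarrow> 'n vfield"
    and deg :: "'n \<Rightarrow> nat"
    and step :: nat
    and hor :: "'m::finite \<Rightarrow> 'n"
  assumes basis_span: "fields_span (range X) = lie_algebra G"
    and basis_indep: "\<And>c :: real ^ 'n. (\<lambda>x. \<Sum>j\<in>UNIV. c $ j *\<^sub>R X j x) = (\<lambda>x. 0) \<Longrightarrow> c = 0"
    and deg_range: "\<And>j. deg j \<in> {1..step}"
    and step_pos: "1 \<le> step"
    and generates: "\<And>i. \<lbrakk>1 \<le> i; i < step\<rbrakk> \<Longrightarrow>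
      fields_span {bracket Y Z | Y Z. Y \<in> layer X deg 1 \<and> Z \<in> layer X deg i} = layer X deg (i + 1)"
    and top_nonzero: "layer X deg step \<noteq> {\<lambda>x. 0}"
    and top_central:
      "fields_span {bracket Y Z | Y Z. Y \<in> layer X deg 1 \<and> Z \<in> layer X deg step} = {\<lambda>x. 0}"
    and rank: "bij_betw hor UNIV {j. deg j = 1}"
    and exp_coordinates: "\<And>y. is_exp G (\<lambda>x. \<Sum>j\<in>UNIV. y $ j *\<^sub>R X j x) y"

definition is_domain :: "'a::topological_space set \<Rightarrow> bool" where
  "is_domain \<Omega> \<longleftrightarrow> open \<Omega> \<and> connected \<Omega>"

section \<open>Horizontal curves and the Carnot-Caratheodory distance\<close>

text \<open>Below, \<open>Xh :: 'm \<Rightarrow> 'n vfield\<close> is the family of horizontal fields (the basis of the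
  first layer).\<close>

definition abs_continuous_on :: "real set \<Rightarrow> (real \<Rightarrow> 'a::real_normed_vector) \<Rightarrow> bool" where
  "abs_continuous_on I \<gamma> \<longleftrightarrow>
     (\<forall>\<epsilon>>0. \<exists>\<delta>>0. \<forall>D S. D division_of S \<and> S \<subseteq> I \<and> (\<Sum>K\<in>D. Sup K - Inf K) < \<delta> \<longrightarrow>
        (\<Sum>K\<in>D. norm (\<gamma> (Sup K) - \<gamma> (Inf K))) < \<epsilon>)"

text \<open>\<open>\<gamma> : [0,T] \<rightarrow> \<Omega>\<close> is horizontal with velocity coefficients \<open>a\<close>. These are determined by
  \<open>\<gamma>\<close> up to a null set, and \<open>\<gamma>'(t)\<close> is identified with \<open>a t\<close>.\<close>

definition horizontal_curve ::
  "('m::finite \<Rightarrow> 'n::finite vfield) \<Rightarrow> (real ^ 'n) set \<Rightarrow> real \<Rightarrow>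
     (real \<Rightarrow> real ^ 'n) \<Rightarrow> (real \<Rightarrow> real ^ 'm) \<Rightarrow> bool" where
  "horizontal_curve Xh \<Omega> T \<gamma> a \<longleftrightarrow>
     \<gamma> ` {0..T} \<subseteq> \<Omega> \<and> abs_continuous_on {0..T} \<gamma> \<and>
     a \<in> borel_measurable (lebesgue_on {0<..<T}) \<and>
     (\<exists>C. AE t in lebesgue_on {0<..<T}. norm (a t) \<le> C) \<and>
     (AE t in lebesgue_on {0<..<T}.
        (\<gamma> has_vector_derivative (\<Sum>i\<in>UNIV. a t $ i *\<^sub>R Xh i (\<gamma> t))) (at t))"

definition cc_dist ::
  "('m::finite \<Rightarrow> 'n::finite vfield) \<Rightarrow> (real ^ 'n) set \<Rightarrow> real ^ 'n \<Rightarrow> real ^ 'n \<Rightarrow> real" where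
  "cc_dist Xh \<Omega> x y =
     Inf {(LINT t|lebesgue_on {0<..<T}. norm (a t)) | T \<gamma> a.
            0 < T \<and> horizontal_curve Xh \<Omega> T \<gamma> a \<and>
            (AE t in lebesgue_on {0<..<T}. norm (a t) \<le> 1) \<and> \<gamma> 0 = x \<and> \<gamma> T = y}"

section \<open>Hamiltonians, optical length and Monge solutions\<close>

definition sublevel :: "('a \<Rightarrow> 'p \<Rightarrow> real) \<Rightarrow> 'a \<Rightarrow> 'p set" where
  "sublevel H x = {p. H x p \<le> 0}"

definition hamiltonian ::
  "(real ^ 'n::finite) set \<Rightarrow> real \<Rightarrow> (real ^ 'n \<Rightarrow> real ^ 'm::finite \<Rightarrow> real) \<Rightarrow> bool" where
  "hamiltonian \<Omega> \<alpha> H \<longleftrightarrow>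
     (\<lambda>(x, p). H x p) \<in> borel_measurable (restrict_space borel (\<Omega> \<times> UNIV)) \<and>
     (\<forall>x\<in>\<Omega>. closed (sublevel H x) \<and> convex (sublevel H x) \<and>
        frontier (sublevel H x) = {p. H x p = 0}) \<and>
     1 < \<alpha> \<and> (\<forall>x\<in>\<Omega>. ball 0 (1 / \<alpha>) \<subseteq> sublevel H x \<and> sublevel H x \<subseteq> ball 0 \<alpha>)"

definition support_fun ::
  "('a \<Rightarrow> 'p::real_inner \<Rightarrow> real) \<Rightarrow> 'a \<Rightarrow> 'p \<Rightarrow> real" where
  "support_fun H x p = Sup {inner (- \<xi>) p | \<xi>. \<xi> \<in> sublevel H x}"

definition optical_length ::
  "('m::finite \<Rightarrow> 'n::finite vfield) \<Rightarrow> (real ^ 'n) set \<Rightarrow> (real ^ 'n \<Rightarrow> real ^ 'm \<Rightarrow> real) \<Rightarrow>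
     real ^ 'n \<Rightarrow> real ^ 'n \<Rightarrow> real" where
  "optical_length Xh \<Omega> H x y =
     Inf {(LINT t|lebesgue_on {0<..<1}. support_fun H (\<gamma> t) (a t)) | \<gamma> a.
            horizontal_curve Xh \<Omega> 1 \<gamma> a \<and> \<gamma> 0 = x \<and> \<gamma> 1 = y}"

definition monge_solution ::
  "('m::finite \<Rightarrow> 'n::finite vfield) \<Rightarrow> (real ^ 'n) set \<Rightarrow> (real ^ 'n \<Rightarrow> real ^ 'm \<Rightarrow> real) \<Rightarrow>
     (real ^ 'n \<Rightarrow> real) \<Rightarrow> bool" where
  "monge_solution Xh \<Omega> H u \<longleftrightarrow>
     continuous_on \<Omega> u \<and>
     (\<forall>x0\<in>\<Omega>. Liminf (at x0 within \<Omega>)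
        (\<lambda>x. ereal ((u x - u x0 + optical_length Xh \<Omega> H x0 x) / cc_dist Xh \<Omega> x0 x)) = 0)"

definition locally_uniform_limit ::
  "'a::topological_space set \<Rightarrow> (nat \<Rightarrow> 'a \<Rightarrow> real) \<Rightarrow> ('a \<Rightarrow> real) \<Rightarrow> bool" where
  "locally_uniform_limit S f l \<longleftrightarrow>
     (\<forall>x\<in>S. \<exists>U. open U \<and> x \<in> U \<and> uniform_limit (U \<inter> S) f l sequentially)"

end

theory Submission
  imports Defs
begin

text \<open>
  Why the theorem holds. Write \<open>d\<close> for the optical length and \<open>c\<close> for the Carnot-Caratheodory
  distance. The Monge condition is infinitesimal and refers to a fixed Hamiltonian, so it does not
  pass to limits directly. It is therefore replaced by two statements that mention only
  \<open>u\<close> and \<open>d\<close>, at positive distance, and that do pass to limits.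

  \<^item> If the lower limit in the Monge condition is nonnegative at every point, then
    \<open>u x - u y \<le> d x y\<close> for all \<open>x\<close> and \<open>y\<close>: the infinitesimal inequality is integrated along almost
    minimal curves (\<open>monge_imp_global_subsolution\<close>).

  \<^item> If the lower limit is nonpositive at every point, then for each closed ball around \<open>x\<close> in the
    domain and each \<open>\<theta> < 1\<close> the bounding sphere contains a point \<open>y\<close> with
    \<open>u y + \<theta> * d x y \<le> u x\<close>: one descends from \<open>x\<close>, and a point of the open ball from which no further
    descent is possible would violate the Monge condition (\<open>monge_imp_sphere_point\<close>).

  For a convergent sequence, the first inequality passes to the limit pointwise. In the second, spheres
  are compact and \<open>\<theta>\<close> may tend to 1, so the limit satisfies \<open>u y + d x y \<le> u x\<close> for some \<open>y\<close> on every
  small sphere around \<open>x\<close>; hence the difference quotient of the limit is nonnegative and vanishes at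
  points arbitrarily close to \<open>x\<close>, which is the Monge condition. The argument is axiomatised in the
  locale \<open>length_structure\<close> and concluded in \<open>monge_stable\<close>.

  What remains is that the optical length functions of a domain in a Carnot group satisfy the axioms.
  Two of them are substantial.

  \<^item> Short horizontal curves stay short in the Euclidean sense (\<open>hcurve_escape_length\<close>), so that
    \<open>c\<close> separates points. This needs the fundamental theorem of calculus for absolutely continuous
    curves (\<open>abs_continuous_has_integral_derivative\<close>), which also allows every horizontal curve to be
    treated as a Lipschitz curve.

  \<^item> Points that are close in the Euclidean sense are joined by short horizontal curves (\<open>chow\<close>). The
    conjugates \<open>g exp(t X\<^sub>i) g\<inverse>\<close> of horizontal one-parameter curves, with \<open>g\<close> reachable
    from the identity by a short horizontal curve, have velocity \<open>Ad g X\<^sub>i\<close>. A covector that annihilates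
    all these velocities annihilates, by differentiation in \<open>g\<close>, also the brackets, hence every layer,
    hence the Lie algebra (\<open>Ad_orbit_detects_layers\<close>). So finitely many of these velocities form a basis,
    and a product of the corresponding curves covers a neighbourhood of the identity
    (\<open>one_interior_reachable\<close>).
\<close>

section \<open>Monge solutions for abstract length structures\<close>

text \<open>Continuity turns local growth to the right of every point into global growth: the set of times up
  to which \<open>g\<close> has stayed above \<open>g 0\<close> is closed and cannot end before 1.\<close>
lemma locally_increasing_imp_le:
  fixes g :: "real \<Rightarrow> real"
  assumes cont: "continuous_on {0..1} g"
    and loc: "\<And>s. \<lbrakk>0 \<le> s; s < 1\<rbrakk> \<Longrightarrow> \<exists>\<delta>>0. \<forall>t. s \<le> t \<and> t < s + \<delta> \<and> t \<le> 1 \<longrightarrow> g s \<le> g t"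
  shows "g 0 \<le> g 1"
proof -
  define A where "A = {t\<in>{0..1}. \<forall>s\<in>{0..t}. g 0 \<le> g s}"
  have A0: "0 \<in> A" by (auto simp: A_def)
  have bdd: "bdd_above A" by (rule bdd_aboveI[of _ 1]) (auto simp: A_def)
  define m where "m = Sup A"
  have m: "0 \<le> m" "m \<le> 1"
  proof -
    show "0 \<le> m" unfolding m_def by (rule cSup_upper[OF A0 bdd])
    show "m \<le> 1" unfolding m_def by (rule cSup_least) (use A0 in blast, simp add: A_def)
  qed
  have below: "g 0 \<le> g s" if "0 \<le> s" "s < m" for s
  proof -
    have "A \<noteq> {}" using A0 by auto
    from less_cSupD[OF this that(2)[unfolded m_def]]
    obtain t where "t \<in> A" "s < t" by blast
    then show ?thesis using that by (auto simp: A_def)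
  qed
  have at_m: "g 0 \<le> g m"
  proof (cases "m = 0")
    case False
    then have "0 < m" using m by simp
    have "(g \<longlongrightarrow> g m) (at m within {0..<m})"
      using cont m by (auto simp: continuous_on_def intro: tendsto_within_subset[where S="{0..1}"])
    moreover have "at m within {0..<m} \<noteq> bot"
      using \<open>0 < m\<close> by (simp add: at_within_eq_bot_iff trivial_limit_within islimpt_greaterThanLessThan2)
    moreover have "\<forall>\<^sub>F s in at m within {0..<m}. g 0 \<le> g s"
      using below by (auto simp: eventually_at_filter)
    ultimately show ?thesis by (metis tendsto_lowerbound)
  qed simp
  show ?thesis
  proof (rule ccontr)
    assume "\<not> g 0 \<le> g 1"
    then have "m < 1" using at_m m by (cases "m = 1") auto
    then obtain \<delta> where \<delta>: "\<delta> > 0" "\<And>t. m \<le> t \<Longrightarrow> t < m + \<delta> \<Longrightarrow> t \<le> 1 \<Longrightarrow> g m \<le> g t"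
      using loc m by blast
    define t where "t = min 1 (m + \<delta>/2)"
    have t: "m < t" "t \<le> 1" "t < m + \<delta>" using \<delta> \<open>m<1\<close> by (auto simp: t_def)
    have "t \<in> A"
      unfolding A_def
    proof (intro CollectI conjI ballI)
      fix s assume s: "s \<in> {0..t}"
      show "g 0 \<le> g s"
        using s t below[of s] \<delta>(2)[of s] at_m by (cases "s < m") force+
    qed (use t m in auto)
    then have "t \<le> m" unfolding m_def using bdd by (rule cSup_upper)
    then show False using t by simp
  qed
qed

text \<open>The Monge condition for an arbitrary length function \<open>d\<close> and reference distance \<open>c\<close>.\<close>
definition monge :: "'a::metric_space set \<Rightarrow> ('a \<Rightarrow> 'a \<Rightarrow> real) \<Rightarrow> ('a \<Rightarrow> 'a \<Rightarrow> real) \<Rightarrow> ('a \<Rightarrow> real) \<Rightarrow> bool"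
  where "monge \<Omega> c d u \<longleftrightarrow> continuous_on \<Omega> u \<and>
    (\<forall>x0\<in>\<Omega>. Liminf (at x0 within \<Omega>) (\<lambda>x. ereal ((u x - u x0 + d x0 x) / c x0 x)) = 0)"

text \<open>The properties of the optical length \<open>d\<close> and the Carnot-Caratheodory distance \<open>c\<close> on which the
  stability argument rests. Since the optical length need not be symmetric, its smallness near the
  diagonal is stated in both directions. The function \<open>l\<close> in
  \<open>almost_geodesic\<close> is the \<open>d\<close>-length of the curve up to a given time.\<close>
locale length_structure =
  fixes \<Omega> :: "'a::euclidean_space set" and c d :: "'a \<Rightarrow> 'a \<Rightarrow> real" and \<alpha> :: real
  assumes open_dom: "open \<Omega>"
    and alpha_pos: "0 < \<alpha>"
    and triangle: "\<lbrakk>x \<in> \<Omega>; y \<in> \<Omega>; z \<in> \<Omega>\<rbrakk> \<Longrightarrow> d x z \<le> d x y + d y z"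
    and near_from: "y \<in> \<Omega> \<Longrightarrow> (d y \<longlongrightarrow> 0) (at y within \<Omega>)"
    and near_to: "y \<in> \<Omega> \<Longrightarrow> ((\<lambda>z. d z y) \<longlongrightarrow> 0) (at y within \<Omega>)"
    and comparison_pos: "\<lbrakk>x \<in> \<Omega>; y \<in> \<Omega>; x \<noteq> y\<rbrakk> \<Longrightarrow> 0 < c x y"
    and comparison_nonneg: "\<lbrakk>x \<in> \<Omega>; y \<in> \<Omega>\<rbrakk> \<Longrightarrow> 0 \<le> c x y"
    and comparison_le: "\<lbrakk>x \<in> \<Omega>; y \<in> \<Omega>\<rbrakk> \<Longrightarrow> c x y \<le> \<alpha> * d x y"
    and almost_geodesic: "\<lbrakk>x \<in> \<Omega>; y \<in> \<Omega>; 0 < \<eta>\<rbrakk> \<Longrightarrow>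
      \<exists>\<gamma> l :: real \<Rightarrow> real. continuous_on {0..1} \<gamma> \<and> \<gamma> ` {0..1} \<subseteq> \<Omega> \<and> \<gamma> 0 = x \<and> \<gamma> 1 = y \<and>
        continuous_on {0..1} l \<and>
        (\<forall>s t. 0 \<le> s \<and> s \<le> t \<and> t \<le> 1 \<longrightarrow> d (\<gamma> s) (\<gamma> t) \<le> l t - l s) \<and> l 1 - l 0 \<le> d x y + \<eta>"
begin

lemma d_nonneg: "\<lbrakk>x \<in> \<Omega>; y \<in> \<Omega>\<rbrakk> \<Longrightarrow> 0 \<le> d x y"
  using comparison_le[of x y] comparison_nonneg[of x y] alpha_pos
  by (metis order_trans zero_le_mult_iff not_less)

lemma d_pos: "\<lbrakk>x \<in> \<Omega>; y \<in> \<Omega>; x \<noteq> y\<rbrakk> \<Longrightarrow> 0 < d x y"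
  using comparison_le[of x y] comparison_pos[of x y] alpha_pos
  by (metis less_le_trans zero_less_mult_pos)

lemma continuous_d: 
  assumes x: "x \<in> \<Omega>" 
  shows "continuous_on \<Omega> (d x)"
  unfolding continuous_on_def
proof
  fix y assume y: "y \<in> \<Omega>"
  have up: "((\<lambda>z. d x y + d y z) \<longlongrightarrow> d x y + 0) (at y within \<Omega>)"
    by (intro tendsto_intros near_from y)
  have lo: "((\<lambda>z. d x y - d z y) \<longlongrightarrow> d x y - 0) (at y within \<Omega>)"
    by (intro tendsto_intros near_to y)
  show "(d x \<longlongrightarrow> d x y) (at y within \<Omega>)"
  proof (rule tendsto_sandwich[of "\<lambda>z. d x y - d z y" "d x" _ "\<lambda>z. d x y + d y z"])
    show "\<forall>\<^sub>F z in at y within \<Omega>. d x y - d z y \<le> d x z"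
      using triangle[OF x _ y] by (auto simp: eventually_at_filter algebra_simps)
    show "\<forall>\<^sub>F z in at y within \<Omega>. d x z \<le> d x y + d y z"
      using triangle[OF x y] by (auto simp: eventually_at_filter)
  qed (use up lo in auto)
qed

text \<open>Along an almost minimal curve \<open>\<gamma>\<close> the function \<open>u \<circ> \<gamma> + (1 + \<epsilon> * \<alpha>) * l\<close> increases to the right of
  every point, because \<open>c \<le> \<alpha> * d\<close> converts the error \<open>\<epsilon> * c\<close> of the Monge condition into a small
  multiple of \<open>d\<close>.\<close>
lemma monge_imp_global_subsolution:
  assumes u: "monge \<Omega> c d u" and x: "x \<in> \<Omega>" and y: "y \<in> \<Omega>"
  shows "u x - u y \<le> d x y"
proof -
  have main: "u x - u y \<le> (1 + \<epsilon> * \<alpha>) * (d x y + \<eta>)" if \<epsilon>: "\<epsilon> > 0" and \<eta>: "\<eta> > 0" for \<epsilon> \<eta> :: real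
  proof -
    obtain \<gamma> and l :: "real \<Rightarrow> real" where \<gamma>: "continuous_on {0..1} \<gamma>" "\<gamma> ` {0..1} \<subseteq> \<Omega>" "\<gamma> 0 = x" "\<gamma> 1 = y"
      and l: "continuous_on {0..1} l" "l 1 - l 0 \<le> d x y + \<eta>"
      and dl: "\<And>s t. \<lbrakk>0 \<le> s; s \<le> t; t \<le> 1\<rbrakk> \<Longrightarrow> d (\<gamma> s) (\<gamma> t) \<le> l t - l s"
      using almost_geodesic[OF x y \<eta>] by blast
    have k: "0 < 1 + \<epsilon> * \<alpha>" using \<epsilon> alpha_pos by (simp add: add_pos_pos)
    define g where "g t = u (\<gamma> t) + (1 + \<epsilon> * \<alpha>) * l t" for t
    have "g 0 \<le> g 1"
    proof (rule locally_increasing_imp_le)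
      have "continuous_on {0..1} (\<lambda>t. u (\<gamma> t))"
        using u \<gamma> continuous_on_compose2[of \<Omega> u "{0..1}" \<gamma>] by (auto simp: monge_def)
      then show "continuous_on {0..1} g"
        unfolding g_def by (intro continuous_intros l)
      fix s :: real assume s: "0 \<le> s" "s < 1"
      have gs: "\<gamma> s \<in> \<Omega>" using s \<gamma> by auto
      have "Liminf (at (\<gamma> s) within \<Omega>) (\<lambda>z. ereal ((u z - u (\<gamma> s) + d (\<gamma> s) z) / c (\<gamma> s) z)) = 0"
        using u gs by (auto simp: monge_def)
      then have "\<forall>\<^sub>F z in at (\<gamma> s) within \<Omega>. ereal (-\<epsilon>) < ereal ((u z - u (\<gamma> s) + d (\<gamma> s) z) / c (\<gamma> s) z)"
        using \<epsilon> by (intro less_LiminfD) auto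
      then obtain r where r: "r > 0" and sub: "\<And>z. \<lbrakk>z \<in> \<Omega>; z \<noteq> \<gamma> s; dist z (\<gamma> s) < r\<rbrakk> \<Longrightarrow>
          - \<epsilon> < (u z - u (\<gamma> s) + d (\<gamma> s) z) / c (\<gamma> s) z"
        unfolding eventually_at by auto
      have "\<exists>\<delta>>0. \<forall>t\<in>{0..1}. dist t s < \<delta> \<longrightarrow> dist (\<gamma> t) (\<gamma> s) < r"
        using \<gamma>(1) s r unfolding continuous_on_iff by auto
      then obtain \<delta> where \<delta>: "\<delta> > 0" "\<And>t. \<lbrakk>0 \<le> t; t \<le> 1; dist t s < \<delta>\<rbrakk> \<Longrightarrow> dist (\<gamma> t) (\<gamma> s) < r"
        by auto
      have "g s \<le> g t" if t: "s \<le> t" "t < s + \<delta>" "t \<le> 1" for t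
      proof -
        have gt: "\<gamma> t \<in> \<Omega>" using s t \<gamma> by auto
        have "u (\<gamma> s) - u (\<gamma> t) \<le> (1 + \<epsilon> * \<alpha>) * d (\<gamma> s) (\<gamma> t)"
        proof (cases "\<gamma> t = \<gamma> s")
          case True
          then show ?thesis using d_nonneg[OF gs gt] k by simp
        next
          case False
          have "- \<epsilon> < (u (\<gamma> t) - u (\<gamma> s) + d (\<gamma> s) (\<gamma> t)) / c (\<gamma> s) (\<gamma> t)"
            using sub gt False \<delta>(2)[of t] s t by (auto simp: dist_real_def)
          then have "- \<epsilon> * c (\<gamma> s) (\<gamma> t) < u (\<gamma> t) - u (\<gamma> s) + d (\<gamma> s) (\<gamma> t)"
            using comparison_pos[OF gs gt] False by (simp add: pos_less_divide_eq)
          moreover have "\<epsilon> * c (\<gamma> s) (\<gamma> t) \<le> \<epsilon> * (\<alpha> * d (\<gamma> s) (\<gamma> t))"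
            using comparison_le[OF gs gt] \<epsilon> by simp
          ultimately show ?thesis by (simp add: algebra_simps)
        qed
        also have "\<dots> \<le> (1 + \<epsilon> * \<alpha>) * (l t - l s)"
          using dl s t k by (intro mult_left_mono) auto
        finally show ?thesis by (simp add: g_def algebra_simps)
      qed
      then show "\<exists>\<delta>>0. \<forall>t. s \<le> t \<and> t < s + \<delta> \<and> t \<le> 1 \<longrightarrow> g s \<le> g t"
        using \<delta>(1) by blast
    qed
    then have "u x - u y \<le> (1 + \<epsilon> * \<alpha>) * (l 1 - l 0)"
      using \<gamma> by (simp add: g_def algebra_simps)
    also have "\<dots> \<le> (1 + \<epsilon> * \<alpha>) * (d x y + \<eta>)"
      using l k by (intro mult_left_mono) auto
    finally show ?thesis .
  qed
  have "((\<lambda>\<epsilon>. (1 + \<epsilon> * \<alpha>) * (d x y + \<epsilon>)) \<longlongrightarrow> (1 + 0 * \<alpha>) * (d x y + 0)) (at_right 0)"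
    by (intro tendsto_intros)
  then show ?thesis
    using tendsto_lowerbound[of "\<lambda>\<epsilon>. (1 + \<epsilon> * \<alpha>) * (d x y + \<epsilon>)" "d x y" "at_right 0" "u x - u y"] main
    by (auto simp: eventually_at_filter)
qed

text \<open>Among the points of the ball that are reached from \<open>x\<close> by descending at rate \<open>\<theta>\<close>, take one where \<open>u\<close>
  is minimal. If it were in the open ball, the Monge condition there would give a further descent, and
  by the triangle inequality the new point would still be a competitor.\<close>
lemma monge_imp_sphere_point:
  assumes u: "monge \<Omega> c d u" and r: "0 < r" and ball: "cball x r \<subseteq> \<Omega>" and \<theta>: "0 < \<theta>" "\<theta> < 1"
  obtains y where "dist x y = r" "u y + \<theta> * d x y \<le> u x"
proof -
  have x: "x \<in> \<Omega>" using ball r by auto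
  define S where "S = {z \<in> cball x r. u z + \<theta> * d x z \<le> u x}"
  have cu: "continuous_on (cball x r) u"
    using u ball by (auto simp: monge_def intro: continuous_on_subset)
  have "continuous_on (cball x r) (\<lambda>z. u z + \<theta> * d x z)"
    by (intro continuous_intros cu continuous_on_subset[OF continuous_d[OF x] ball])
  then have "closed S"
    unfolding S_def by (intro continuous_on_closed_Collect_le) auto
  then have "compact S"
    unfolding S_def by (metis (no_types, lifting) compact_cball compact_Int_closed inf.absorb_iff2 mem_Collect_eq subsetI)
  moreover have "x \<in> S"
  proof -
    have "(d x \<longlongrightarrow> d x x) (at x within \<Omega>)" using continuous_d[OF x] x by (auto simp: continuous_on_def)
    then have "d x x = 0"
      using near_from[OF x] x open_dom by (metis at_within_open at_neq_bot tendsto_unique)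
    then show ?thesis using r by (auto simp: S_def)
  qed
  moreover have "continuous_on S u"
    by (rule continuous_on_subset[OF cu]) (auto simp: S_def)
  ultimately have "\<exists>y\<in>S. \<forall>z\<in>S. u y \<le> u z"
    using continuous_attains_inf[of S u] by blast
  then obtain y where y: "y \<in> S" and ymin: "\<And>z. z \<in> S \<Longrightarrow> u y \<le> u z" by blast
  have y\<Omega>: "y \<in> \<Omega>" using y ball by (auto simp: S_def)
  have "dist x y = r"
  proof (rule ccontr)
    assume "dist x y \<noteq> r"
    then have yb: "dist x y < r" using y by (auto simp: S_def)
    \<comment> \<open>With this error the loss \<open>\<epsilon> * c\<close> is at most \<open>\<epsilon> * \<alpha> * d = (1 - \<theta>) * d\<close>.\<close>
    define \<epsilon> where "\<epsilon> = (1 - \<theta>) / \<alpha>"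
    have \<epsilon>: "0 < \<epsilon>" using \<theta> alpha_pos by (simp add: \<epsilon>_def)
    have "Liminf (at y within \<Omega>) (\<lambda>z. ereal ((u z - u y + d y z) / c y z)) = 0"
      using u y\<Omega> by (auto simp: monge_def)
    then have "\<not> (\<forall>\<^sub>F z in at y within \<Omega>. ereal \<epsilon> \<le> ereal ((u z - u y + d y z) / c y z))"
      using \<epsilon> Liminf_bounded[of "ereal \<epsilon>" "\<lambda>z. ereal ((u z - u y + d y z) / c y z)" "at y within \<Omega>"]
      by auto
    then have "\<not> (\<forall>z\<in>\<Omega>. z \<noteq> y \<and> dist z y < r - dist x y \<longrightarrow>
        ereal \<epsilon> \<le> ereal ((u z - u y + d y z) / c y z))"
      using yb unfolding eventually_at by (metis diff_gt_0_iff_gt)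
    then obtain z where z: "z \<in> \<Omega>" "z \<noteq> y" "dist z y < r - dist x y"
      and q: "\<not> ereal \<epsilon> \<le> ereal ((u z - u y + d y z) / c y z)" by blast
    then have q: "(u z - u y + d y z) / c y z < \<epsilon>" by simp
    have "u z - u y + d y z < \<epsilon> * c y z"
      using q comparison_pos[OF y\<Omega> z(1)] z(2) by (simp add: pos_divide_less_eq)
    also have "\<dots> \<le> \<epsilon> * (\<alpha> * d y z)"
      using \<epsilon> comparison_le[OF y\<Omega> z(1)] by simp
    also have "\<dots> = (1 - \<theta>) * d y z" using alpha_pos by (simp add: \<epsilon>_def)
    finally have step: "u z + \<theta> * d y z < u y" by (simp add: algebra_simps)
    have "dist x z \<le> r" using z(3) dist_triangle[of x z y] by (simp add: dist_commute)
    moreover have "\<theta> * d x z \<le> \<theta> * (d x y + d y z)"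
      using \<theta> triangle[OF x y\<Omega> z(1)] by simp
    ultimately have "z \<in> S" using y step by (auto simp: S_def algebra_simps)
    then have "u y \<le> u z" by (rule ymin)
    moreover have "0 < \<theta> * d y z" using d_pos[OF y\<Omega> z(1)] z(2) \<theta> by simp
    ultimately show False using step by simp
  qed
  then show ?thesis using that y by (auto simp: S_def)
qed

end

lemma locally_uniform_limit_pointwise:
  "\<lbrakk>locally_uniform_limit S f l; x \<in> S\<rbrakk> \<Longrightarrow> (\<lambda>j. f j x) \<longlonglongrightarrow> l x"
  unfolding locally_uniform_limit_def by (metis IntI tendsto_uniform_limitI)

text \<open>Local uniform convergence allows the point to move with the index, along a subsequence of the
  functions.\<close>
lemma locally_uniform_limit_diagonal:
  assumes f: "locally_uniform_limit S f l" and r: "strict_mono r"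
    and y: "y \<longlonglongrightarrow> y0" "y0 \<in> S" "\<And>j. y j \<in> S"
    and l: "((\<lambda>j. l (y j)) \<longlongrightarrow> l y0) sequentially"
  shows "(\<lambda>j. f (r j) (y j)) \<longlonglongrightarrow> l y0"
proof -
  obtain U where U: "open U" "y0 \<in> U" "uniform_limit (U \<inter> S) f l sequentially"
    using f y by (auto simp: locally_uniform_limit_def)
  have "(\<lambda>j. f (r j) (y j) - l (y j)) \<longlonglongrightarrow> 0"
  proof (rule tendstoI)
    fix e :: real assume "e > 0"
    then have "\<forall>\<^sub>F n in sequentially. \<forall>x\<in>U \<inter> S. dist (f n x) (l x) < e"
      using U by (auto simp: uniform_limit_iff)
    then have "\<forall>\<^sub>F n in sequentially. \<forall>x\<in>U \<inter> S. dist (f (r n) x) (l x) < e"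
      by (rule eventually_subseq[OF r])
    moreover have "\<forall>\<^sub>F j in sequentially. y j \<in> U"
      using y U topological_tendstoD by blast
    ultimately show "\<forall>\<^sub>F j in sequentially. dist (f (r j) (y j) - l (y j)) 0 < e"
      by eventually_elim (use y in \<open>auto simp: dist_real_def\<close>)
  qed
  from tendsto_add[OF this l] show ?thesis by simp
qed

text \<open>The sphere points supplied for \<open>u j\<close> with the rates \<open>1 - 1 / (j + 2)\<close> accumulate at a sphere point
  where the limit descends at rate 1; there the difference quotient is nonpositive, while the global
  inequality makes it nonnegative everywhere.\<close>
theorem monge_stable:
  fixes \<Omega> :: "'a::euclidean_space set"
  assumes L: "\<And>j. length_structure \<Omega> c (d j) \<alpha>" and L_inf: "length_structure \<Omega> c d_inf \<alpha>"
    and u: "\<And>j. monge \<Omega> c (d j) (u j)"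
    and d_lim: "locally_uniform_limit (\<Omega> \<times> \<Omega>) (\<lambda>j (x, y). d j x y) (\<lambda>(x, y). d_inf x y)"
    and u_inf: "continuous_on \<Omega> u_inf" and u_lim: "locally_uniform_limit \<Omega> u u_inf"
  shows "monge \<Omega> c d_inf u_inf"
proof -
  interpret D: length_structure \<Omega> c d_inf \<alpha> by (rule L_inf)
  have sub: "u_inf x - u_inf y \<le> d_inf x y" if "x \<in> \<Omega>" "y \<in> \<Omega>" for x y
  proof (rule tendsto_le)
    show "(\<lambda>j. d j x y) \<longlonglongrightarrow> d_inf x y"
      using locally_uniform_limit_pointwise[OF d_lim, of "(x, y)"] that by simp
    show "(\<lambda>j. u j x - u j y) \<longlonglongrightarrow> u_inf x - u_inf y"
      by (intro tendsto_diff locally_uniform_limit_pointwise[OF u_lim] that)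
    show "\<forall>\<^sub>F j in sequentially. u j x - u j y \<le> d j x y"
      using length_structure.monge_imp_global_subsolution[OF L u that] by simp
  qed simp
  have sphere: "\<exists>y. dist x y = r \<and> u_inf y + d_inf x y \<le> u_inf x"
    if r: "0 < r" and ball: "cball x r \<subseteq> \<Omega>" for x r
  proof -
    have x: "x \<in> \<Omega>" using ball r by auto
    define \<theta> where "\<theta> j = 1 - inverse (real (Suc (Suc j)))" for j
    have \<theta>: "0 < \<theta> j" "\<theta> j < 1" for j by (auto simp: \<theta>_def field_simps)
    have "\<exists>y. dist x y = r \<and> u j y + \<theta> j * d j x y \<le> u j x" for j
      using length_structure.monge_imp_sphere_point[OF L u r ball \<theta>] by metis
    then obtain y where y: "\<And>j. dist x (y j) = r" "\<And>j. u j (y j) + \<theta> j * d j x (y j) \<le> u j x"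
      by metis
    have "\<forall>j. y j \<in> sphere x r" using y by simp
    then obtain y0 k where y0: "y0 \<in> sphere x r" and k: "strict_mono k" "(y \<circ> k) \<longlonglongrightarrow> y0"
      using compact_sphere[of x r] unfolding compact_def by metis
    have y\<Omega>: "y j \<in> \<Omega>" for j using y(1) ball by auto
    have y0\<Omega>: "y0 \<in> \<Omega>" using y0 ball by auto
    have lim: "(\<lambda>j. f (y (k j))) \<longlonglongrightarrow> f y0" if "continuous_on \<Omega> f" for f :: "'a \<Rightarrow> real"
      using that k(2) y0\<Omega> y\<Omega> continuous_on_tendsto_compose[of \<Omega> f "y \<circ> k" y0 sequentially] by (auto simp: o_def)
    have 1: "(\<lambda>j. u (k j) (y (k j))) \<longlonglongrightarrow> u_inf y0"
      using locally_uniform_limit_diagonal[OF u_lim k(1), of "y \<circ> k" y0] k(2) y0\<Omega> y\<Omega> lim[OF u_inf] by simp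
    have "(\<lambda>j. (x, y (k j))) \<longlonglongrightarrow> (x, y0)"
      using k(2) by (intro tendsto_intros) (simp add: o_def)
    then have 2: "(\<lambda>j. d (k j) x (y (k j))) \<longlonglongrightarrow> d_inf x y0"
      using locally_uniform_limit_diagonal[OF d_lim k(1), of "\<lambda>j. (x, y (k j))" "(x, y0)"] x y0\<Omega> y\<Omega>
        lim[OF D.continuous_d[OF x]] by simp
    have "(\<lambda>j. 1 - inverse (real (Suc (Suc j)))) \<longlonglongrightarrow> 1 - 0"
      by (intro tendsto_intros LIMSEQ_Suc[OF LIMSEQ_inverse_real_of_nat])
    then have 3: "(\<lambda>j. \<theta> (k j)) \<longlonglongrightarrow> 1"
      using LIMSEQ_subseq_LIMSEQ[OF _ k(1), of \<theta> 1] by (simp add: \<theta>_def[abs_def] o_def)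
    have "(\<lambda>j. u (k j) x) \<longlonglongrightarrow> u_inf x"
      using LIMSEQ_subseq_LIMSEQ[OF locally_uniform_limit_pointwise[OF u_lim x] k(1)] by (simp add: o_def)
    moreover have "(\<lambda>j. u (k j) (y (k j)) + \<theta> (k j) * d (k j) x (y (k j))) \<longlonglongrightarrow> u_inf y0 + 1 * d_inf x y0"
      by (intro tendsto_intros 1 2 3)
    ultimately have "u_inf y0 + 1 * d_inf x y0 \<le> u_inf x"
      by (rule tendsto_le[OF sequentially_bot]) (use y in auto)
    then show ?thesis using y0 by auto
  qed
  have "Liminf (at x within \<Omega>) (\<lambda>z. ereal ((u_inf z - u_inf x + d_inf x z) / c x z)) = 0" if x: "x \<in> \<Omega>" for x
  proof (rule antisym)
    show "0 \<le> Liminf (at x within \<Omega>) (\<lambda>z. ereal ((u_inf z - u_inf x + d_inf x z) / c x z))"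
    proof (rule Liminf_bounded)
      have "0 \<le> (u_inf z - u_inf x + d_inf x z) / c x z" if "z \<in> \<Omega>" for z
        using sub[OF x that] D.comparison_nonneg[OF x that] by (intro divide_nonneg_nonneg) auto
      then show "\<forall>\<^sub>F z in at x within \<Omega>. 0 \<le> ereal ((u_inf z - u_inf x + d_inf x z) / c x z)"
        by (auto simp: eventually_at_filter)
    qed
    show "Liminf (at x within \<Omega>) (\<lambda>z. ereal ((u_inf z - u_inf x + d_inf x z) / c x z)) \<le> 0"
    proof (rule ccontr)
      assume "\<not> ?thesis"
      then have "\<forall>\<^sub>F z in at x within \<Omega>. 0 < ereal ((u_inf z - u_inf x + d_inf x z) / c x z)"
        by (intro less_LiminfD) (simp add: not_le)
      then obtain e where e: "e > 0" "\<And>z. \<lbrakk>z \<in> \<Omega>; z \<noteq> x; dist z x < e\<rbrakk> \<Longrightarrow> 0 < (u_inf z - u_inf x + d_inf x z) / c x z"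
        unfolding eventually_at by auto
      obtain r where r: "r > 0" "cball x r \<subseteq> \<Omega>"
        using D.open_dom x open_contains_cball by blast
      define \<rho> where "\<rho> = min r (e/2)"
      have \<rho>: "0 < \<rho>" "cball x \<rho> \<subseteq> \<Omega>" "\<rho> < e" using r e by (auto simp: \<rho>_def)
      obtain y where y: "dist x y = \<rho>" "u_inf y + d_inf x y \<le> u_inf x" using sphere \<rho> by blast
      have "y \<in> \<Omega>" "y \<noteq> x" "dist y x < e" using y \<rho> by (auto simp: dist_commute)
      with e(2)[of y] have "0 < (u_inf y - u_inf x + d_inf x y) / c x y" by blast
      moreover have "0 \<le> c x y" using D.comparison_nonneg x \<open>y \<in> \<Omega>\<close> by blast
      ultimately show False using y(2) by (simp add: zero_less_divide_iff)
    qed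
  qed
  then show ?thesis using u_inf by (auto simp: monge_def)
qed

section \<open>Absolutely continuous curves\<close>

lemma division_sum_length:
  fixes D :: "real set set"
  assumes "D division_of S"
  shows "(\<Sum>K\<in>D. Sup K - Inf K) = measure lebesgue S"
proof -
  have "Sup K - Inf K = measure lebesgue K" if "K \<in> D" for K
  proof -
    obtain a b where "K = cbox a b" "K \<noteq> {}"
      using division_ofD(3,4)[OF assms \<open>K \<in> D\<close>] by blast
    then show ?thesis by simp
  qed
  then show ?thesis using content_division[OF assms] by simp
qed

text \<open>To prove the fundamental theorem of calculus, the Riemann sum of the derivative is compared with the
  increment of the curve, separately over tags where the curve is differentiable and over tags in a null
  set. The first part is controlled by differentiability.\<close>
lemma fine_sum_at_differentiable_tags:
  fixes \<gamma> g :: "real \<Rightarrow> 'a::euclidean_space"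
  assumes p: "p tagged_division_of {a..b}" and ab: "a \<le> b" and e: "0 \<le> e"
    and der: "\<And>x u v. \<lbrakk>(x, cbox u v) \<in> p; x \<notin> N; u \<le> v\<rbrakk> \<Longrightarrow> norm ((v - u) *\<^sub>R g x - (\<gamma> v - \<gamma> u)) \<le> e * (v - u)"
  shows "norm (\<Sum>(x,K)\<in>{(x,K). (x,K) \<in> p \<and> x \<notin> N}. measure lborel K *\<^sub>R g x - (\<gamma> (Sup K) - \<gamma> (Inf K))) \<le> e * (b - a)"
proof -
  let ?p = "{(x,K). (x,K) \<in> p \<and> x \<notin> N}"
  have sub: "?p \<subseteq> p" by auto
  have fin: "finite p" using p by auto
  have "norm (\<Sum>(x,K)\<in>?p. measure lborel K *\<^sub>R g x - (\<gamma> (Sup K) - \<gamma> (Inf K))) \<le> (\<Sum>(x,K)\<in>?p. e * measure lborel K)"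
  proof (rule sum_norm_le, clarify)
    fix x K assume x: "(x, K) \<in> p" "x \<notin> N"
    then obtain u v where K: "K = cbox u v" using tagged_division_ofD(4)[OF p] by blast
    moreover have "x \<in> K" using x tagged_division_ofD(2)[OF p] by blast
    ultimately have "u \<le> v" by auto
    then show "norm (measure lborel K *\<^sub>R g x - (\<gamma> (Sup K) - \<gamma> (Inf K))) \<le> e * measure lborel K"
      using der[of x u v] x K by simp
  qed
  also have "\<dots> \<le> (\<Sum>(x,K)\<in>p. e * measure lborel K)"
    by (rule sum_mono2[OF fin sub]) (use e in auto)
  also have "\<dots> = e * (\<Sum>(x,K)\<in>p. measure lborel K)"
    by (simp add: sum_distrib_left case_prod_unfold)
  also have "(\<Sum>(x,K)\<in>p. measure lborel K) = b - a"
    using additive_content_tagged_division[of p a b] p ab by simp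
  finally show ?thesis .
qed

text \<open>The second part: intervals with tags in the null set lie in an open set of small measure, so
  absolute continuity bounds the sum of the increments. Empty intervals, for which \<open>Sup\<close> and \<open>Inf\<close>
  carry no information, do not occur in a tagged division, which is why the summand may be replaced
  by 0 there.\<close>
lemma abs_continuous_small_sum:
  fixes \<gamma> :: "real \<Rightarrow> 'a::euclidean_space"
  assumes p: "p tagged_partial_division_of {a..b}"
    and ac: "\<And>D S. \<lbrakk>D division_of S; S \<subseteq> {a..b}; (\<Sum>K\<in>D. Sup K - Inf K) < \<delta>\<rbrakk> \<Longrightarrow>
       (\<Sum>K\<in>D. norm (\<gamma> (Sup K) - \<gamma> (Inf K))) < \<epsilon>"
    and U: "U \<in> lmeasurable" "measure lebesgue U < \<delta>" and sub: "\<And>x K. (x,K) \<in> p \<Longrightarrow> K \<subseteq> U"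
  shows "(\<Sum>(x,K)\<in>p. norm (\<gamma> (Sup K) - \<gamma> (Inf K))) < \<epsilon>"
proof -
  let ?f = "\<lambda>K. if K = {} then 0 else norm (\<gamma> (Sup K) - \<gamma> (Inf K))"
  have D: "snd ` p division_of \<Union>(snd ` p)" by (rule partial_division_of_tagged_division[OF p])
  have "(\<Sum>(x,K)\<in>p. norm (\<gamma> (Sup K) - \<gamma> (Inf K))) = (\<Sum>(x,K)\<in>p. ?f K)"
    by (rule sum.cong) (use tagged_partial_division_ofD(2)[OF p] in fastforce)+
  also have "\<dots> = sum ?f (snd ` p)"
  proof (rule sum.over_tagged_division_lemma[OF tagged_partial_division_of_Union_self[OF p]])
    fix u v :: real assume "box u v = {}"
    then have "v \<le> u" by simp
    then show "?f (cbox u v) = 0" by (cases "u = v") auto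
  qed
  also have "\<dots> = (\<Sum>K\<in>snd ` p. norm (\<gamma> (Sup K) - \<gamma> (Inf K)))"
    by (rule sum.cong) (use division_ofD(3)[OF D] in auto)
  also have "\<dots> < \<epsilon>"
  proof (rule ac[OF D])
    show "\<Union>(snd ` p) \<subseteq> {a..b}" using tagged_partial_division_ofD(3)[OF p] by force
    have "\<Union>(snd ` p) \<in> lmeasurable" using lmeasurable_division[OF D] .
    moreover have "\<Union>(snd ` p) \<subseteq> U" using sub by force
    ultimately have "measure lebesgue (\<Union>(snd ` p)) \<le> measure lebesgue U"
      using U(1) by (intro measure_mono_fmeasurable) (auto simp: fmeasurableD)
    then show "(\<Sum>K\<in>snd ` p. Sup K - Inf K) < \<delta>"
      using division_sum_length[OF D] U(2) by simp
  qed
  finally show ?thesis .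
qed

lemma negligible_open_cover:
  fixes N :: "real set"
  assumes "negligible N" "0 < \<delta>"
  obtains U where "open U" "N \<subseteq> U" "U \<in> lmeasurable" "measure lebesgue U < \<delta>"
proof -
  have N: "N \<in> null_sets lebesgue" using assms by (simp add: negligible_iff_null_sets)
  obtain U where U: "open U" "N \<subseteq> U" "U - N \<in> lmeasurable" "emeasure lebesgue (U - N) < ennreal \<delta>"
    using sets_lebesgue_outer_open[of N \<delta>] N assms by blast
  have eq: "emeasure lebesgue (U - N) = emeasure lebesgue U"
    by (rule emeasure_Diff_null_set) (use N U in auto)
  have Um: "U \<in> lmeasurable"
    using U eq by (intro fmeasurableI) (auto intro: order_less_trans)
  moreover have "measure lebesgue U < \<delta>"
    using U(4) eq Um assms(2) by (simp add: emeasure_eq_measure2 ennreal_less_iff)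
  ultimately show ?thesis using that U by blast
qed

text \<open>The fundamental theorem of calculus for absolutely continuous curves, in gauge integral form. The
  gauge is dictated by differentiability outside \<open>N\<close> and by a small open neighbourhood of \<open>N\<close> on \<open>N\<close>.\<close>
proposition abs_continuous_has_integral_derivative:
  fixes \<gamma> g :: "real \<Rightarrow> 'a::euclidean_space"
  assumes ac: "abs_continuous_on {a..b} \<gamma>" and ab: "a \<le> b" and N: "negligible N"
    and der: "\<And>t. \<lbrakk>t \<in> {a..b}; t \<notin> N\<rbrakk> \<Longrightarrow> (\<gamma> has_vector_derivative g t) (at t within {a..b})"
  shows "(g has_integral (\<gamma> b - \<gamma> a)) {a..b}"
proof (cases "a = b")
  case False
  then have "a < b" using ab by simp
  define g' where "g' t = (if t \<in> N then 0 else g t)" for t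
  have "(g' has_integral (\<gamma> b - \<gamma> a)) {a..b}"
    unfolding has_integral_factor_content_real
  proof (intro allI impI)
    fix e :: real assume e: "0 < e"
    define \<epsilon> where "\<epsilon> = e / 2 * (b - a)"
    have \<epsilon>: "0 < \<epsilon>" using e \<open>a < b\<close> by (simp add: \<epsilon>_def)
    obtain \<delta> where \<delta>: "0 < \<delta>" and small: "\<And>D S. \<lbrakk>D division_of S; S \<subseteq> {a..b}; (\<Sum>K\<in>D. Sup K - Inf K) < \<delta>\<rbrakk> \<Longrightarrow>
        (\<Sum>K\<in>D. norm (\<gamma> (Sup K) - \<gamma> (Inf K))) < \<epsilon>"
      using ac \<epsilon> unfolding abs_continuous_on_def by metis
    obtain U where U: "open U" "N \<subseteq> U" "U \<in> lmeasurable" "measure lebesgue U < \<delta>"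
      using negligible_open_cover[OF N \<delta>] .
    have "\<exists>r>0. \<forall>s\<in>{a..b}. \<bar>s - t\<bar> < r \<longrightarrow> norm (\<gamma> s - \<gamma> t - (s - t) *\<^sub>R g t) \<le> e / 2 * \<bar>s - t\<bar>"
      if "t \<in> {a..b}" "t \<notin> N" for t
      using der[OF that] e unfolding has_vector_derivative_def has_derivative_within_alt
      by (metis half_gt_zero real_norm_def)
    then obtain r where r: "\<And>t. \<lbrakk>t \<in> {a..b}; t \<notin> N\<rbrakk> \<Longrightarrow> 0 < r t"
      and rd: "\<And>t s. \<lbrakk>t \<in> {a..b}; t \<notin> N; s \<in> {a..b}; \<bar>s - t\<bar> < r t\<rbrakk> \<Longrightarrow>
        norm (\<gamma> s - \<gamma> t - (s - t) *\<^sub>R g t) \<le> e / 2 * \<bar>s - t\<bar>"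
      by metis
    define d where "d t = (if t \<in> N then U else if t \<in> {a..b} then ball t (r t) else UNIV)" for t
    have gauge: "gauge d" unfolding gauge_def d_def using U r by auto
    have estimate: "norm ((\<Sum>(x,K)\<in>p. measure lborel K *\<^sub>R g' x) - (\<gamma> b - \<gamma> a)) \<le> e * measure lborel {a..b}"
      if p: "p tagged_division_of {a..b}" and fine: "d fine p" for p
    proof -
      note pD = tagged_division_ofD[OF p]
      let ?h = "\<lambda>(x,K). measure lborel K *\<^sub>R g' x - (\<gamma> (Sup K) - \<gamma> (Inf K))"
      let ?N = "{(x,K). (x,K) \<in> p \<and> x \<in> N}" and ?G = "{(x,K). (x,K) \<in> p \<and> x \<notin> N}"
      have "(\<Sum>(x,K)\<in>p. measure lborel K *\<^sub>R g' x) - (\<gamma> b - \<gamma> a) = sum ?h p"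
        unfolding additive_tagged_division_1[OF ab p, of \<gamma>, symmetric]
        by (simp add: sum_subtractf[symmetric] case_prod_unfold)
      also have "\<dots> = sum ?h (?N \<union> ?G)" by (rule arg_cong[where f="sum ?h"]) auto
      also have "\<dots> = sum ?h ?N + sum ?h ?G"
        by (rule sum.union_disjoint) (auto intro: finite_subset[OF _ pD(1)])
      finally have split: "(\<Sum>(x,K)\<in>p. measure lborel K *\<^sub>R g' x) - (\<gamma> b - \<gamma> a) = sum ?h ?N + sum ?h ?G" .
      have "sum ?h ?G = (\<Sum>(x,K)\<in>?G. measure lborel K *\<^sub>R g x - (\<gamma> (Sup K) - \<gamma> (Inf K)))"
        by (rule sum.cong) (auto simp: g'_def)
      also have "norm \<dots> \<le> e / 2 * (b - a)"
      proof (rule fine_sum_at_differentiable_tags[OF p ab])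
        fix x u v assume x: "(x, cbox u v) \<in> p" "x \<notin> N" "u \<le> v"
        have xab: "x \<in> {a..b}" and xuv: "u \<le> x" "x \<le> v" and uv: "u \<in> {a..b}" "v \<in> {a..b}"
          using pD(2,3)[OF x(1)] x(3) by auto
        have "cbox u v \<subseteq> d x"
          using fine x(1) by (auto simp: fine_def)
        then have "cbox u v \<subseteq> ball x (r x)"
          using x(2) xab by (simp add: d_def)
        then have "u \<in> ball x (r x)" "v \<in> ball x (r x)" using x(3) by auto
        then have "\<bar>u - x\<bar> < r x" "\<bar>v - x\<bar> < r x" by (auto simp: dist_real_def)
        moreover have "\<bar>u - x\<bar> = x - u" "\<bar>v - x\<bar> = v - x" using xuv by auto
        ultimately have 1: "norm (\<gamma> u - \<gamma> x - (u - x) *\<^sub>R g x) \<le> e / 2 * (x - u)"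
          and 2: "norm (\<gamma> v - \<gamma> x - (v - x) *\<^sub>R g x) \<le> e / 2 * (v - x)"
          using rd[OF xab x(2) uv(1)] rd[OF xab x(2) uv(2)] by auto
        have "(v - u) *\<^sub>R g x - (\<gamma> v - \<gamma> u) =
            (\<gamma> u - \<gamma> x - (u - x) *\<^sub>R g x) - (\<gamma> v - \<gamma> x - (v - x) *\<^sub>R g x)"
          by (simp add: algebra_simps)
        also have "norm \<dots> \<le> e / 2 * (x - u) + e / 2 * (v - x)"
          using norm_triangle_ineq4 1 2 by (meson add_mono order_trans)
        also have "\<dots> = e / 2 * (v - u)" by (simp only: distrib_left[symmetric]) simp
        finally show "norm ((v - u) *\<^sub>R g x - (\<gamma> v - \<gamma> u)) \<le> e / 2 * (v - u)" .
      qed (use e in auto)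
      finally have G: "norm (sum ?h ?G) \<le> e / 2 * (b - a)" .
      have "norm (sum ?h ?N) \<le> (\<Sum>(x,K)\<in>?N. norm (\<gamma> (Sup K) - \<gamma> (Inf K)))"
        by (rule sum_norm_le) (auto simp: g'_def norm_minus_commute)
      also have "\<dots> < \<epsilon>"
      proof (rule abs_continuous_small_sum[OF _ small U(3,4)])
        show "?N tagged_partial_division_of {a..b}"
          by (rule tagged_partial_division_subset[of p]) (use p in \<open>auto simp: tagged_division_of_def\<close>)
        show "K \<subseteq> U" if "(x, K) \<in> ?N" for x K
        proof -
          have "(x, K) \<in> p" "d x = U" using that by (auto simp: d_def)
          then show ?thesis using fine by (auto simp: fine_def)
        qed
      qed
      finally have "norm (sum ?h ?N) < e / 2 * (b - a)" by (simp add: \<epsilon>_def)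
      then have "norm (sum ?h ?N + sum ?h ?G) \<le> e * (b - a)"
        using G norm_triangle_ineq[of "sum ?h ?N" "sum ?h ?G"] by (simp add: algebra_simps)
      then show ?thesis using split ab by simp
    qed
    show "\<exists>d. gauge d \<and> (\<forall>p. p tagged_division_of {a..b} \<and> d fine p \<longrightarrow>
        norm ((\<Sum>(x,K)\<in>p. measure lborel K *\<^sub>R g' x) - (\<gamma> b - \<gamma> a)) \<le> e * measure lborel {a..b})"
      using gauge by (intro exI[of _ d] conjI allI impI) (assumption, elim conjE, rule estimate)
  qed
  then show ?thesis
    using has_integral_spike[OF N, of "{a..b}" g g'] by (simp add: g'_def)
qed (simp add: has_integral_refl)

lemma lipschitz_imp_abs_continuous:
  fixes \<gamma> :: "real \<Rightarrow> 'a::euclidean_space"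
  assumes L: "L-lipschitz_on {a..b} \<gamma>"
  shows "abs_continuous_on {a..b} \<gamma>"
  unfolding abs_continuous_on_def
proof (intro allI impI)
  fix \<epsilon> :: real assume \<epsilon>: "0 < \<epsilon>"
  have L0: "0 \<le> L" using L by (rule lipschitz_on_nonneg)
  have "(\<Sum>K\<in>D. norm (\<gamma> (Sup K) - \<gamma> (Inf K))) < \<epsilon>"
    if D: "D division_of S" and S: "S \<subseteq> {a..b}" and small: "(\<Sum>K\<in>D. Sup K - Inf K) < \<epsilon> / (L + 1)" for D S
  proof -
    have "(\<Sum>K\<in>D. norm (\<gamma> (Sup K) - \<gamma> (Inf K))) \<le> (\<Sum>K\<in>D. L * (Sup K - Inf K))"
    proof (rule sum_mono)
      fix K assume K: "K \<in> D"
      obtain u v where uv: "K = cbox u v" "K \<noteq> {}" using division_ofD(3,4)[OF D K] by blast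
      then have "u \<le> v" "u \<in> K" "v \<in> K" by auto
      moreover have "K \<subseteq> {a..b}" using division_ofD(2)[OF D K] S by blast
      ultimately have "u \<in> {a..b}" "v \<in> {a..b}" by auto
      then show "norm (\<gamma> (Sup K) - \<gamma> (Inf K)) \<le> L * (Sup K - Inf K)"
        using lipschitz_onD[OF L, of v u] \<open>u \<le> v\<close> uv by (simp add: dist_norm)
    qed
    also have "\<dots> = L * (\<Sum>K\<in>D. Sup K - Inf K)" by (simp add: sum_distrib_left)
    also have "\<dots> \<le> L * (\<epsilon> / (L + 1))" using small L0 by (intro mult_left_mono) auto
    also have "\<dots> < \<epsilon>" using \<epsilon> L0 by (simp add: field_simps)
    finally show ?thesis .
  qed
  then show "\<exists>\<delta>>0. \<forall>D S. D division_of S \<and> S \<subseteq> {a..b} \<and> (\<Sum>K\<in>D. Sup K - Inf K) < \<delta> \<longrightarrow>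
      (\<Sum>K\<in>D. norm (\<gamma> (Sup K) - \<gamma> (Inf K))) < \<epsilon>"
    using \<epsilon> L0 by (intro exI[of _ "\<epsilon> / (L + 1)"]) auto
qed

lemma abs_continuous_imp_continuous:
  fixes \<gamma> :: "real \<Rightarrow> 'a::euclidean_space"
  assumes ac: "abs_continuous_on {a..b} \<gamma>"
  shows "continuous_on {a..b} \<gamma>"
  unfolding continuous_on_iff
proof (intro ballI allI impI)
  fix t and e :: real assume t: "t \<in> {a..b}" and e: "0 < e"
  obtain \<delta> where \<delta>: "0 < \<delta>" and small: "\<And>D S. \<lbrakk>D division_of S; S \<subseteq> {a..b}; (\<Sum>K\<in>D. Sup K - Inf K) < \<delta>\<rbrakk> \<Longrightarrow>
      (\<Sum>K\<in>D. norm (\<gamma> (Sup K) - \<gamma> (Inf K))) < e"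
    using ac e unfolding abs_continuous_on_def by metis
  have "norm (\<gamma> v - \<gamma> u) < e" if "u \<in> {a..b}" "v \<in> {a..b}" "u \<le> v" "v - u < \<delta>" for u v
  proof -
    have "{cbox u v} division_of cbox u v" using that by (intro division_of_self) auto
    from small[OF this] that show ?thesis by auto
  qed
  then have "dist (\<gamma> s) (\<gamma> t) < e" if "s \<in> {a..b}" "dist s t < \<delta>" for s
    using that t by (cases "s \<le> t") (force simp: dist_norm norm_minus_commute)+
  then show "\<exists>d>0. \<forall>s\<in>{a..b}. dist s t < d \<longrightarrow> dist (\<gamma> s) (\<gamma> t) < e"
    using \<delta> by blast
qed

lemma abs_continuous_on_subset: "\<lbrakk>abs_continuous_on I \<gamma>; J \<subseteq> I\<rbrakk> \<Longrightarrow> abs_continuous_on J \<gamma>"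
  unfolding abs_continuous_on_def by (meson order_trans)

section \<open>Lipschitz horizontal curves\<close>

lemma negligible_affine_preimage:
  fixes N :: "real set"
  assumes "negligible N" "c \<noteq> 0"
  shows "negligible {t. c * t + s \<in> N}"
proof -
  have "negligible ((\<lambda>y. (y - s) / c) ` N)"
    by (rule negligible_differentiable_image_negligible)
       (use assms in \<open>auto intro!: derivative_intros simp: differentiable_on_def\<close>)
  moreover have "{t. c * t + s \<in> N} = (\<lambda>y. (y - s) / c) ` N"
    using assms(2) by (force simp: image_iff field_simps)
  ultimately show ?thesis by simp
qed

lemma AE_lebesgue_on_negligible:
  assumes "AE t in lebesgue_on S. P t" "S \<in> sets lebesgue"
  obtains N where "negligible N" "\<And>t. \<lbrakk>t \<in> S; t \<notin> N\<rbrakk> \<Longrightarrow> P t"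
proof -
  have "AE t in lebesgue. t \<in> S \<longrightarrow> P t"
    using assms by (simp add: AE_restrict_space_iff)
  then obtain N where "N \<in> null_sets lebesgue" "{t \<in> space lebesgue. \<not> (t \<in> S \<longrightarrow> P t)} \<subseteq> N"
    by (auto simp: eventually_ae_filter)
  then show ?thesis using that[of N] by (auto simp: negligible_iff_null_sets)
qed

lemma AE_lebesgue_onI:
  assumes "negligible N" "\<And>t. \<lbrakk>t \<in> S; t \<notin> N\<rbrakk> \<Longrightarrow> P t" "S \<in> sets lebesgue"
  shows "AE t in lebesgue_on S. P t"
proof -
  have "AE t in lebesgue. t \<notin> N"
    using assms(1) by (intro AE_not_in) (simp add: negligible_iff_null_sets)
  then have "AE t in lebesgue. t \<in> S \<longrightarrow> P t"
    by eventually_elim (use assms(2) in auto)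
  then show ?thesis using assms(3) by (simp add: AE_restrict_space_iff)
qed

text \<open>The horizontal field with constant coefficients \<open>p\<close>.\<close>
definition hvec :: "('m::finite \<Rightarrow> 'n::finite vfield) \<Rightarrow> real ^ 'm \<Rightarrow> 'n vfield"
  where "hvec Xh p x = (\<Sum>i\<in>UNIV. p $ i *\<^sub>R Xh i x)"

lemma hvec_scaleR: "hvec Xh (c *\<^sub>R p) x = c *\<^sub>R hvec Xh p x"
  by (simp add: hvec_def scaleR_sum_right)

lemma hvec_zero: "hvec Xh 0 x = 0"
  by (simp add: hvec_def)

lemma hvec_bound_on_compact:
  assumes cont: "\<And>i. continuous_on UNIV (Xh i)" and K: "compact K"
  shows "\<exists>M>0. \<forall>x\<in>K. \<forall>p. norm (hvec Xh p x) \<le> M * norm p"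
proof -
  have "continuous_on K (\<lambda>x. \<Sum>i\<in>UNIV. norm (Xh i x))"
    by (intro continuous_intros continuous_on_subset[OF cont]) auto
  then have "bounded ((\<lambda>x. \<Sum>i\<in>UNIV. norm (Xh i x)) ` K)"
    using K compact_continuous_image compact_imp_bounded by blast
  then obtain B where B: "0 < B" "\<And>x. x \<in> K \<Longrightarrow> norm (\<Sum>i\<in>UNIV. norm (Xh i x)) \<le> B"
    unfolding bounded_pos by auto
  have "norm (hvec Xh p x) \<le> B * norm p" if "x \<in> K" for x p
  proof -
    have "norm (hvec Xh p x) \<le> (\<Sum>i\<in>UNIV. norm (p $ i *\<^sub>R Xh i x))"
      unfolding hvec_def by (rule norm_sum)
    also have "\<dots> \<le> (\<Sum>i\<in>UNIV. norm p * norm (Xh i x))"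
      by (intro sum_mono) (simp add: component_le_norm_cart mult_right_mono)
    also have "\<dots> = norm p * (\<Sum>i\<in>UNIV. norm (Xh i x))" by (simp add: sum_distrib_left)
    also have "\<dots> \<le> norm p * B" using B(2)[OF that] by (intro mult_left_mono) auto
    finally show ?thesis by (simp add: mult.commute)
  qed
  then show ?thesis using B(1) by blast
qed

text \<open>A horizontal curve on \<open>{p..q}\<close> that is Lipschitz and whose coefficients are bounded everywhere, not
  only almost everywhere. In contrast to absolute continuity these properties are visibly stable under
  reparametrisation, concatenation and left translation; up to a change of the coefficients on a null
  set no curve is lost (\<open>horizontal_curve_imp_hcurve\<close>).\<close>
definition hcurve :: "('m::finite \<Rightarrow> 'n::finite vfield) \<Rightarrow> (real ^ 'n) set \<Rightarrow> real \<Rightarrow> real \<Rightarrow>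
     (real \<Rightarrow> real ^ 'n) \<Rightarrow> (real \<Rightarrow> real ^ 'm) \<Rightarrow> bool"
  where "hcurve Xh \<Omega> p q \<gamma> a \<longleftrightarrow>
     \<gamma> ` {p..q} \<subseteq> \<Omega> \<and> (\<exists>L. L-lipschitz_on {p..q} \<gamma>) \<and>
     a \<in> borel_measurable (lebesgue_on {p..q}) \<and> (\<exists>C. \<forall>t\<in>{p..q}. norm (a t) \<le> C) \<and>
     (\<exists>N. negligible N \<and> (\<forall>t. p < t \<and> t < q \<and> t \<notin> N \<longrightarrow>
        (\<gamma> has_vector_derivative hvec Xh (a t) (\<gamma> t)) (at t)))"

lemma hcurve_subset: "\<lbrakk>hcurve Xh \<Omega> p q \<gamma> a; \<gamma> ` {p..q} \<subseteq> \<Omega>'\<rbrakk> \<Longrightarrow> hcurve Xh \<Omega>' p q \<gamma> a"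
  by (auto simp: hcurve_def)

lemma hcurve_in: "\<lbrakk>hcurve Xh \<Omega> p q \<gamma> a; p \<le> t; t \<le> q\<rbrakk> \<Longrightarrow> \<gamma> t \<in> \<Omega>"
  by (auto simp: hcurve_def)

lemma hcurve_measurable: "hcurve Xh \<Omega> p q \<gamma> a \<Longrightarrow> a \<in> borel_measurable (lebesgue_on {p..q})"
  by (auto simp: hcurve_def)

lemma hcurve_continuous: "hcurve Xh \<Omega> p q \<gamma> a \<Longrightarrow> continuous_on {p..q} \<gamma>"
  by (auto simp: hcurve_def intro: lipschitz_on_continuous_on)

lemma hcurve_const: "x \<in> \<Omega> \<Longrightarrow> hcurve Xh \<Omega> p q (\<lambda>t. x) (\<lambda>t. 0)"
  unfolding hcurve_def hvec_zero
  by (auto intro!: exI[of _ "0::real"] exI[of _ "{}"] lipschitz_on_constant)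

text \<open>Affine changes of parameter include rescaling, restriction to a subinterval and, for negative \<open>c\<close>,
  reversal.\<close>
lemma hcurve_affine:
  assumes h: "hcurve Xh \<Omega> p q \<gamma> a" and c: "c \<noteq> 0"
    and sub: "\<And>t. \<lbrakk>p' \<le> t; t \<le> q'\<rbrakk> \<Longrightarrow> c * t + s \<in> {p..q}"
  shows "hcurve Xh \<Omega> p' q' (\<lambda>t. \<gamma> (c * t + s)) (\<lambda>t. c *\<^sub>R a (c * t + s))"
  unfolding hcurve_def
proof (intro conjI)
  let ?\<phi> = "\<lambda>t. c * t + s"
  have maps: "?\<phi> \<in> {p'..q'} \<rightarrow> {p..q}" using sub by auto
  show "(\<lambda>t. \<gamma> (?\<phi> t)) ` {p'..q'} \<subseteq> \<Omega>" using h sub by (force simp: hcurve_def)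
  obtain L where L: "L-lipschitz_on {p..q} \<gamma>" using h by (auto simp: hcurve_def)
  have "\<bar>c\<bar>-lipschitz_on {p'..q'} ?\<phi>"
    by (rule lipschitz_onI) (auto simp: dist_real_def abs_mult[symmetric] algebra_simps)
  moreover have "L-lipschitz_on (?\<phi> ` {p'..q'}) \<gamma>"
    by (rule lipschitz_on_subset[OF L]) (use maps in auto)
  ultimately show "\<exists>L. L-lipschitz_on {p'..q'} (\<lambda>t. \<gamma> (?\<phi> t))"
    using lipschitz_on_compose2 by blast
  have "(\<lambda>t. s + c * t) \<in> lebesgue \<rightarrow>\<^sub>M lebesgue"
    using lebesgue_affine_measurable[where c="\<lambda>x::real. c" and t=s] c by simp
  then have "?\<phi> \<in> lebesgue \<rightarrow>\<^sub>M lebesgue" by (simp add: add.commute)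
  then have "?\<phi> \<in> lebesgue_on {p'..q'} \<rightarrow>\<^sub>M lebesgue_on {p..q}"
    using maps by (rule measurable_restrict_space3)
  moreover have "a \<in> borel_measurable (lebesgue_on {p..q})" using h by (auto simp: hcurve_def)
  ultimately have "(\<lambda>t. a (?\<phi> t)) \<in> borel_measurable (lebesgue_on {p'..q'})"
    using measurable_compose by blast
  then show "(\<lambda>t. c *\<^sub>R a (?\<phi> t)) \<in> borel_measurable (lebesgue_on {p'..q'})"
    by (rule borel_measurable_const_scaleR)
  obtain C where C: "\<forall>t\<in>{p..q}. norm (a t) \<le> C" using h by (auto simp: hcurve_def)
  show "\<exists>C. \<forall>t\<in>{p'..q'}. norm (c *\<^sub>R a (?\<phi> t)) \<le> C"
    using C sub by (intro exI[of _ "\<bar>c\<bar> * C"]) (auto intro!: mult_left_mono)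
  obtain N where N: "negligible N"
    and der: "\<And>t. \<lbrakk>p < t; t < q; t \<notin> N\<rbrakk> \<Longrightarrow> (\<gamma> has_vector_derivative hvec Xh (a t) (\<gamma> t)) (at t)"
    using h by (auto simp: hcurve_def)
  \<comment> \<open>The derivative of \<open>\<gamma>\<close> is known only at interior times, so times sent to an end point are exceptional.\<close>
  define N' where "N' = {t. ?\<phi> t \<in> insert p (insert q N)}"
  have "negligible N'" unfolding N'_def
    by (rule negligible_affine_preimage[OF _ c]) (simp add: N)
  moreover have "((\<lambda>t. \<gamma> (?\<phi> t)) has_vector_derivative hvec Xh (c *\<^sub>R a (?\<phi> t)) (\<gamma> (?\<phi> t))) (at t)"
    if "p' < t" "t < q'" "t \<notin> N'" for t
  proof -
    have "p < ?\<phi> t" "?\<phi> t < q" "?\<phi> t \<notin> N" using that sub[of t] by (auto simp: N'_def less_le)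
    from der[OF this] have "(\<gamma> has_vector_derivative hvec Xh (a (?\<phi> t)) (\<gamma> (?\<phi> t))) (at (?\<phi> t))" .
    moreover have "(?\<phi> has_vector_derivative c) (at t)"
      by (auto intro!: derivative_eq_intros simp flip: has_real_derivative_iff_has_vector_derivative)
    ultimately have "(\<gamma> \<circ> ?\<phi> has_vector_derivative c *\<^sub>R hvec Xh (a (?\<phi> t)) (\<gamma> (?\<phi> t))) (at t)"
      by (rule vector_diff_chain_at[rotated])
    then show ?thesis by (simp add: hvec_scaleR o_def)
  qed
  ultimately show "\<exists>N. negligible N \<and> (\<forall>t. p' < t \<and> t < q' \<and> t \<notin> N \<longrightarrow>
      ((\<lambda>t. \<gamma> (?\<phi> t)) has_vector_derivative hvec Xh (c *\<^sub>R a (?\<phi> t)) (\<gamma> (?\<phi> t))) (at t))"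
    by blast
qed

lemma hcurve_sub:
  assumes "hcurve Xh \<Omega> p q \<gamma> a" "p \<le> s" "t \<le> q"
  shows "hcurve Xh \<Omega> s t \<gamma> a"
  using hcurve_affine[OF assms(1), of 1 s t 0] assms by simp

lemma hcurve_concat:
  assumes h1: "hcurve Xh \<Omega> p q \<gamma>1 a1" and h2: "hcurve Xh \<Omega> q r \<gamma>2 a2" and eq: "\<gamma>1 q = \<gamma>2 q"
    and pq: "p \<le> q" "q \<le> r"
  shows "hcurve Xh \<Omega> p r (\<lambda>t. if t \<le> q then \<gamma>1 t else \<gamma>2 t) (\<lambda>t. if t \<le> q then a1 t else a2 t)"
  unfolding hcurve_def
proof (intro conjI)
  let ?\<gamma> = "\<lambda>t. if t \<le> q then \<gamma>1 t else \<gamma>2 t" and ?a = "\<lambda>t. if t \<le> q then a1 t else a2 t"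
  show "?\<gamma> ` {p..r} \<subseteq> \<Omega>" using h1 h2 by (force simp: hcurve_def)
  obtain L1 L2 where "L1-lipschitz_on {p..q} \<gamma>1" "L2-lipschitz_on {q..r} \<gamma>2"
    using h1 h2 by (auto simp: hcurve_def)
  from lipschitz_on_concat_max[OF this eq] show "\<exists>L. L-lipschitz_on {p..r} ?\<gamma>" by blast
  have m: "(\<lambda>t. if t \<in> {p..q} then a1 t else 0) \<in> borel_measurable lebesgue"
      "(\<lambda>t. if t \<in> {q..r} then a2 t else 0) \<in> borel_measurable lebesgue"
    using hcurve_measurable[OF h1] hcurve_measurable[OF h2] by (auto intro: borel_measurable_if_I simp del: atLeastAtMost_iff)
  have "(\<lambda>t. if t \<in> {..q} then (if t \<in> {p..q} then a1 t else 0) else (if t \<in> {q..r} then a2 t else 0))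
      \<in> borel_measurable lebesgue"
    by (rule measurable_If_set[OF m]) auto
  then have "(\<lambda>t. if t \<in> {..q} then (if t \<in> {p..q} then a1 t else 0) else (if t \<in> {q..r} then a2 t else 0))
      \<in> borel_measurable (lebesgue_on {p..r})"
    by (rule measurable_restrict_space1)
  then show "?a \<in> borel_measurable (lebesgue_on {p..r})"
    by (rule measurable_cong[THEN iffD1, rotated]) auto
  obtain C1 C2 where "\<forall>t\<in>{p..q}. norm (a1 t) \<le> C1" "\<forall>t\<in>{q..r}. norm (a2 t) \<le> C2"
    using h1 h2 by (auto simp: hcurve_def)
  then show "\<exists>C. \<forall>t\<in>{p..r}. norm (?a t) \<le> C"
    by (intro exI[of _ "max C1 C2"]) (auto simp: le_max_iff_disj)
  obtain N1 where N1: "negligible N1"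
    "\<And>t. \<lbrakk>p < t; t < q; t \<notin> N1\<rbrakk> \<Longrightarrow> (\<gamma>1 has_vector_derivative hvec Xh (a1 t) (\<gamma>1 t)) (at t)"
    using h1 by (auto simp: hcurve_def)
  obtain N2 where N2: "negligible N2"
    "\<And>t. \<lbrakk>q < t; t < r; t \<notin> N2\<rbrakk> \<Longrightarrow> (\<gamma>2 has_vector_derivative hvec Xh (a2 t) (\<gamma>2 t)) (at t)"
    using h2 by (auto simp: hcurve_def)
  have "(?\<gamma> has_vector_derivative hvec Xh (?a t) (?\<gamma> t)) (at t)"
    if t: "p < t" "t < r" "t \<notin> N1 \<union> N2 \<union> {q}" for t
  proof (cases "t < q")
    case True
    then have "(\<gamma>1 has_vector_derivative hvec Xh (a1 t) (\<gamma>1 t)) (at t)" using N1 t by auto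
    then have "(?\<gamma> has_vector_derivative hvec Xh (a1 t) (\<gamma>1 t)) (at t)"
      by (rule has_vector_derivative_transform_within_open[of _ _ _ "{..<q}"]) (use True in auto)
    then show ?thesis using True by simp
  next
    case False
    then have "q < t" using t by auto
    then have "(\<gamma>2 has_vector_derivative hvec Xh (a2 t) (\<gamma>2 t)) (at t)" using N2 t by auto
    then have "(?\<gamma> has_vector_derivative hvec Xh (a2 t) (\<gamma>2 t)) (at t)"
      by (rule has_vector_derivative_transform_within_open[of _ _ _ "{q<..}"]) (use \<open>q < t\<close> in auto)
    then show ?thesis using \<open>q < t\<close> by simp
  qed
  moreover have "negligible (N1 \<union> N2 \<union> {q})" using N1 N2 by simp
  ultimately show "\<exists>N. negligible N \<and> (\<forall>t. p < t \<and> t < r \<and> t \<notin> N \<longrightarrow>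
      (?\<gamma> has_vector_derivative hvec Xh (?a t) (?\<gamma> t)) (at t))"
    by blast
qed

lemma hcurve_has_integral:
  assumes h: "hcurve Xh \<Omega> p q \<gamma> a" and st: "p \<le> s" "s \<le> t" "t \<le> q"
  shows "((\<lambda>\<tau>. hvec Xh (a \<tau>) (\<gamma> \<tau>)) has_integral (\<gamma> t - \<gamma> s)) {s..t}"
proof -
  obtain L where "L-lipschitz_on {p..q} \<gamma>" using h by (auto simp: hcurve_def)
  then have "L-lipschitz_on {s..t} \<gamma>" by (rule lipschitz_on_subset) (use st in auto)
  then have ac: "abs_continuous_on {s..t} \<gamma>" by (rule lipschitz_imp_abs_continuous)
  obtain N where N: "negligible N"
    and der: "\<And>t. \<lbrakk>p < t; t < q; t \<notin> N\<rbrakk> \<Longrightarrow> (\<gamma> has_vector_derivative hvec Xh (a t) (\<gamma> t)) (at t)"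
    using h by (auto simp: hcurve_def)
  show ?thesis
  proof (rule abs_continuous_has_integral_derivative[OF ac st(2), of "N \<union> {p, q}"])
    show "negligible (N \<union> {p, q})" using N by simp
    show "(\<gamma> has_vector_derivative hvec Xh (a \<tau>) (\<gamma> \<tau>)) (at \<tau> within {s..t})"
      if "\<tau> \<in> {s..t}" "\<tau> \<notin> N \<union> {p, q}" for \<tau>
    proof -
      have "p < \<tau>" "\<tau> < q" "\<tau> \<notin> N" using that st by auto
      then show ?thesis using der has_vector_derivative_at_within by blast
    qed
  qed
qed

lemma hcurve_imp_horizontal_curve:
  assumes h: "hcurve Xh \<Omega> 0 T \<gamma> a"
  shows "horizontal_curve Xh \<Omega> T \<gamma> a"
  unfolding horizontal_curve_def
proof (intro conjI)
  show "\<gamma> ` {0..T} \<subseteq> \<Omega>" using h by (auto simp: hcurve_def)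
  show "abs_continuous_on {0..T} \<gamma>" using h lipschitz_imp_abs_continuous by (auto simp: hcurve_def)
  have sub: "{0<..<T} \<subseteq> {0..T}" by auto
  show "a \<in> borel_measurable (lebesgue_on {0<..<T})"
    using h measurable_restrict_mono[OF _ sub] by (auto simp: hcurve_def)
  obtain C where "\<forall>t\<in>{0..T}. norm (a t) \<le> C" using h by (auto simp: hcurve_def)
  then show "\<exists>C. AE t in lebesgue_on {0<..<T}. norm (a t) \<le> C"
    by (intro exI[of _ C] AE_lebesgue_onI[of "{}"]) auto
  obtain N where N: "negligible N"
    and der: "\<And>t. \<lbrakk>0 < t; t < T; t \<notin> N\<rbrakk> \<Longrightarrow> (\<gamma> has_vector_derivative hvec Xh (a t) (\<gamma> t)) (at t)"
    using h by (auto simp: hcurve_def)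
  show "AE t in lebesgue_on {0<..<T}. (\<gamma> has_vector_derivative (\<Sum>i\<in>UNIV. a t $ i *\<^sub>R Xh i (\<gamma> t))) (at t)"
    by (rule AE_lebesgue_onI[OF N]) (simp_all add: der[unfolded hvec_def])
qed

text \<open>The velocity is essentially bounded because the curve has compact image, so by the fundamental
  theorem of calculus an absolutely continuous horizontal curve is Lipschitz. The coefficients are
  replaced by 0 where they exceed the essential bound.\<close>
lemma horizontal_curve_imp_hcurve:
  assumes cont: "\<And>i. continuous_on UNIV (Xh i)" and h: "horizontal_curve Xh \<Omega> T \<gamma> a"
  obtains a' N where "hcurve Xh \<Omega> 0 T \<gamma> a'" "negligible N" "\<And>t. \<lbrakk>0 < t; t < T; t \<notin> N\<rbrakk> \<Longrightarrow> a' t = a t"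
proof -
  have ac: "abs_continuous_on {0..T} \<gamma>" using h by (auto simp: horizontal_curve_def)
  obtain C where "AE t in lebesgue_on {0<..<T}. norm (a t) \<le> C"
    using h by (auto simp: horizontal_curve_def)
  then obtain N1 where N1: "negligible N1" "\<And>t. \<lbrakk>t \<in> {0<..<T}; t \<notin> N1\<rbrakk> \<Longrightarrow> norm (a t) \<le> C"
    by (rule AE_lebesgue_on_negligible) auto
  have "AE t in lebesgue_on {0<..<T}. (\<gamma> has_vector_derivative (\<Sum>i\<in>UNIV. a t $ i *\<^sub>R Xh i (\<gamma> t))) (at t)"
    using h by (auto simp: horizontal_curve_def)
  then obtain N2 where N2: "negligible N2" "\<And>t. \<lbrakk>t \<in> {0<..<T}; t \<notin> N2\<rbrakk> \<Longrightarrow>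
      (\<gamma> has_vector_derivative hvec Xh (a t) (\<gamma> t)) (at t)"
    by (rule AE_lebesgue_on_negligible) (auto simp: hvec_def)
  define b where "b t = (if t \<in> {0<..<T} then (if norm (a t) \<le> C then a t else 0) else 0)" for t
  have am: "a \<in> borel_measurable (lebesgue_on {0<..<T})"
    using h by (auto simp: horizontal_curve_def)
  then have "(\<lambda>t. if norm (a t) \<le> C then a t else 0) \<in> borel_measurable (lebesgue_on {0<..<T})"
    by measurable
  then have "b \<in> borel_measurable lebesgue"
    unfolding b_def[abs_def] by (rule borel_measurable_if_I) auto
  then have bm: "b \<in> borel_measurable (lebesgue_on {0..T})" by (rule measurable_restrict_space1)
  have bb: "norm (b t) \<le> max C 0" for t by (auto simp: b_def)
  have eq: "b t = a t" if "0 < t" "t < T" "t \<notin> N1" for t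
    using that N1 by (auto simp: b_def)
  define N where "N = N1 \<union> N2 \<union> {0, T}"
  have N: "negligible N" using N1 N2 by (simp add: N_def)
  have der: "(\<gamma> has_vector_derivative hvec Xh (b t) (\<gamma> t)) (at t)" if "t \<in> {0..T}" "t \<notin> N" for t
  proof -
    have t: "0 < t" "t < T" "t \<notin> N1" "t \<notin> N2" using that by (auto simp: N_def less_le)
    then show ?thesis using N2(2)[of t] eq[of t] by simp
  qed
  have "compact (\<gamma> ` {0..T})"
    by (intro compact_continuous_image abs_continuous_imp_continuous ac) auto
  then have "\<exists>M>0. \<forall>x\<in>\<gamma> ` {0..T}. \<forall>p. norm (hvec Xh p x) \<le> M * norm p"
    by (rule hvec_bound_on_compact[OF cont])
  then obtain M where M: "0 < M" "\<And>x p. x \<in> \<gamma> ` {0..T} \<Longrightarrow> norm (hvec Xh p x) \<le> M * norm p"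
    by meson
  have lip: "(M * max C 0)-lipschitz_on {0..T} \<gamma>"
  proof (rule lipschitz_onI)
    have *: "norm (\<gamma> t - \<gamma> s) \<le> M * max C 0 * (t - s)" if st: "s \<in> {0..T}" "t \<in> {0..T}" "s \<le> t" for s t
    proof -
      let ?g = "\<lambda>\<tau>. if \<tau> \<in> N then 0 else hvec Xh (b \<tau>) (\<gamma> \<tau>)"
      have "(?g has_integral (\<gamma> t - \<gamma> s)) {s..t}"
      proof (rule abs_continuous_has_integral_derivative[OF _ st(3) N])
        show "abs_continuous_on {s..t} \<gamma>" by (rule abs_continuous_on_subset[OF ac]) (use st in auto)
        show "(\<gamma> has_vector_derivative ?g \<tau>) (at \<tau> within {s..t})" if "\<tau> \<in> {s..t}" "\<tau> \<notin> N" for \<tau>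
          using der[of \<tau>] that st by (auto intro: has_vector_derivative_at_within)
      qed
      then have "norm (\<gamma> t - \<gamma> s) \<le> M * max C 0 * measure lborel {s..t}"
      proof (rule has_integral_bound_real[rotated 2])
        show "norm (?g \<tau>) \<le> M * max C 0" if "\<tau> \<in> {s..t} - {}" for \<tau>
        proof -
          have "norm (hvec Xh (b \<tau>) (\<gamma> \<tau>)) \<le> M * norm (b \<tau>)"
            by (rule M(2)) (use that st in auto)
          also have "\<dots> \<le> M * max C 0" using bb M(1) by (intro mult_left_mono) auto
          finally show ?thesis using M(1) by simp
        qed
      qed (use M in auto)
      then show ?thesis using st by simp
    qed
    show "dist (\<gamma> s) (\<gamma> t) \<le> M * max C 0 * dist s t" if "s \<in> {0..T}" "t \<in> {0..T}" for s t
      using *[of s t] *[of t s] that by (cases "s \<le> t") (auto simp: dist_norm norm_minus_commute)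
  qed (use M in auto)
  have "hcurve Xh \<Omega> 0 T \<gamma> b"
    unfolding hcurve_def
  proof (intro conjI)
    show "\<gamma> ` {0..T} \<subseteq> \<Omega>" using h by (simp add: horizontal_curve_def)
    show "\<exists>L. L-lipschitz_on {0..T} \<gamma>" using lip by blast
    show "\<exists>C. \<forall>t\<in>{0..T}. norm (b t) \<le> C" using bb by blast
    show "\<exists>N. negligible N \<and> (\<forall>t. 0 < t \<and> t < T \<and> t \<notin> N \<longrightarrow>
        (\<gamma> has_vector_derivative hvec Xh (b t) (\<gamma> t)) (at t))"
      using N der by (intro exI[of _ N]) auto
  qed (rule bm)
  then show ?thesis using that[of b N1] N1 eq by blast
qed

section \<open>Lagrangians and their length functionals\<close>

text \<open>The common properties of the support function of a Hamiltonian and of the Euclidean norm. The lower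
  bound is written without division.\<close>
definition lagrangian :: "'a::topological_space set \<Rightarrow> real \<Rightarrow> ('a \<Rightarrow> 'p::euclidean_space \<Rightarrow> real) \<Rightarrow> bool"
  where "lagrangian \<Omega> \<alpha> L \<longleftrightarrow> 0 < \<alpha> \<and>
     (\<lambda>(x, p). L x p) \<in> borel_measurable (restrict_space borel (\<Omega> \<times> UNIV)) \<and>
     (\<forall>x\<in>\<Omega>. \<forall>p. norm p \<le> \<alpha> * L x p \<and> L x p \<le> \<alpha> * norm p) \<and>
     (\<forall>x\<in>\<Omega>. \<forall>p. \<forall>c>0. L x (c *\<^sub>R p) = c * L x p)"

lemma support_fun_upper:
  assumes "sublevel H x \<subseteq> ball 0 \<alpha>" "\<xi> \<in> sublevel H x"
  shows "inner (- \<xi>) p \<le> support_fun H x p"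
proof -
  have "bdd_above {inner (- \<xi>) p | \<xi>. \<xi> \<in> sublevel H x}"
  proof (rule bdd_aboveI)
    fix y assume "y \<in> {inner (- \<xi>) p | \<xi>. \<xi> \<in> sublevel H x}"
    then obtain \<xi> where \<xi>: "y = inner (- \<xi>) p" "\<xi> \<in> sublevel H x" by blast
    have "inner (- \<xi>) p \<le> norm (- \<xi>) * norm p" by (rule norm_cauchy_schwarz)
    also have "\<dots> \<le> \<alpha> * norm p"
      using assms(1) \<xi>(2) by (intro mult_right_mono) auto
    finally show "y \<le> \<alpha> * norm p" using \<xi> by simp
  qed
  then show ?thesis
    unfolding support_fun_def using assms(2) by (intro cSup_upper) auto
qed

lemma support_fun_least:
  assumes "sublevel H x \<noteq> {}" "\<And>\<xi>. \<xi> \<in> sublevel H x \<Longrightarrow> inner (- \<xi>) p \<le> b"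
  shows "support_fun H x p \<le> b"
  unfolding support_fun_def using assms by (intro cSup_least) auto

text \<open>A closed convex set with interior points is the closure of its interior, hence of the points of a dense
  set \<open>D\<close> in its interior. For countable \<open>D\<close> the right-hand side is visibly measurable in \<open>x\<close>; points
  outside the sublevel set contribute 0, which is harmless since the sublevel set contains 0.\<close>
lemma support_fun_eq_countable_SUP:
  fixes H :: "'a \<Rightarrow> 'p::euclidean_space \<Rightarrow> real"
  assumes Z: "closed (sublevel H x)" "convex (sublevel H x)"
    and \<alpha>: "0 < \<alpha>" "ball 0 (1 / \<alpha>) \<subseteq> sublevel H x" "sublevel H x \<subseteq> ball 0 \<alpha>"
    and D: "closure D = UNIV"
  shows "bdd_above ((\<lambda>\<xi>. if \<xi> \<in> sublevel H x then inner (- \<xi>) p else 0) ` D)"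
    and "support_fun H x p = (SUP \<xi>\<in>D. if \<xi> \<in> sublevel H x then inner (- \<xi>) p else 0)"
proof -
  let ?g = "\<lambda>\<xi>. if \<xi> \<in> sublevel H x then inner (- \<xi>) p else 0"
  have zero: "0 \<in> sublevel H x" using \<alpha> by auto
  have le: "?g \<xi> \<le> support_fun H x p" for \<xi>
    using support_fun_upper[OF \<alpha>(3), of _ p] zero by (metis inner_zero_left minus_zero)
  show bdd: "bdd_above (?g ` D)" using le by (intro bdd_aboveI) blast
  have ne: "D \<noteq> {}" using D by auto
  show "support_fun H x p = (SUP \<xi>\<in>D. ?g \<xi>)"
  proof (rule antisym)
    show "support_fun H x p \<le> (SUP \<xi>\<in>D. ?g \<xi>)"
    proof (rule support_fun_least)
      show "sublevel H x \<noteq> {}" using zero by auto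
      fix \<xi> assume \<xi>: "\<xi> \<in> sublevel H x"
      let ?I = "interior (sublevel H x)"
      have "0 \<in> ?I" by (rule interiorI[of "ball 0 (1 / \<alpha>)"]) (use \<alpha> in auto)
      then have "closure ?I = closure (sublevel H x)"
        using Z(2) by (intro convex_closure_interior) auto
      moreover have "closure (?I \<inter> D) = closure ?I"
        by (rule closure_open_Int_superset) (use D in auto)
      ultimately have "\<xi> \<in> closure (?I \<inter> D)" using \<xi> Z(1) by simp
      moreover have "closure (?I \<inter> D) \<subseteq> {\<xi>. inner (- \<xi>) p \<le> (SUP \<xi>\<in>D. ?g \<xi>)}"
      proof (rule closure_minimal)
        show "closed {\<xi>. inner (- \<xi>) p \<le> (SUP \<xi>\<in>D. ?g \<xi>)}"
          by (intro closed_Collect_le continuous_intros)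
        show "?I \<inter> D \<subseteq> {\<xi>. inner (- \<xi>) p \<le> (SUP \<xi>\<in>D. ?g \<xi>)}"
        proof
          fix \<zeta> assume \<zeta>: "\<zeta> \<in> ?I \<inter> D"
          then have "?g \<zeta> \<le> (SUP \<xi>\<in>D. ?g \<xi>)" by (intro cSUP_upper bdd) auto
          moreover have "\<zeta> \<in> sublevel H x" using \<zeta> interior_subset by blast
          ultimately show "\<zeta> \<in> {\<xi>. inner (- \<xi>) p \<le> (SUP \<xi>\<in>D. ?g \<xi>)}" by simp
        qed
      qed
      ultimately show "inner (- \<xi>) p \<le> (SUP \<xi>\<in>D. ?g \<xi>)" by blast
    qed
    show "(SUP \<xi>\<in>D. ?g \<xi>) \<le> support_fun H x p"
      by (rule cSUP_least[OF ne le])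
  qed
qed

text \<open>Measurability is the delicate point: the Lebesgue integral of a nonmeasurable function would be 0 by
  convention, and the optical length would lose its meaning. A supremum over an uncountable family of
  vectors is reduced to a countable one.\<close>
proposition lagrangian_support_fun:
  fixes H :: "real ^ 'n::finite \<Rightarrow> real ^ 'm::finite \<Rightarrow> real"
  assumes H: "hamiltonian \<Omega> \<alpha> H"
  shows "lagrangian \<Omega> \<alpha> (support_fun H)"
proof -
  have \<alpha>: "0 < \<alpha>" using H by (auto simp: hamiltonian_def)
  have Z: "closed (sublevel H x)" "convex (sublevel H x)" "ball 0 (1 / \<alpha>) \<subseteq> sublevel H x" "sublevel H x \<subseteq> ball 0 \<alpha>"
    if "x \<in> \<Omega>" for x using H that by (auto simp: hamiltonian_def)
  have ne: "sublevel H x \<noteq> {}" if "x \<in> \<Omega>" for x using Z(3)[OF that] \<alpha> by auto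
  obtain D :: "(real ^ 'm) set" where D: "countable D" "closure D = UNIV"
  proof -
    obtain D :: "(real ^ 'm) set" where D: "countable D" "\<And>X. \<lbrakk>open X; X \<noteq> {}\<rbrakk> \<Longrightarrow> \<exists>d\<in>D. d \<in> X"
      using countable_dense_setE by blast
    have "x \<in> closure D" for x
      unfolding closure_iff_nhds_not_empty using D(2) by (metis disjoint_iff interior_subset interiorI open_interior subsetD empty_iff)
    then show ?thesis using that D(1) by blast
  qed
  let ?M = "restrict_space borel (\<Omega> \<times> UNIV) :: ((real ^ 'n) \<times> (real ^ 'm)) measure"
  have meas: "(\<lambda>(x, p). support_fun H x p) \<in> borel_measurable ?M"
  proof -
    let ?g = "\<lambda>\<xi> z. if H (fst z) \<xi> \<le> 0 then inner (- \<xi>) (snd z) else 0"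
    have g: "?g \<xi> \<in> borel_measurable ?M" for \<xi>
    proof -
      have "(\<lambda>z. (fst z, \<xi>)) \<in> borel_measurable (borel :: ((real ^ 'n) \<times> (real ^ 'm)) measure)"
        by (intro borel_measurable_continuous_onI continuous_intros)
      then have "(\<lambda>z. (fst z, \<xi>)) \<in> ?M \<rightarrow>\<^sub>M ?M"
        by (rule measurable_restrict_space3) auto
      moreover have "(\<lambda>(x, p). H x p) \<in> borel_measurable ?M" using H by (auto simp: hamiltonian_def)
      ultimately have Hm: "(\<lambda>z. H (fst z) \<xi>) \<in> borel_measurable ?M"
        using measurable_compose[of "\<lambda>z. (fst z, \<xi>)" ?M ?M "\<lambda>(x, p). H x p" borel] by simp
      have "(\<lambda>z. inner (- \<xi>) (snd z)) \<in> borel_measurable (borel :: ((real ^ 'n) \<times> (real ^ 'm)) measure)"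
        by (intro borel_measurable_continuous_onI continuous_intros)
      then have "(\<lambda>z. inner (- \<xi>) (snd z)) \<in> borel_measurable ?M" by (rule measurable_restrict_space1)
      then show ?thesis using Hm by measurable
    qed
    have "(\<lambda>z. SUP \<xi>\<in>D. ?g \<xi> z) \<in> borel_measurable ?M"
    proof (rule borel_measurable_cSUP[OF D(1) g])
      fix z assume "z \<in> space ?M"
      then have "fst z \<in> \<Omega>" by (auto simp: space_restrict_space)
      from support_fun_eq_countable_SUP(1)[OF Z(1,2)[OF this] \<alpha> Z(3,4)[OF this] D(2), of "snd z"]
      show "bdd_above ((\<lambda>\<xi>. ?g \<xi> z) ` D)" by (simp add: sublevel_def)
    qed
    then show ?thesis
    proof (rule measurable_cong[THEN iffD1, rotated])
      fix z assume "z \<in> space ?M"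
      then have "fst z \<in> \<Omega>" by (auto simp: space_restrict_space)
      from support_fun_eq_countable_SUP(2)[OF Z(1,2)[OF this] \<alpha> Z(3,4)[OF this] D(2), of "snd z"]
      show "(SUP \<xi>\<in>D. ?g \<xi> z) = (case z of (x, p) \<Rightarrow> support_fun H x p)"
        by (simp add: sublevel_def case_prod_beta)
    qed
  qed
  have upper: "support_fun H x p \<le> \<alpha> * norm p" if x: "x \<in> \<Omega>" for x p
  proof (rule support_fun_least[OF ne[OF x]])
    fix \<xi> assume "\<xi> \<in> sublevel H x"
    then have "norm \<xi> \<le> \<alpha>" using Z(4)[OF x] by auto
    moreover have "inner (- \<xi>) p \<le> norm (- \<xi>) * norm p" by (rule norm_cauchy_schwarz)
    ultimately show "inner (- \<xi>) p \<le> \<alpha> * norm p"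
      by (metis mult_right_mono norm_ge_zero norm_minus_cancel order_trans)
  qed
  have lower: "norm p \<le> \<alpha> * support_fun H x p" if x: "x \<in> \<Omega>" for x p
  proof (cases "p = 0")
    case True
    have "0 \<in> sublevel H x" using Z(3)[OF x] \<alpha> by auto
    then show ?thesis using support_fun_upper[OF Z(4)[OF x], of 0 p] True \<alpha> by simp
  next
    case False
    \<comment> \<open>The point of the closed ball of radius \<open>1 / \<alpha>\<close>, which the closed sublevel set contains, in direction \<open>- p\<close>.\<close>
    define \<xi> where "\<xi> = - (1 / (\<alpha> * norm p)) *\<^sub>R p"
    have "closure (ball 0 (1 / \<alpha>)) \<subseteq> sublevel H x"
      using Z(1,3)[OF x] by (rule closure_minimal[rotated])
    then have "cball 0 (1 / \<alpha>) \<subseteq> sublevel H x" using \<alpha> by simp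
    moreover have "\<xi> \<in> cball 0 (1 / \<alpha>)" using \<alpha> False by (simp add: \<xi>_def)
    ultimately have "inner (- \<xi>) p \<le> support_fun H x p"
      using support_fun_upper[OF Z(4)[OF x]] by blast
    moreover have "inner (- \<xi>) p = norm p / \<alpha>"
      using False \<alpha> by (simp add: \<xi>_def dot_square_norm power2_eq_square)
    ultimately show ?thesis using \<alpha> by (simp add: pos_divide_le_eq mult.commute)
  qed
  have sub: "support_fun H x (c *\<^sub>R p) \<le> c * support_fun H x p" if x: "x \<in> \<Omega>" and c: "0 < c" for x p and c :: real
  proof (rule support_fun_least[OF ne[OF x]])
    fix \<xi> assume "\<xi> \<in> sublevel H x"
    from support_fun_upper[OF Z(4)[OF x] this, of p] show "inner (- \<xi>) (c *\<^sub>R p) \<le> c * support_fun H x p"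
      using c by (simp only: inner_scaleR_right) (intro mult_left_mono, auto)
  qed
  have hom: "support_fun H x (c *\<^sub>R p) = c * support_fun H x p" if x: "x \<in> \<Omega>" and c: "0 < c" for x p and c :: real
  proof (rule antisym[OF sub[OF x c]])
    have "support_fun H x (inverse c *\<^sub>R (c *\<^sub>R p)) \<le> inverse c * support_fun H x (c *\<^sub>R p)"
      using c by (intro sub x) auto
    then show "c * support_fun H x p \<le> support_fun H x (c *\<^sub>R p)"
      using c by (simp add: field_simps)
  qed
  show ?thesis
    unfolding lagrangian_def using \<alpha> meas upper lower hom by blast
qed

lemma lagrangian_norm:
  assumes "1 \<le> \<alpha>"
  shows "lagrangian \<Omega> \<alpha> (\<lambda>(x :: real ^ 'n::finite) (p :: real ^ 'm::finite). norm p)"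
proof -
  have "(\<lambda>z. norm (snd z)) \<in> borel_measurable (borel :: ((real ^ 'n) \<times> (real ^ 'm)) measure)"
    by (intro borel_measurable_continuous_onI continuous_intros)
  then have "(\<lambda>(x, p). norm p) \<in> borel_measurable (restrict_space (borel :: ((real ^ 'n) \<times> (real ^ 'm)) measure) (\<Omega> \<times> UNIV))"
    unfolding case_prod_beta by (rule measurable_restrict_space1)
  moreover have "norm p \<le> \<alpha> * norm p" for p :: "real ^ 'm"
    using assms mult_right_mono[of 1 \<alpha> "norm p"] by simp
  ultimately show ?thesis using assms by (simp add: lagrangian_def)
qed

lemma lagrangian_along_measurable:
  fixes L :: "real ^ 'n::finite \<Rightarrow> real ^ 'm::finite \<Rightarrow> real"
  assumes L: "lagrangian \<Omega> \<alpha> L" and \<gamma>: "continuous_on S \<gamma>" "\<gamma> ` S \<subseteq> \<Omega>"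
    and a: "a \<in> borel_measurable (lebesgue_on S)" and S: "S \<in> sets lebesgue"
  shows "(\<lambda>t. L (\<gamma> t) (a t)) \<in> borel_measurable (lebesgue_on S)"
proof -
  have "\<gamma> \<in> borel_measurable (lebesgue_on S)"
    by (rule continuous_imp_measurable_on_sets_lebesgue[OF \<gamma>(1) S])
  then have "(\<lambda>t. (\<gamma> t, a t)) \<in> borel_measurable (lebesgue_on S)"
    using a by (rule borel_measurable_Pair)
  then have "(\<lambda>t. (\<gamma> t, a t)) \<in> lebesgue_on S \<rightarrow>\<^sub>M restrict_space borel (\<Omega> \<times> UNIV)"
    using \<gamma>(2) by (intro measurable_restrict_space2) auto
  moreover have "(\<lambda>(x, p). L x p) \<in> borel_measurable (restrict_space borel (\<Omega> \<times> UNIV))"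
    using L by (simp add: lagrangian_def)
  ultimately show ?thesis
    using measurable_compose[of "\<lambda>t. (\<gamma> t, a t)" _ _ "\<lambda>(x, p). L x p" borel] by simp
qed

lemma lagrangian_le: "\<lbrakk>lagrangian \<Omega> \<alpha> L; x \<in> \<Omega>\<rbrakk> \<Longrightarrow> L x p \<le> \<alpha> * norm p"
  and norm_le_lagrangian: "\<lbrakk>lagrangian \<Omega> \<alpha> L; x \<in> \<Omega>\<rbrakk> \<Longrightarrow> norm p \<le> \<alpha> * L x p"
  and lagrangian_scaleR: "\<lbrakk>lagrangian \<Omega> \<alpha> L; x \<in> \<Omega>; 0 < c\<rbrakk> \<Longrightarrow> L x (c *\<^sub>R p) = c * L x p"
  and lagrangian_alpha_pos: "lagrangian \<Omega> \<alpha> L \<Longrightarrow> 0 < \<alpha>"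
  by (auto simp: lagrangian_def)

lemma lagrangian_nonneg: "\<lbrakk>lagrangian \<Omega> \<alpha> L; x \<in> \<Omega>\<rbrakk> \<Longrightarrow> 0 \<le> L x p"
  using norm_le_lagrangian[of \<Omega> \<alpha> L x p] lagrangian_alpha_pos[of \<Omega> \<alpha> L]
  by (metis norm_ge_zero order_trans zero_le_mult_iff not_less)

lemma lagrangian_zero:
  assumes "lagrangian \<Omega> \<alpha> L" "x \<in> \<Omega>"
  shows "L x 0 = 0"
  using lagrangian_le[OF assms, of 0] lagrangian_nonneg[OF assms, of 0] by simp

lemma cost_absolutely_integrable:
  fixes L :: "real ^ 'n::finite \<Rightarrow> real ^ 'm::finite \<Rightarrow> real"
  assumes L: "lagrangian \<Omega> \<alpha> L" and h: "hcurve Xh \<Omega> p q \<gamma> a"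
  shows "(\<lambda>t. L (\<gamma> t) (a t)) absolutely_integrable_on {p..q}"
proof -
  obtain C where C: "\<forall>t\<in>{p..q}. norm (a t) \<le> C" using h by (auto simp: hcurve_def)
  show ?thesis
  proof (rule measurable_bounded_by_integrable_imp_absolutely_integrable[where g="\<lambda>t. \<alpha> * C"])
    show "(\<lambda>t. L (\<gamma> t) (a t)) \<in> borel_measurable (lebesgue_on {p..q})"
      by (rule lagrangian_along_measurable[OF L hcurve_continuous[OF h] _ hcurve_measurable[OF h]])
        (use h in \<open>auto simp: hcurve_def\<close>)
    fix t assume t: "t \<in> {p..q}"
    then have g: "\<gamma> t \<in> \<Omega>" using hcurve_in[OF h] by simp
    have "L (\<gamma> t) (a t) \<le> \<alpha> * norm (a t)" by (rule lagrangian_le[OF L g])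
    also have "\<dots> \<le> \<alpha> * C" using C t lagrangian_alpha_pos[OF L] by (intro mult_left_mono) auto
    finally show "norm (L (\<gamma> t) (a t)) \<le> \<alpha> * C" using lagrangian_nonneg[OF L g] by simp
  qed (auto intro: integrable_const_ivl)
qed

lemma cost_integrable:
  fixes L :: "real ^ 'n::finite \<Rightarrow> real ^ 'm::finite \<Rightarrow> real"
  assumes "lagrangian \<Omega> \<alpha> L" "hcurve Xh \<Omega> p q \<gamma> a"
  shows "(\<lambda>t. L (\<gamma> t) (a t)) integrable_on {p..q}"
  using cost_absolutely_integrable[OF assms] set_lebesgue_integral_eq_integral(1) by blast

lemma cost_nonneg:
  fixes L :: "real ^ 'n::finite \<Rightarrow> real ^ 'm::finite \<Rightarrow> real"
  assumes "lagrangian \<Omega> \<alpha> L" "hcurve Xh \<Omega> p q \<gamma> a"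
  shows "0 \<le> integral {p..q} (\<lambda>t. L (\<gamma> t) (a t))"
  by (rule integral_nonneg[OF cost_integrable[OF assms]])
    (use lagrangian_nonneg[OF assms(1)] hcurve_in[OF assms(2)] in auto)

text \<open>Links the Lebesgue integral over the open interval, for coefficients given almost everywhere, with the
  gauge integral over the closed interval, which is more convenient for splitting and rescaling.\<close>
lemma cost_eq_lebesgue_integral:
  fixes L :: "real ^ 'n::finite \<Rightarrow> real ^ 'm::finite \<Rightarrow> real"
  assumes L: "lagrangian \<Omega> \<alpha> L" and h: "hcurve Xh \<Omega> 0 T \<gamma> a"
    and b: "b \<in> borel_measurable (lebesgue_on {0<..<T})"
    and N: "negligible N" "\<And>t. \<lbrakk>0 < t; t < T; t \<notin> N\<rbrakk> \<Longrightarrow> a t = b t"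
  shows "(LINT t|lebesgue_on {0<..<T}. L (\<gamma> t) (b t)) = integral {0..T} (\<lambda>t. L (\<gamma> t) (a t))"
proof -
  have sub: "{0<..<T} \<subseteq> {0..T}" by auto
  have \<gamma>: "continuous_on {0<..<T} \<gamma>" "\<gamma> ` {0<..<T} \<subseteq> \<Omega>"
    using hcurve_continuous[OF h] continuous_on_subset[OF _ sub] h by (auto simp: hcurve_def)
  have am: "a \<in> borel_measurable (lebesgue_on {0<..<T})"
    using hcurve_measurable[OF h] measurable_restrict_mono[OF _ sub] by blast
  have "(LINT t|lebesgue_on {0<..<T}. L (\<gamma> t) (b t)) = (LINT t|lebesgue_on {0<..<T}. L (\<gamma> t) (a t))"
  proof (rule integral_cong_AE)
    show "AE t in lebesgue_on {0<..<T}. L (\<gamma> t) (b t) = L (\<gamma> t) (a t)"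
      by (rule AE_lebesgue_onI[OF N(1)]) (use N in auto)
  qed (auto intro!: lagrangian_along_measurable[OF L \<gamma>] am b)
  also have "\<dots> = integral {0<..<T} (\<lambda>t. L (\<gamma> t) (a t))"
  proof (rule lebesgue_integral_eq_integral)
    have "(\<lambda>t. L (\<gamma> t) (a t)) absolutely_integrable_on {0<..<T}"
      by (rule set_integrable_subset[OF cost_absolutely_integrable[OF L h]]) auto
    then show "integrable (lebesgue_on {0<..<T}) (\<lambda>t. L (\<gamma> t) (a t))"
      by (rule absolutely_integrable_imp_integrable) auto
  qed auto
  also have "\<dots> = integral {0..T} (\<lambda>t. L (\<gamma> t) (a t))"
    by (rule integral_open_interval_real[symmetric])
  finally show ?thesis .
qed

text \<open>Positive homogeneity makes the length independent of the speed.\<close>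
lemma cost_affine:
  fixes L :: "real ^ 'n::finite \<Rightarrow> real ^ 'm::finite \<Rightarrow> real"
  assumes L: "lagrangian \<Omega> \<alpha> L" and h: "hcurve Xh \<Omega> p q \<gamma> a" and c: "0 < c"
  shows "integral {(p - s) / c..(q - s) / c} (\<lambda>t. L (\<gamma> (c * t + s)) (c *\<^sub>R a (c * t + s))) =
    integral {p..q} (\<lambda>t. L (\<gamma> t) (a t))"
proof -
  let ?I = "integral {p..q} (\<lambda>t. L (\<gamma> t) (a t))"
  have "((\<lambda>t. L (\<gamma> t) (a t)) has_integral ?I) (cbox p q)"
    using integrable_integral[OF cost_integrable[OF L h]] by simp
  from has_integral_affinity'[OF this c, of s]
  have "((\<lambda>t. L (\<gamma> (c * t + s)) (a (c * t + s))) has_integral ?I / c) {(p - s) / c..(q - s) / c}"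
    by (simp add: divide_inverse mult.commute)
  from has_integral_mult_right[OF this, of c]
  have I: "((\<lambda>t. c * L (\<gamma> (c * t + s)) (a (c * t + s))) has_integral ?I) {(p - s) / c..(q - s) / c}"
    using c by simp
  have eq: "c * L (\<gamma> (c * t + s)) (a (c * t + s)) = L (\<gamma> (c * t + s)) (c *\<^sub>R a (c * t + s))"
    if "t \<in> {(p - s) / c..(q - s) / c}" for t
  proof -
    have "p \<le> c * t + s" "c * t + s \<le> q" using that c by (auto simp: field_simps)
    then show ?thesis using lagrangian_scaleR[OF L hcurve_in[OF h] c] by metis
  qed
  have "((\<lambda>t. L (\<gamma> (c * t + s)) (c *\<^sub>R a (c * t + s))) has_integral ?I) {(p - s) / c..(q - s) / c}"
    by (rule has_integral_eq[OF eq I])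
  then show ?thesis by (rule integral_unique)
qed

text \<open>The set of lengths whose infimum is the optical length; it is kept separate because the infimum is
  meaningful only once the set is known to be nonempty.\<close>
definition costs :: "('m::finite \<Rightarrow> 'n::finite vfield) \<Rightarrow> (real ^ 'n) set \<Rightarrow> (real ^ 'n \<Rightarrow> real ^ 'm \<Rightarrow> real) \<Rightarrow>
    real ^ 'n \<Rightarrow> real ^ 'n \<Rightarrow> real set"
  where "costs Xh \<Omega> L x y = {integral {0..1} (\<lambda>t. L (\<gamma> t) (a t)) | \<gamma> a.
     hcurve Xh \<Omega> 0 1 \<gamma> a \<and> \<gamma> 0 = x \<and> \<gamma> 1 = y}"

lemma optical_length_eq_Inf_costs:
  assumes cont: "\<And>i. continuous_on UNIV (Xh i)" and H: "hamiltonian \<Omega> \<alpha> H"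
  shows "optical_length Xh \<Omega> H x y = Inf (costs Xh \<Omega> (support_fun H) x y)"
proof -
  note L = lagrangian_support_fun[OF H]
  have "{(LINT t|lebesgue_on {0<..<1}. support_fun H (\<gamma> t) (a t)) | \<gamma> a.
      horizontal_curve Xh \<Omega> 1 \<gamma> a \<and> \<gamma> 0 = x \<and> \<gamma> 1 = y} = costs Xh \<Omega> (support_fun H) x y" (is "?A = ?B")
  proof
    show "?A \<subseteq> ?B"
    proof
      fix v assume "v \<in> ?A"
      then obtain \<gamma> a where v: "v = (LINT t|lebesgue_on {0<..<1}. support_fun H (\<gamma> t) (a t))"
        and h: "horizontal_curve Xh \<Omega> 1 \<gamma> a" and ends: "\<gamma> 0 = x" "\<gamma> 1 = y" by blast
      obtain a' N where a': "hcurve Xh \<Omega> 0 1 \<gamma> a'" "negligible N" "\<And>t. \<lbrakk>0 < t; t < 1; t \<notin> N\<rbrakk> \<Longrightarrow> a' t = a t"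
        using horizontal_curve_imp_hcurve[OF cont h] by metis
      have "a \<in> borel_measurable (lebesgue_on {0<..<1})" using h by (simp add: horizontal_curve_def)
      from cost_eq_lebesgue_integral[OF L a'(1) this a'(2,3)]
      have "v = integral {0..1} (\<lambda>t. support_fun H (\<gamma> t) (a' t))" using v by simp
      then show "v \<in> ?B" unfolding costs_def using a'(1) ends by blast
    qed
    show "?B \<subseteq> ?A"
    proof
      fix v assume "v \<in> ?B"
      then obtain \<gamma> a where v: "v = integral {0..1} (\<lambda>t. support_fun H (\<gamma> t) (a t))"
        and h: "hcurve Xh \<Omega> 0 1 \<gamma> a" and ends: "\<gamma> 0 = x" "\<gamma> 1 = y" unfolding costs_def by blast
      have hc: "horizontal_curve Xh \<Omega> 1 \<gamma> a" by (rule hcurve_imp_horizontal_curve[OF h])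
      then have "a \<in> borel_measurable (lebesgue_on {0<..<1})" by (simp add: horizontal_curve_def)
      from cost_eq_lebesgue_integral[OF L h this, of "{}"]
      have "v = (LINT t|lebesgue_on {0<..<1}. support_fun H (\<gamma> t) (a t))" using v by simp
      then show "v \<in> ?A" using hc ends by blast
    qed
  qed
  then show ?thesis by (simp add: optical_length_def)
qed

lemma Inf_costs_le:
  fixes L :: "real ^ 'n::finite \<Rightarrow> real ^ 'm::finite \<Rightarrow> real"
  assumes L: "lagrangian \<Omega> \<alpha> L" and h: "hcurve Xh \<Omega> p q \<gamma> a" and pq: "p < q"
  shows "integral {p..q} (\<lambda>t. L (\<gamma> t) (a t)) \<in> costs Xh \<Omega> L (\<gamma> p) (\<gamma> q)"
    and "Inf (costs Xh \<Omega> L (\<gamma> p) (\<gamma> q)) \<le> integral {p..q} (\<lambda>t. L (\<gamma> t) (a t))"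
proof -
  let ?c = "q - p"
  have c: "0 < ?c" using pq by simp
  have eq: "integral {0..1} (\<lambda>t. L (\<gamma> (?c * t + p)) (?c *\<^sub>R a (?c * t + p))) = integral {p..q} (\<lambda>t. L (\<gamma> t) (a t))"
    using cost_affine[OF L h c, of p] pq by simp
  have "hcurve Xh \<Omega> 0 1 (\<lambda>t. \<gamma> (?c * t + p)) (\<lambda>t. ?c *\<^sub>R a (?c * t + p))"
  proof (rule hcurve_affine[OF h])
    fix t :: real assume "0 \<le> t" "t \<le> 1"
    then have "0 \<le> ?c * t" "?c * t \<le> ?c * 1" using c by (auto intro: mult_left_mono simp del: mult_1_right)
    then show "?c * t + p \<in> {p..q}" by simp
  qed (use c in simp)
  then show mem: "integral {p..q} (\<lambda>t. L (\<gamma> t) (a t)) \<in> costs Xh \<Omega> L (\<gamma> p) (\<gamma> q)"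
    unfolding costs_def eq[symmetric] by force
  have "bdd_below (costs Xh \<Omega> L (\<gamma> p) (\<gamma> q))"
    by (rule bdd_belowI[of _ 0]) (use cost_nonneg[OF L] in \<open>auto simp: costs_def\<close>)
  then show "Inf (costs Xh \<Omega> L (\<gamma> p) (\<gamma> q)) \<le> integral {p..q} (\<lambda>t. L (\<gamma> t) (a t))"
    by (rule cInf_lower[OF mem])
qed

lemma Inf_costs_self:
  fixes L :: "real ^ 'n::finite \<Rightarrow> real ^ 'm::finite \<Rightarrow> real"
  assumes L: "lagrangian \<Omega> \<alpha> L" and x: "x \<in> \<Omega>"
  shows "Inf (costs Xh \<Omega> L x x) \<le> 0"
  using Inf_costs_le(2)[OF L hcurve_const[OF x, of Xh], of 0 1] lagrangian_zero[OF L x] by simp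

lemma Inf_costs_approx:
  assumes "costs Xh \<Omega> L x y \<noteq> {}" "0 < \<eta>"
  obtains \<gamma> a where "hcurve Xh \<Omega> 0 1 \<gamma> a" "\<gamma> 0 = x" "\<gamma> 1 = y"
    "integral {0..1} (\<lambda>t. L (\<gamma> t) (a t)) < Inf (costs Xh \<Omega> L x y) + \<eta>"
proof -
  have "\<exists>v\<in>costs Xh \<Omega> L x y. v < Inf (costs Xh \<Omega> L x y) + \<eta>"
    using assms by (intro cInf_lessD) auto
  then show ?thesis using that unfolding costs_def by blast
qed

lemma Inf_costs_triangle:
  fixes L :: "real ^ 'n::finite \<Rightarrow> real ^ 'm::finite \<Rightarrow> real"
  assumes L: "lagrangian \<Omega> \<alpha> L" and ne: "costs Xh \<Omega> L x y \<noteq> {}" "costs Xh \<Omega> L y z \<noteq> {}"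
  shows "Inf (costs Xh \<Omega> L x z) \<le> Inf (costs Xh \<Omega> L x y) + Inf (costs Xh \<Omega> L y z)"
proof (rule field_le_epsilon)
  fix e :: real assume e: "0 < e"
  then have e2: "0 < e / 2" by simp
  obtain \<gamma> a where 1: "hcurve Xh \<Omega> 0 1 \<gamma> a" "\<gamma> 0 = x" "\<gamma> 1 = y"
    "integral {0..1} (\<lambda>t. L (\<gamma> t) (a t)) < Inf (costs Xh \<Omega> L x y) + e / 2"
    using Inf_costs_approx[OF ne(1) e2] .
  obtain \<beta> b where 2: "hcurve Xh \<Omega> 0 1 \<beta> b" "\<beta> 0 = y" "\<beta> 1 = z"
    "integral {0..1} (\<lambda>t. L (\<beta> t) (b t)) < Inf (costs Xh \<Omega> L y z) + e / 2"
    using Inf_costs_approx[OF ne(2) e2] .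
  have h2: "hcurve Xh \<Omega> 1 2 (\<lambda>t. \<beta> (1 * t + -1)) (\<lambda>t. 1 *\<^sub>R b (1 * t + -1))"
    by (rule hcurve_affine[OF 2(1)]) auto
  have i2: "integral {1..2} (\<lambda>t. L (\<beta> (1 * t + -1)) (1 *\<^sub>R b (1 * t + -1))) = integral {0..1} (\<lambda>t. L (\<beta> t) (b t))"
    using cost_affine[OF L 2(1), of 1 "-1"] by simp
  let ?\<gamma> = "\<lambda>t. if t \<le> 1 then \<gamma> t else \<beta> (1 * t + -1)" and ?a = "\<lambda>t. if t \<le> 1 then a t else 1 *\<^sub>R b (1 * t + -1)"
  have h: "hcurve Xh \<Omega> 0 2 ?\<gamma> ?a"
    by (rule hcurve_concat[OF 1(1) h2]) (use 1 2 in auto)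
  have "((\<lambda>t. L (?\<gamma> t) (?a t)) has_integral integral {0..1} (\<lambda>t. L (\<gamma> t) (a t)) + integral {0..1} (\<lambda>t. L (\<beta> t) (b t))) {0..2}"
  proof (rule has_integral_combine[of 0 1 2])
    show "((\<lambda>t. L (?\<gamma> t) (?a t)) has_integral integral {0..1} (\<lambda>t. L (\<gamma> t) (a t))) {0..1}"
      by (rule has_integral_eq[OF _ integrable_integral[OF cost_integrable[OF L 1(1)]]]) auto
    show "((\<lambda>t. L (?\<gamma> t) (?a t)) has_integral integral {0..1} (\<lambda>t. L (\<beta> t) (b t))) {1..2}"
      unfolding i2[symmetric]
      by (rule has_integral_spike[OF negligible_sing[of 1] _ integrable_integral[OF cost_integrable[OF L h2]]]) auto
  qed auto
  then have "integral {0..2} (\<lambda>t. L (?\<gamma> t) (?a t)) = integral {0..1} (\<lambda>t. L (\<gamma> t) (a t)) + integral {0..1} (\<lambda>t. L (\<beta> t) (b t))"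
    by (rule integral_unique)
  moreover have "Inf (costs Xh \<Omega> L x z) \<le> integral {0..2} (\<lambda>t. L (?\<gamma> t) (?a t))"
    using Inf_costs_le(2)[OF L h] 1 2 by simp
  ultimately show "Inf (costs Xh \<Omega> L x z) \<le> Inf (costs Xh \<Omega> L x y) + Inf (costs Xh \<Omega> L y z) + e"
    using 1(4) 2(4) by simp
qed

section \<open>The length structure of a horizontally connected domain\<close>

abbreviation (input) hlength :: "(real \<Rightarrow> real ^ 'm::finite) \<Rightarrow> real \<Rightarrow> real \<Rightarrow> real"
  where "hlength a p q \<equiv> integral {p..q} (\<lambda>t. norm (a t))"

lemma hcurve_norm_integrable:
  assumes "hcurve Xh \<Omega> p q \<gamma> a"
  shows "(\<lambda>t. norm (a t)) integrable_on {p..q}"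
  using cost_integrable[OF lagrangian_norm[of 1] assms] by simp

text \<open>A horizontal curve that leaves the ball of radius \<open>\<delta>\<close> has length at least \<open>\<delta> / M\<close>: until the first exit
  time \<open>\<tau>\<close> its Euclidean speed is at most \<open>M\<close> times its horizontal speed.\<close>
lemma hcurve_escape_length:
  assumes M: "0 < M" "\<And>z p. z \<in> cball x r \<Longrightarrow> norm (hvec Xh p z) \<le> M * norm p"
    and h: "hcurve Xh \<Omega> p q \<gamma> a" and x: "\<gamma> p = x" and s: "p \<le> s" "s \<le> q"
    and \<delta>: "0 < \<delta>" "\<delta> \<le> r" "\<delta> \<le> dist x (\<gamma> s)"
  shows "\<delta> \<le> M * hlength a p q"
proof -
  have cont: "continuous_on {p..q} \<gamma>" by (rule hcurve_continuous[OF h])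
  define S where "S = {t \<in> {p..q}. \<delta> \<le> dist x (\<gamma> t)}"
  have "closed S"
    unfolding S_def by (intro continuous_on_closed_Collect_le continuous_intros cont)
  moreover have "bounded S" by (rule bounded_subset[of "{p..q}"]) (auto simp: S_def)
  ultimately have "compact S" using compact_eq_bounded_closed by blast
  moreover have "S \<noteq> {}" using s \<delta> by (auto simp: S_def)
  ultimately obtain \<tau> where \<tau>: "\<tau> \<in> S" "\<And>t. t \<in> S \<Longrightarrow> \<tau> \<le> t"
    using compact_attains_inf by metis
  have \<tau>pq: "p \<le> \<tau>" "\<tau> \<le> q" "\<delta> \<le> dist x (\<gamma> \<tau>)" using \<tau>(1) by (auto simp: S_def)
  have before: "\<gamma> s \<in> cball x r" if "p \<le> s" "s < \<tau>" for s
  proof (rule ccontr)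
    assume "\<gamma> s \<notin> cball x r"
    then have "s \<in> S" using that \<tau>pq \<delta> by (simp add: S_def)
    then show False using \<tau>(2)[of s] that by simp
  qed
  \<comment> \<open>At the exit time itself the point is not known to lie in the ball where \<open>M\<close> is a bound.\<close>
  let ?f = "\<lambda>s. if s = \<tau> then 0 else hvec Xh (a s) (\<gamma> s)"
  have f: "(?f has_integral (\<gamma> \<tau> - \<gamma> p)) {p..\<tau>}"
    by (rule has_integral_spike[OF negligible_sing[of \<tau>] _ hcurve_has_integral[OF h order_refl \<tau>pq(1,2)]]) simp
  have g: "(\<lambda>s. M * norm (a s)) integrable_on {p..q}"
    using integrable_on_cmult_left[OF hcurve_norm_integrable[OF h], of M] by simp
  have g': "(\<lambda>s. M * norm (a s)) integrable_on {p..\<tau>}"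
    by (rule integrable_subinterval_real[OF g]) (use \<tau>pq in auto)
  have "norm (integral {p..\<tau>} ?f) \<le> integral {p..\<tau>} (\<lambda>s. M * norm (a s))"
  proof (rule integral_norm_bound_integral)
    show "?f integrable_on {p..\<tau>}" using f by (rule has_integral_integrable)
    show "norm (?f s) \<le> M * norm (a s)" if "s \<in> {p..\<tau>}" for s
      using M(2)[OF before[of s], of "a s"] M(1) that by (cases "s = \<tau>") auto
  qed (rule g')
  also have "\<dots> \<le> integral {p..q} (\<lambda>s. M * norm (a s))"
    by (rule integral_subset_le[OF _ g' g]) (use \<tau>pq M in auto)
  also have "\<dots> = M * hlength a p q" by simp
  finally have "norm (\<gamma> \<tau> - \<gamma> p) \<le> M * hlength a p q" using integral_unique[OF f] by simp
  then show ?thesis using \<tau>pq(3) x by (simp add: dist_norm norm_minus_commute)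
qed

abbreviation (input) cc_lengths :: "('m::finite \<Rightarrow> 'n::finite vfield) \<Rightarrow> (real ^ 'n) set \<Rightarrow> real ^ 'n \<Rightarrow> real ^ 'n \<Rightarrow> real set"
  where "cc_lengths Xh \<Omega> x y \<equiv> {(LINT t|lebesgue_on {0<..<T}. norm (a t)) | T \<gamma> a.
            0 < T \<and> horizontal_curve Xh \<Omega> T \<gamma> a \<and>
            (AE t in lebesgue_on {0<..<T}. norm (a t) \<le> 1) \<and> \<gamma> 0 = x \<and> \<gamma> T = y}"

lemma cc_lengths_nonneg: "v \<in> cc_lengths Xh \<Omega> x y \<Longrightarrow> 0 \<le> v"
  by (auto intro!: integral_nonneg_AE)

text \<open>Slowing a curve down by the bound \<open>C\<close> of its coefficients makes it sub-unit and keeps its length.\<close>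
lemma hlength_in_cc_lengths:
  fixes a :: "real \<Rightarrow> real ^ 'm::finite"
  assumes h: "hcurve Xh \<Omega> p q \<gamma> a" and pq: "p < q"
  shows "hlength a p q \<in> cc_lengths Xh \<Omega> (\<gamma> p) (\<gamma> q)"
proof -
  obtain C where C: "\<forall>t\<in>{p..q}. norm (a t) \<le> C" using h by (auto simp: hcurve_def)
  define c where "c = 1 / max C 1"
  have c: "0 < c" by (simp add: c_def)
  define T where "T = (q - p) / c"
  have T: "0 < T" using c pq by (simp add: T_def)
  have cT: "c * T + p = q" using c by (simp add: T_def)
  let ?\<gamma> = "\<lambda>t. \<gamma> (c * t + p)" and ?a = "\<lambda>t. c *\<^sub>R a (c * t + p)"
  have maps: "c * t + p \<in> {p..q}" if "0 \<le> t" "t \<le> T" for t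
    using that c by (auto simp: T_def field_simps)
  have h': "hcurve Xh \<Omega> 0 T ?\<gamma> ?a"
    by (rule hcurve_affine[OF h]) (use c maps in auto)
  have unit: "norm (?a t) \<le> 1" if "0 < t" "t < T" for t
  proof -
    have "norm (a (c * t + p)) \<le> max C 1" using C maps[of t] that by (force simp: le_max_iff_disj)
    then show ?thesis by (simp add: c_def divide_le_eq)
  qed
  have hc: "horizontal_curve Xh \<Omega> T ?\<gamma> ?a" by (rule hcurve_imp_horizontal_curve[OF h'])
  have L: "lagrangian \<Omega> 1 (\<lambda>(x :: real ^ 'a) (p :: real ^ 'm). norm p)" by (rule lagrangian_norm) simp
  have "(LINT t|lebesgue_on {0<..<T}. norm (?a t)) = integral {0..T} (\<lambda>t. norm (?a t))"
    by (rule cost_eq_lebesgue_integral[OF L h', of _ "{}"]) (use hc in \<open>auto simp: horizontal_curve_def\<close>)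
  also have "\<dots> = hlength a p q"
    using cost_affine[OF L h c, of p] by (simp add: T_def)
  finally have "hlength a p q = (LINT t|lebesgue_on {0<..<T}. norm (?a t))" by simp
  moreover have "AE t in lebesgue_on {0<..<T}. norm (?a t) \<le> 1"
    by (rule AE_lebesgue_onI[of "{}"]) (use unit in auto)
  ultimately show ?thesis
    using T hc cT by (intro CollectI exI[of _ T] exI[of _ ?\<gamma>] exI[of _ ?a]) simp
qed

lemma cc_dist_le_hlength:
  assumes h: "hcurve Xh \<Omega> p q \<gamma> a" and pq: "p < q"
  shows "cc_dist Xh \<Omega> (\<gamma> p) (\<gamma> q) \<le> hlength a p q"
  unfolding cc_dist_def
  by (rule cInf_lower[OF hlength_in_cc_lengths[OF h pq]]) (rule bdd_belowI[of _ 0], rule cc_lengths_nonneg)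

lemma cc_dist_nonneg:
  assumes "costs Xh \<Omega> L x y \<noteq> {}"
  shows "0 \<le> cc_dist Xh \<Omega> x y"
proof -
  obtain \<gamma> a where h: "hcurve Xh \<Omega> 0 1 \<gamma> a" "\<gamma> 0 = x" "\<gamma> 1 = y" using assms by (auto simp: costs_def)
  have "cc_lengths Xh \<Omega> x y \<noteq> {}" using hlength_in_cc_lengths[OF h(1)] h by auto
  then show ?thesis unfolding cc_dist_def by (rule cInf_greatest) (rule cc_lengths_nonneg)
qed

text \<open>Every curve from \<open>x\<close> to \<open>y\<close> leaves the open Euclidean ball around \<open>x\<close> through \<open>y\<close>.\<close>
lemma cc_dist_pos:
  assumes cont: "\<And>i. continuous_on UNIV (Xh i)" and ne: "costs Xh \<Omega> L x y \<noteq> {}" and xy: "x \<noteq> y"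
  shows "0 < cc_dist Xh \<Omega> x y"
proof -
  let ?\<delta> = "dist x y"
  have \<delta>: "0 < ?\<delta>" using xy by simp
  obtain M where M: "0 < M" "\<And>z p. z \<in> cball x ?\<delta> \<Longrightarrow> norm (hvec Xh p z) \<le> M * norm p"
    using hvec_bound_on_compact[of Xh, OF cont compact_cball] by meson
  obtain \<gamma> a where h: "hcurve Xh \<Omega> 0 1 \<gamma> a" "\<gamma> 0 = x" "\<gamma> 1 = y" using ne by (auto simp: costs_def)
  have nonempty: "cc_lengths Xh \<Omega> x y \<noteq> {}" using hlength_in_cc_lengths[OF h(1)] h by auto
  have "?\<delta> / M \<le> cc_dist Xh \<Omega> x y"
    unfolding cc_dist_def
  proof (rule cInf_greatest[OF nonempty])
    fix v assume "v \<in> cc_lengths Xh \<Omega> x y"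
    then obtain T \<gamma> a where v: "v = (LINT t|lebesgue_on {0<..<T}. norm (a t))" and T: "0 < T"
      and hc: "horizontal_curve Xh \<Omega> T \<gamma> a" and ends: "\<gamma> 0 = x" "\<gamma> T = y" by blast
    obtain a' N where a': "hcurve Xh \<Omega> 0 T \<gamma> a'" "negligible N" "\<And>t. \<lbrakk>0 < t; t < T; t \<notin> N\<rbrakk> \<Longrightarrow> a' t = a t"
      using horizontal_curve_imp_hcurve[OF cont hc] by metis
    have "v = hlength a' 0 T"
      unfolding v using hc a'
      by (intro cost_eq_lebesgue_integral[OF lagrangian_norm[of 1]]) (auto simp: horizontal_curve_def)
    moreover have "?\<delta> \<le> M * hlength a' 0 T"
      by (rule hcurve_escape_length[OF M a'(1) ends(1), where s=T]) (use T \<delta> ends in auto)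
    ultimately show "?\<delta> / M \<le> v" using M(1) by (simp add: divide_le_eq mult.commute)
  qed
  moreover have "0 < ?\<delta> / M" using \<delta> M by simp
  ultimately show ?thesis by linarith
qed

lemma cc_dist_le_Inf_costs:
  fixes L :: "real ^ 'n::finite \<Rightarrow> real ^ 'm::finite \<Rightarrow> real"
  assumes L: "lagrangian \<Omega> \<alpha> L" and ne: "costs Xh \<Omega> L x y \<noteq> {}"
  shows "cc_dist Xh \<Omega> x y \<le> \<alpha> * Inf (costs Xh \<Omega> L x y)"
proof -
  have \<alpha>: "0 < \<alpha>" by (rule lagrangian_alpha_pos[OF L])
  have "cc_dist Xh \<Omega> x y / \<alpha> \<le> Inf (costs Xh \<Omega> L x y)"
  proof (rule cInf_greatest[OF ne])
    fix v assume "v \<in> costs Xh \<Omega> L x y"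
    then obtain \<gamma> a where v: "v = integral {0..1} (\<lambda>t. L (\<gamma> t) (a t))" and h: "hcurve Xh \<Omega> 0 1 \<gamma> a"
      and ends: "\<gamma> 0 = x" "\<gamma> 1 = y" by (auto simp: costs_def)
    have "cc_dist Xh \<Omega> x y \<le> hlength a 0 1" using cc_dist_le_hlength[OF h] ends by simp
    also have "\<dots> \<le> integral {0..1} (\<lambda>t. \<alpha> * L (\<gamma> t) (a t))"
    proof (rule integral_le[OF hcurve_norm_integrable[OF h]])
      show "(\<lambda>t. \<alpha> * L (\<gamma> t) (a t)) integrable_on {0..1}"
        using integrable_on_cmult_left[OF cost_integrable[OF L h], of \<alpha>] by simp
      show "norm (a t) \<le> \<alpha> * L (\<gamma> t) (a t)" if "t \<in> {0..1}" for t
        using norm_le_lagrangian[OF L] hcurve_in[OF h] that by simp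
    qed
    also have "\<dots> = \<alpha> * v" by (simp add: v)
    finally show "cc_dist Xh \<Omega> x y / \<alpha> \<le> v" using \<alpha> by (simp add: divide_le_eq mult.commute)
  qed
  then show ?thesis using \<alpha> by (simp add: divide_le_eq mult.commute)
qed

text \<open>The points joined to \<open>x\<close> by sub-unit horizontal curves in \<open>\<Omega>\<close> in time less than \<open>\<epsilon>\<close>; for
  \<open>\<Omega> = UNIV\<close> this is the Carnot-Caratheodory ball.\<close>
definition reachable :: "('m::finite \<Rightarrow> 'n::finite vfield) \<Rightarrow> (real ^ 'n) set \<Rightarrow> real ^ 'n \<Rightarrow> real \<Rightarrow> (real ^ 'n) set"
  where "reachable Xh \<Omega> x \<epsilon> = {y. \<exists>T \<gamma> a. 0 < T \<and> T < \<epsilon> \<and> hcurve Xh \<Omega> 0 T \<gamma> a \<and>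
     (\<forall>t\<in>{0..T}. norm (a t) \<le> 1) \<and> \<gamma> 0 = x \<and> \<gamma> T = y}"

lemma reachableI:
  "\<lbrakk>hcurve Xh \<Omega> 0 T \<gamma> a; 0 < T; T < \<epsilon>; \<And>t. \<lbrakk>0 \<le> t; t \<le> T\<rbrakk> \<Longrightarrow> norm (a t) \<le> 1\<rbrakk> \<Longrightarrow> \<gamma> T \<in> reachable Xh \<Omega> (\<gamma> 0) \<epsilon>"
  unfolding reachable_def by (intro CollectI exI[of _ T] exI[of _ \<gamma>] exI[of _ a]) auto

lemma reachableE:
  assumes "y \<in> reachable Xh \<Omega> x \<epsilon>"
  obtains T \<gamma> a where "0 < T" "T < \<epsilon>" "hcurve Xh \<Omega> 0 T \<gamma> a" "\<And>t. \<lbrakk>0 \<le> t; t \<le> T\<rbrakk> \<Longrightarrow> norm (a t) \<le> 1"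
    "\<gamma> 0 = x" "\<gamma> T = y"
  using assms unfolding reachable_def by force

lemma reachable_mono: "\<epsilon> \<le> \<epsilon>' \<Longrightarrow> reachable Xh \<Omega> x \<epsilon> \<subseteq> reachable Xh \<Omega> x \<epsilon>'"
  unfolding reachable_def using less_le_trans by blast

lemma reachable_refl: "\<lbrakk>x \<in> \<Omega>; 0 < \<epsilon>\<rbrakk> \<Longrightarrow> x \<in> reachable Xh \<Omega> x \<epsilon>"
  using reachableI[OF hcurve_const, of x \<Omega> "\<epsilon> / 2" \<epsilon> Xh] by simp

lemma reachable_sym:
  assumes "y \<in> reachable Xh \<Omega> x \<epsilon>"
  shows "x \<in> reachable Xh \<Omega> y \<epsilon>"
proof -
  obtain T \<gamma> a where *: "0 < T" "T < \<epsilon>" "hcurve Xh \<Omega> 0 T \<gamma> a" "\<And>t. \<lbrakk>0 \<le> t; t \<le> T\<rbrakk> \<Longrightarrow> norm (a t) \<le> 1"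
    "\<gamma> 0 = x" "\<gamma> T = y" using reachableE[OF assms] by metis
  have "hcurve Xh \<Omega> 0 T (\<lambda>t. \<gamma> (- 1 * t + T)) (\<lambda>t. - 1 *\<^sub>R a (- 1 * t + T))"
    by (rule hcurve_affine[OF *(3)]) auto
  from reachableI[OF this *(1,2)] *(4-6) show ?thesis by simp
qed

lemma reachable_trans:
  assumes "y \<in> reachable Xh \<Omega> x \<epsilon>" "z \<in> reachable Xh \<Omega> y \<delta>"
  shows "z \<in> reachable Xh \<Omega> x (\<epsilon> + \<delta>)"
proof -
  obtain T \<gamma> a where 1: "0 < T" "T < \<epsilon>" "hcurve Xh \<Omega> 0 T \<gamma> a" "\<And>t. \<lbrakk>0 \<le> t; t \<le> T\<rbrakk> \<Longrightarrow> norm (a t) \<le> 1"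
    "\<gamma> 0 = x" "\<gamma> T = y" using reachableE[OF assms(1)] by metis
  obtain S \<beta> b where 2: "0 < S" "S < \<delta>" "hcurve Xh \<Omega> 0 S \<beta> b" "\<And>t. \<lbrakk>0 \<le> t; t \<le> S\<rbrakk> \<Longrightarrow> norm (b t) \<le> 1"
    "\<beta> 0 = y" "\<beta> S = z" using reachableE[OF assms(2)] by metis
  have h2: "hcurve Xh \<Omega> T (T + S) (\<lambda>t. \<beta> (1 * t + - T)) (\<lambda>t. 1 *\<^sub>R b (1 * t + - T))"
    by (rule hcurve_affine[OF 2(3)]) auto
  have "hcurve Xh \<Omega> 0 (T + S) (\<lambda>t. if t \<le> T then \<gamma> t else \<beta> (1 * t + - T))
      (\<lambda>t. if t \<le> T then a t else 1 *\<^sub>R b (1 * t + - T))"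
    by (rule hcurve_concat[OF 1(3) h2]) (use 1 2 in auto)
  from reachableI[OF this, of "\<epsilon> + \<delta>"] show ?thesis using 1 2 by simp
qed

lemma reachable_imp_costs:
  fixes L :: "real ^ 'n::finite \<Rightarrow> real ^ 'm::finite \<Rightarrow> real"
  assumes L: "lagrangian \<Omega> \<alpha> L" and y: "y \<in> reachable Xh \<Omega> x \<epsilon>"
  shows "costs Xh \<Omega> L x y \<noteq> {}" and "Inf (costs Xh \<Omega> L x y) \<le> \<alpha> * \<epsilon>"
proof -
  obtain T \<gamma> a where *: "0 < T" "T < \<epsilon>" "hcurve Xh \<Omega> 0 T \<gamma> a" "\<And>t. \<lbrakk>0 \<le> t; t \<le> T\<rbrakk> \<Longrightarrow> norm (a t) \<le> 1"
    "\<gamma> 0 = x" "\<gamma> T = y" using reachableE[OF y] by metis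
  have \<alpha>: "0 < \<alpha>" by (rule lagrangian_alpha_pos[OF L])
  show "costs Xh \<Omega> L x y \<noteq> {}" using Inf_costs_le(1)[OF L *(3,1)] * by auto
  have "Inf (costs Xh \<Omega> L x y) \<le> integral {0..T} (\<lambda>t. L (\<gamma> t) (a t))"
    using Inf_costs_le(2)[OF L *(3,1)] * by simp
  also have "\<dots> \<le> integral {0..T} (\<lambda>t. \<alpha>)"
  proof (rule integral_le[OF cost_integrable[OF L *(3)]])
    fix t assume t: "t \<in> {0..T}"
    have "L (\<gamma> t) (a t) \<le> \<alpha> * norm (a t)"
      using lagrangian_le[OF L hcurve_in[OF *(3)]] t by simp
    also have "\<dots> \<le> \<alpha> * 1" using *(4) t \<alpha> by (intro mult_left_mono) auto
    finally show "L (\<gamma> t) (a t) \<le> \<alpha>" by simp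
  qed (rule integrable_const_ivl)
  also have "\<dots> = \<alpha> * T" using *(1) by simp
  also have "\<dots> \<le> \<alpha> * \<epsilon>" using *(2) \<alpha> by (intro mult_left_mono) auto
  finally show "Inf (costs Xh \<Omega> L x y) \<le> \<alpha> * \<epsilon>" .
qed

lemma reachable_localize:
  fixes Xh :: "'m::finite \<Rightarrow> 'n::finite vfield"
  assumes cont: "\<And>i. continuous_on UNIV (Xh i)" and r: "0 < r"
  shows "\<exists>\<epsilon>>0. \<forall>\<delta>\<le>\<epsilon>. reachable Xh UNIV x \<delta> \<subseteq> reachable Xh (ball x r) x \<delta>"
proof -
  obtain M where M: "0 < M" "\<And>z p. z \<in> cball x r \<Longrightarrow> norm (hvec Xh p z) \<le> M * norm p"
    using hvec_bound_on_compact[of Xh, OF cont compact_cball] by meson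
  have "reachable Xh UNIV x \<delta> \<subseteq> reachable Xh (ball x r) x \<delta>" if \<delta>: "\<delta> \<le> r / M" for \<delta>
  proof
    fix y assume "y \<in> reachable Xh UNIV x \<delta>"
    then obtain T \<gamma> a where *: "0 < T" "T < \<delta>" "hcurve Xh UNIV 0 T \<gamma> a" "\<And>t. \<lbrakk>0 \<le> t; t \<le> T\<rbrakk> \<Longrightarrow> norm (a t) \<le> 1"
      "\<gamma> 0 = x" "\<gamma> T = y" using reachableE by metis
    have "hlength a 0 T \<le> integral {0..T} (\<lambda>t. 1)"
      by (rule integral_le[OF hcurve_norm_integrable[OF *(3)] integrable_const_ivl]) (use *(4) in auto)
    then have len: "M * hlength a 0 T \<le> M * T" using *(1) M(1) by (intro mult_left_mono) auto
    have "\<gamma> t \<in> ball x r" if t: "0 \<le> t" "t \<le> T" for t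
    proof (rule ccontr)
      assume "\<gamma> t \<notin> ball x r"
      then have "r \<le> dist x (\<gamma> t)" by simp
      from hcurve_escape_length[OF M *(3,5) t r order_refl this] len have "r \<le> M * T" by simp
      moreover have "M * T < M * (r / M)" using *(2) \<delta> M(1) by (intro mult_strict_left_mono) auto
      ultimately show False using M(1) by simp
    qed
    then have "hcurve Xh (ball x r) 0 T \<gamma> a" by (intro hcurve_subset[OF *(3)]) auto
    from reachableI[OF this *(1,2) *(4)] show "y \<in> reachable Xh (ball x r) x \<delta>" using *(5,6) by simp
  qed
  then show ?thesis using r M(1) by (intro exI[of _ "r / M"]) auto
qed

lemma reachable_subset: "\<Omega> \<subseteq> \<Omega>' \<Longrightarrow> reachable Xh \<Omega> x \<epsilon> \<subseteq> reachable Xh \<Omega>' x \<epsilon>"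
proof
  fix y assume "\<Omega> \<subseteq> \<Omega>'" "y \<in> reachable Xh \<Omega> x \<epsilon>"
  moreover from this(2) obtain T \<gamma> a where *: "0 < T" "T < \<epsilon>" "hcurve Xh \<Omega> 0 T \<gamma> a" "\<And>t. \<lbrakk>0 \<le> t; t \<le> T\<rbrakk> \<Longrightarrow> norm (a t) \<le> 1"
      "\<gamma> 0 = x" "\<gamma> T = y" using reachableE by metis
  ultimately have "hcurve Xh \<Omega>' 0 T \<gamma> a" by (intro hcurve_subset[OF *(3)]) (auto simp: hcurve_def)
  from reachableI[OF this *(1,2) *(4)] show "y \<in> reachable Xh \<Omega>' x \<epsilon>" using *(5,6) by simp
qed

text \<open>Once small Carnot-Caratheodory balls are Euclidean neighbourhoods, they can be found inside \<open>\<Omega>\<close>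
  (\<open>reachable_localize\<close>). Horizontal connectedness of the domain is then open and an equivalence
  relation, hence global, and both one-sided distances tend to 0 at the diagonal because horizontal
  curves can be reversed.\<close>
proposition length_structure_Inf_costs:
  fixes Xh :: "'m::finite \<Rightarrow> 'n::finite vfield"
  assumes cont: "\<And>i. continuous_on UNIV (Xh i)"
    and chow: "\<And>x \<epsilon>. 0 < \<epsilon> \<Longrightarrow> \<exists>\<delta>>0. ball x \<delta> \<subseteq> reachable Xh UNIV x \<epsilon>"
    and \<Omega>: "open \<Omega>" "connected \<Omega>" and L: "lagrangian \<Omega> \<alpha> L"
  shows "length_structure \<Omega> (cc_dist Xh \<Omega>) (\<lambda>x y. Inf (costs Xh \<Omega> L x y)) \<alpha>"
proof -
  have \<alpha>: "0 < \<alpha>" by (rule lagrangian_alpha_pos[OF L])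
  have local: "\<exists>\<delta>>0. ball x \<delta> \<subseteq> reachable Xh \<Omega> x \<epsilon>" if x: "x \<in> \<Omega>" and \<epsilon>: "0 < \<epsilon>" for x \<epsilon>
  proof -
    obtain r where r: "0 < r" "ball x r \<subseteq> \<Omega>" using \<Omega>(1) x open_contains_ball by blast
    obtain \<epsilon>' where \<epsilon>': "0 < \<epsilon>'" "\<And>\<delta>. \<delta> \<le> \<epsilon>' \<Longrightarrow> reachable Xh UNIV x \<delta> \<subseteq> reachable Xh (ball x r) x \<delta>"
      using reachable_localize[of Xh, OF cont r(1), where x=x] by blast
    obtain \<delta> where "0 < \<delta>" "ball x \<delta> \<subseteq> reachable Xh UNIV x (min \<epsilon> \<epsilon>')"
      using chow[of "min \<epsilon> \<epsilon>'" x] \<epsilon> \<epsilon>' by auto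
    moreover have "reachable Xh UNIV x (min \<epsilon> \<epsilon>') \<subseteq> reachable Xh \<Omega> x \<epsilon>"
    proof -
      have "reachable Xh UNIV x (min \<epsilon> \<epsilon>') \<subseteq> reachable Xh (ball x r) x (min \<epsilon> \<epsilon>')" by (rule \<epsilon>'(2)) simp
      also have "\<dots> \<subseteq> reachable Xh \<Omega> x (min \<epsilon> \<epsilon>')" by (rule reachable_subset[OF r(2)])
      also have "\<dots> \<subseteq> reachable Xh \<Omega> x \<epsilon>" by (rule reachable_mono) simp
      finally show ?thesis .
    qed
    ultimately show ?thesis by blast
  qed
  have ne: "costs Xh \<Omega> L x y \<noteq> {}" if "x \<in> \<Omega>" "y \<in> \<Omega>" for x y
  proof -
    have "\<exists>\<epsilon>. y \<in> reachable Xh \<Omega> x \<epsilon>"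
    proof (rule connected_equivalence_relation[OF \<Omega>(2) that, where R="\<lambda>x y. \<exists>\<epsilon>. y \<in> reachable Xh \<Omega> x \<epsilon>"])
      show "\<exists>\<epsilon>. x \<in> reachable Xh \<Omega> y \<epsilon>" if "\<exists>\<epsilon>. y \<in> reachable Xh \<Omega> x \<epsilon>" for x y
        using that reachable_sym by blast
      show "\<exists>\<epsilon>. z \<in> reachable Xh \<Omega> x \<epsilon>" if "\<exists>\<epsilon>. y \<in> reachable Xh \<Omega> x \<epsilon>" "\<exists>\<epsilon>. z \<in> reachable Xh \<Omega> y \<epsilon>" for x y z
        using that reachable_trans by blast
      show "\<exists>T. openin (top_of_set \<Omega>) T \<and> x \<in> T \<and> (\<forall>y\<in>T. \<exists>\<epsilon>. y \<in> reachable Xh \<Omega> x \<epsilon>)" if "x \<in> \<Omega>" for x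
      proof -
        obtain \<delta> where "0 < \<delta>" "ball x \<delta> \<subseteq> reachable Xh \<Omega> x 1" using local[OF \<open>x \<in> \<Omega>\<close>, of 1] by auto
        then show ?thesis
          using that by (intro exI[of _ "\<Omega> \<inter> ball x \<delta>"]) (auto intro: openin_open_Int)
      qed
    qed
    then show ?thesis using reachable_imp_costs(1)[OF L] by blast
  qed
  have cc0: "0 \<le> cc_dist Xh \<Omega> x y" and d0: "0 \<le> Inf (costs Xh \<Omega> L x y)" if "x \<in> \<Omega>" "y \<in> \<Omega>" for x y
  proof -
    show "0 \<le> cc_dist Xh \<Omega> x y" using cc_dist_nonneg[OF ne[OF that]] .
    then have "0 \<le> \<alpha> * Inf (costs Xh \<Omega> L x y)"
      using cc_dist_le_Inf_costs[OF L ne[OF that]] by linarith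
    then show "0 \<le> Inf (costs Xh \<Omega> L x y)" using \<alpha> by (simp add: zero_le_mult_iff)
  qed
  have small: "\<exists>\<delta>>0. \<forall>z\<in>\<Omega>. dist z y < \<delta> \<longrightarrow> Inf (costs Xh \<Omega> L y z) < e \<and> Inf (costs Xh \<Omega> L z y) < e"
    if y: "y \<in> \<Omega>" and e: "0 < e" for y e
  proof -
    have e': "0 < e / (2 * \<alpha>)" using e \<alpha> by simp
    obtain \<delta> where \<delta>: "0 < \<delta>" "ball y \<delta> \<subseteq> reachable Xh \<Omega> y (e / (2 * \<alpha>))" using local[OF y e'] by blast
    have "Inf (costs Xh \<Omega> L y z) < e \<and> Inf (costs Xh \<Omega> L z y) < e" if "z \<in> \<Omega>" "dist z y < \<delta>" for z
    proof -
      have z: "z \<in> reachable Xh \<Omega> y (e / (2 * \<alpha>))" using \<delta>(2) that by (auto simp: dist_commute)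
      have "\<alpha> * (e / (2 * \<alpha>)) < e" using \<alpha> e by simp
      then show ?thesis
        using reachable_imp_costs(2)[OF L z] reachable_imp_costs(2)[OF L reachable_sym[OF z]] by linarith
    qed
    then show ?thesis using \<delta>(1) by blast
  qed
  show ?thesis
  proof
    show "open \<Omega>" "0 < \<alpha>" by fact+
    fix x y assume xy: "x \<in> \<Omega>" "y \<in> \<Omega>"
    show "Inf (costs Xh \<Omega> L x z) \<le> Inf (costs Xh \<Omega> L x y) + Inf (costs Xh \<Omega> L y z)" if "z \<in> \<Omega>" for z
      by (rule Inf_costs_triangle[OF L ne ne]) (use xy that in auto)
    show "0 < cc_dist Xh \<Omega> x y" if "x \<noteq> y" by (rule cc_dist_pos[OF cont ne[OF xy] that])
    show "0 \<le> cc_dist Xh \<Omega> x y" by (rule cc0[OF xy])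
    show "cc_dist Xh \<Omega> x y \<le> \<alpha> * Inf (costs Xh \<Omega> L x y)" by (rule cc_dist_le_Inf_costs[OF L ne[OF xy]])
    fix \<eta> :: real assume \<eta>: "0 < \<eta>"
    obtain \<gamma> a where \<gamma>: "hcurve Xh \<Omega> 0 1 \<gamma> a" "\<gamma> 0 = x" "\<gamma> 1 = y"
      "integral {0..1} (\<lambda>t. L (\<gamma> t) (a t)) < Inf (costs Xh \<Omega> L x y) + \<eta>"
      using Inf_costs_approx[OF ne[OF xy] \<eta>] .
    let ?l = "\<lambda>t. integral {0..t} (\<lambda>t. L (\<gamma> t) (a t))"
    note int = cost_integrable[OF L \<gamma>(1)]
    have incr: "Inf (costs Xh \<Omega> L (\<gamma> s) (\<gamma> t)) \<le> ?l t - ?l s" if st: "0 \<le> s" "s \<le> t" "t \<le> 1" for s t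
    proof (cases "s = t")
      case True
      then show ?thesis using Inf_costs_self[OF L hcurve_in[OF \<gamma>(1), of t]] st by simp
    next
      case False
      have h: "hcurve Xh \<Omega> s t \<gamma> a" by (rule hcurve_sub[OF \<gamma>(1)]) (use st in auto)
      have "Inf (costs Xh \<Omega> L (\<gamma> s) (\<gamma> t)) \<le> integral {s..t} (\<lambda>t. L (\<gamma> t) (a t))"
        by (rule Inf_costs_le(2)[OF L h]) (use st False in auto)
      moreover have "?l s + integral {s..t} (\<lambda>t. L (\<gamma> t) (a t)) = ?l t"
        by (rule Henstock_Kurzweil_Integration.integral_combine[OF st(1,2)])
           (rule integrable_subinterval_real[OF int], use st in auto)
      ultimately show ?thesis by simp
    qed
    show "\<exists>\<gamma> l :: real \<Rightarrow> real. continuous_on {0..1} \<gamma> \<and> \<gamma> ` {0..1} \<subseteq> \<Omega> \<and> \<gamma> 0 = x \<and> \<gamma> 1 = y \<and>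
        continuous_on {0..1} l \<and>
        (\<forall>s t. 0 \<le> s \<and> s \<le> t \<and> t \<le> 1 \<longrightarrow> Inf (costs Xh \<Omega> L (\<gamma> s) (\<gamma> t)) \<le> l t - l s) \<and>
        l 1 - l 0 \<le> Inf (costs Xh \<Omega> L x y) + \<eta>"
    proof (intro exI conjI allI impI)
      show "continuous_on {0..1} \<gamma>" by (rule hcurve_continuous[OF \<gamma>(1)])
      show "\<gamma> ` {0..1} \<subseteq> \<Omega>" using \<gamma>(1) by (simp add: hcurve_def)
      show "continuous_on {0..1} ?l" by (rule indefinite_integral_continuous_1[OF int])
      show "?l 1 - ?l 0 \<le> Inf (costs Xh \<Omega> L x y) + \<eta>" using \<gamma>(4) by simp
    qed (use incr \<gamma>(2,3) in auto)
  next
    fix y assume y: "y \<in> \<Omega>"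
    show "((\<lambda>z. Inf (costs Xh \<Omega> L y z)) \<longlongrightarrow> 0) (at y within \<Omega>)"
    proof (rule tendstoI)
      fix e :: real assume "0 < e"
      from small[OF y this] d0[OF y] show "\<forall>\<^sub>F z in at y within \<Omega>. dist (Inf (costs Xh \<Omega> L y z)) 0 < e"
        unfolding eventually_at dist_real_def by (metis abs_of_nonneg diff_zero)
    qed
    show "((\<lambda>z. Inf (costs Xh \<Omega> L z y)) \<longlongrightarrow> 0) (at y within \<Omega>)"
    proof (rule tendstoI)
      fix e :: real assume "0 < e"
      from small[OF y this] d0[OF _ y] show "\<forall>\<^sub>F z in at y within \<Omega>. dist (Inf (costs Xh \<Omega> L z y)) 0 < e"
        unfolding eventually_at dist_real_def by (metis abs_of_nonneg diff_zero)
    qed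
  qed
qed

section \<open>Symmetry of second derivatives\<close>

lemma smooth_imp_differentiable: "smooth f \<Longrightarrow> f differentiable (at x)"
  unfolding smooth_def using C_k.simps(2)[of 0 f] by blast

lemma smooth_has_derivative: "smooth f \<Longrightarrow> (f has_derivative frechet_derivative f (at x)) (at x)"
  using smooth_imp_differentiable frechet_derivative_works by blast

lemma smooth_directional_derivative: "smooth f \<Longrightarrow> smooth (\<lambda>x. frechet_derivative f (at x) v)"
  unfolding smooth_def using C_k.simps(2) by blast

lemma smooth_imp_continuous_on: "smooth f \<Longrightarrow> continuous_on S f"
  by (meson continuous_at_imp_continuous_on differentiable_imp_continuous_within smooth_imp_differentiable)

text \<open>The classical argument: by two applications of the mean value theorem the second difference of \<open>F\<close> over a
  small parallelogram is a value of either mixed derivative near \<open>x\<close>, up to the same factor \<open>h * h\<close>.\<close>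
lemma mixed_second_derivatives_eq:
  fixes F Fv Fw Fvw Fwv :: "'a::real_normed_vector \<Rightarrow> real"
  assumes Fv: "\<And>x s. ((\<lambda>s. F (x + s *\<^sub>R v)) has_real_derivative Fv (x + s *\<^sub>R v)) (at s)"
    and Fw: "\<And>x s. ((\<lambda>s. F (x + s *\<^sub>R w)) has_real_derivative Fw (x + s *\<^sub>R w)) (at s)"
    and Fvw: "\<And>x s. ((\<lambda>s. Fv (x + s *\<^sub>R w)) has_real_derivative Fvw (x + s *\<^sub>R w)) (at s)"
    and Fwv: "\<And>x s. ((\<lambda>s. Fw (x + s *\<^sub>R v)) has_real_derivative Fwv (x + s *\<^sub>R v)) (at s)"
    and cont: "isCont Fvw x" "isCont Fwv x"
  shows "Fvw x = Fwv x"
proof -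
  have mvt: "\<exists>s t. 0 < s \<and> s < h \<and> 0 < t \<and> t < h \<and>
      F (x + h *\<^sub>R w + h *\<^sub>R v) - F (x + h *\<^sub>R v) - (F (x + h *\<^sub>R w) - F x) = h * (h * Gvw (x + s *\<^sub>R v + t *\<^sub>R w))"
    if h: "0 < h"
      and Gv: "\<And>x s. ((\<lambda>s. F (x + s *\<^sub>R v)) has_real_derivative Gv (x + s *\<^sub>R v)) (at s)"
      and Gvw: "\<And>x s. ((\<lambda>s. Gv (x + s *\<^sub>R w)) has_real_derivative Gvw (x + s *\<^sub>R w)) (at s)"
    for v w Gv Gvw and h :: real
  proof -
    have "\<exists>s>0. s < h \<and> (F (x + h *\<^sub>R w + h *\<^sub>R v) - F (x + h *\<^sub>R v)) - (F (x + h *\<^sub>R w + 0 *\<^sub>R v) - F (x + 0 *\<^sub>R v))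
        = (h - 0) * (Gv (x + h *\<^sub>R w + s *\<^sub>R v) - Gv (x + s *\<^sub>R v))"
      by (rule MVT2[OF h]) (intro DERIV_diff Gv)
    then obtain s where s: "0 < s" "s < h" and 1: "(F (x + h *\<^sub>R w + h *\<^sub>R v) - F (x + h *\<^sub>R v)) - (F (x + h *\<^sub>R w) - F x)
        = h * (Gv (x + h *\<^sub>R w + s *\<^sub>R v) - Gv (x + s *\<^sub>R v))"
      by auto
    have "\<exists>t>0. t < h \<and> Gv (x + s *\<^sub>R v + h *\<^sub>R w) - Gv (x + s *\<^sub>R v + 0 *\<^sub>R w) = (h - 0) * Gvw (x + s *\<^sub>R v + t *\<^sub>R w)"
      by (rule MVT2[OF h]) (rule Gvw)
    then obtain t where t: "0 < t" "t < h" and 2: "Gv (x + s *\<^sub>R v + h *\<^sub>R w) - Gv (x + s *\<^sub>R v) = h * Gvw (x + s *\<^sub>R v + t *\<^sub>R w)"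
      by auto
    have "x + h *\<^sub>R w + s *\<^sub>R v = x + s *\<^sub>R v + h *\<^sub>R w" by simp
    then show ?thesis using s t 1 2 by metis
  qed
  show ?thesis
  proof (rule ccontr)
    assume "Fvw x \<noteq> Fwv x"
    define e where "e = \<bar>Fvw x - Fwv x\<bar> / 2"
    have e: "0 < e" using \<open>Fvw x \<noteq> Fwv x\<close> by (simp add: e_def)
    obtain d1 where d1: "0 < d1" "\<And>y. dist y x < d1 \<Longrightarrow> \<bar>Fvw y - Fvw x\<bar> < e"
      using cont(1) e unfolding continuous_at_eps_delta dist_real_def by blast
    obtain d2 where d2: "0 < d2" "\<And>y. dist y x < d2 \<Longrightarrow> \<bar>Fwv y - Fwv x\<bar> < e"
      using cont(2) e unfolding continuous_at_eps_delta dist_real_def by blast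
    define h where "h = min d1 d2 / (norm v + norm w + 1)"
    have pos: "0 < norm v + norm w + 1" by (simp add: add_nonneg_pos)
    have h: "0 < h" using d1 d2 pos by (simp add: h_def)
    have near: "dist (x + s *\<^sub>R v' + t *\<^sub>R w') x < min d1 d2"
      if st: "0 < s" "s < h" "0 < t" "t < h" and vw: "norm v' + norm w' = norm v + norm w" for s t :: real and v' w'
    proof -
      have "dist (x + s *\<^sub>R v' + t *\<^sub>R w') x = norm (s *\<^sub>R v' + t *\<^sub>R w')" by (simp add: dist_norm add.assoc)
      also have "\<dots> \<le> s * norm v' + t * norm w'" using st norm_triangle_ineq[of "s *\<^sub>R v'" "t *\<^sub>R w'"] by simp
      also have "\<dots> \<le> h * norm v' + h * norm w'" using st by (intro add_mono mult_right_mono) auto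
      also have "\<dots> = h * (norm v + norm w)" by (simp only: distrib_left[symmetric] vw)
      also have "\<dots> < h * (norm v + norm w + 1)" using h by (intro mult_strict_left_mono) auto
      also have "\<dots> = min d1 d2" using pos by (simp add: h_def)
      finally show ?thesis .
    qed
    obtain s1 t1 where 1: "0 < s1" "s1 < h" "0 < t1" "t1 < h"
      "F (x + h *\<^sub>R w + h *\<^sub>R v) - F (x + h *\<^sub>R v) - (F (x + h *\<^sub>R w) - F x) = h * (h * Fvw (x + s1 *\<^sub>R v + t1 *\<^sub>R w))"
      using mvt[OF h Fv Fvw] by blast
    obtain s2 t2 where 2: "0 < s2" "s2 < h" "0 < t2" "t2 < h"
      "F (x + h *\<^sub>R v + h *\<^sub>R w) - F (x + h *\<^sub>R w) - (F (x + h *\<^sub>R v) - F x) = h * (h * Fwv (x + s2 *\<^sub>R w + t2 *\<^sub>R v))"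
      using mvt[OF h Fw Fwv] by blast
    have "x + h *\<^sub>R v + h *\<^sub>R w = x + h *\<^sub>R w + h *\<^sub>R v" by simp
    then have "h * (h * Fvw (x + s1 *\<^sub>R v + t1 *\<^sub>R w)) = h * (h * Fwv (x + s2 *\<^sub>R w + t2 *\<^sub>R v))"
      using 1(5) 2(5) by (simp only:)
    then have eq: "Fvw (x + s1 *\<^sub>R v + t1 *\<^sub>R w) = Fwv (x + s2 *\<^sub>R w + t2 *\<^sub>R v)" using h by simp
    have "\<bar>Fvw (x + s1 *\<^sub>R v + t1 *\<^sub>R w) - Fvw x\<bar> < e" using d1(2) near[OF 1(1-4), of v w] by simp
    moreover have "\<bar>Fwv (x + s2 *\<^sub>R w + t2 *\<^sub>R v) - Fwv x\<bar> < e" using d2(2) near[OF 2(1-4), of w v] by simp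
    ultimately have "\<bar>Fvw x - Fwv x\<bar> < e + e" using eq by linarith
    then show False by (simp add: e_def)
  qed
qed

lemma has_derivative_along_line:
  fixes f :: "'a::real_normed_vector \<Rightarrow> 'b::real_inner"
  assumes "\<And>x. (f has_derivative f' x) (at x)"
  shows "((\<lambda>s. inner (f (x + s *\<^sub>R v)) b) has_real_derivative inner (f' (x + s *\<^sub>R v) v) b) (at s)"
proof -
  have 1: "((\<lambda>s. x + s *\<^sub>R v) has_derivative (\<lambda>h. h *\<^sub>R v)) (at s)"
    by (auto intro!: derivative_eq_intros)
  have 2: "((\<lambda>s. f (x + s *\<^sub>R v)) has_derivative (\<lambda>h. f' (x + s *\<^sub>R v) (h *\<^sub>R v))) (at s)"
    by (rule has_derivative_compose[OF 1 assms])
  have "linear (f' (x + s *\<^sub>R v))" using assms has_derivative_linear by blast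
  then have eq: "f' (x + s *\<^sub>R v) (h *\<^sub>R v) = h *\<^sub>R f' (x + s *\<^sub>R v) v" for h by (rule linear_cmul)
  have "((\<lambda>s. inner (f (x + s *\<^sub>R v)) b) has_derivative (\<lambda>h. inner (f' (x + s *\<^sub>R v) (h *\<^sub>R v)) b)) (at s)"
    by (rule has_derivative_inner_left[OF 2])
  then show ?thesis unfolding has_field_derivative_def eq by (simp add: mult_commute_abs)
qed

proposition smooth_second_derivative_symmetric:
  fixes f :: "'a::euclidean_space \<Rightarrow> 'b::euclidean_space"
  assumes f: "smooth f"
  shows "frechet_derivative (\<lambda>x. frechet_derivative f (at x) v) (at x) w =
    frechet_derivative (\<lambda>x. frechet_derivative f (at x) w) (at x) v"
proof (rule euclidean_eqI)
  fix b :: 'b assume "b \<in> Basis"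
  let ?D = "\<lambda>f v x. frechet_derivative f (at x) v"
  have D: "\<And>x. (f has_derivative (\<lambda>v. ?D f v x)) (at x)" by (rule smooth_has_derivative[OF f])
  have DD: "\<And>x. (?D f v has_derivative (\<lambda>w. ?D (?D f v) w x)) (at x)" for v
    by (rule smooth_has_derivative[OF smooth_directional_derivative[OF f]])
  have cont: "isCont (\<lambda>x. inner (?D (?D f v) w x) b) x" for v w
  proof -
    have "smooth (?D (?D f v) w)" by (intro smooth_directional_derivative f)
    then have "isCont (?D (?D f v) w) x"
      using differentiable_imp_continuous_within smooth_imp_differentiable by blast
    then show ?thesis by (intro continuous_intros)
  qed
  show "inner (?D (?D f v) w x) b = inner (?D (?D f w) v x) b"
    by (rule mixed_second_derivatives_eq[where F="\<lambda>x. inner (f x) b" and v=v and w=w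
          and Fv="\<lambda>x. inner (?D f v x) b" and Fw="\<lambda>x. inner (?D f w x) b"])
       (rule has_derivative_along_line[OF D] has_derivative_along_line[OF DD] cont)+
qed

text \<open>Continuity of the derivative is required only in each direction; summing over a basis gives a uniform
  bound of its norm on the ball.\<close>
lemma continuous_derivative_imp_lipschitz_on_cball:
  fixes f :: "'a::euclidean_space \<Rightarrow> 'b::real_normed_vector"
  assumes f: "\<And>x. (f has_derivative f' x) (at x)" and cont: "\<And>v. continuous_on UNIV (\<lambda>x. f' x v)"
  shows "\<exists>L. L-lipschitz_on (cball x r) f"
proof -
  have "continuous_on (cball x r) (\<lambda>x. \<Sum>b\<in>Basis. norm (f' x b))"
    by (intro continuous_intros continuous_on_subset[OF cont]) auto
  then have "bounded ((\<lambda>x. \<Sum>b\<in>Basis. norm (f' x b)) ` cball x r)"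
    using compact_continuous_image compact_cball compact_imp_bounded by blast
  then obtain B where B: "0 < B" "\<And>y. y \<in> cball x r \<Longrightarrow> norm (\<Sum>b\<in>Basis. norm (f' y b)) \<le> B"
    unfolding bounded_pos by blast
  have "onorm (f' y) \<le> B" if "y \<in> cball x r" for y
  proof (rule onorm_le)
    fix v
    have lin: "linear (f' y)" using f has_derivative_linear by blast
    have "f' y v = (\<Sum>b\<in>Basis. inner v b *\<^sub>R f' y b)"
      by (subst euclidean_representation[symmetric, of v]) (simp only: linear_sum[OF lin] linear_cmul[OF lin])
    also have "norm \<dots> \<le> (\<Sum>b\<in>Basis. norm v * norm (f' y b))"
      by (rule sum_norm_le) (simp add: Basis_le_norm mult_right_mono)
    also have "\<dots> = norm v * (\<Sum>b\<in>Basis. norm (f' y b))" by (simp add: sum_distrib_left)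
    also have "\<dots> \<le> norm v * B" using B(2)[OF that] by (intro mult_left_mono) auto
    finally show "norm (f' y v) \<le> B * norm v" by (simp add: mult.commute)
  qed
  then have "norm (f y - f z) \<le> B * norm (y - z)" if "y \<in> cball x r" "z \<in> cball x r" for y z
    by (intro differentiable_bound[OF convex_cball]) (use that f in \<open>auto intro: has_derivative_at_withinI\<close>)
  then have "B-lipschitz_on (cball x r) f"
    using B(1) by (intro lipschitz_onI) (auto simp: dist_norm)
  then show ?thesis by blast
qed

section \<open>The adjoint action and the bracket\<close>

text \<open>If \<open>A t \<rightarrow> id\<close>, then \<open>A t (q t)\<close> and \<open>q t\<close> have the same limit. Pointwise convergence suffices in finite
  dimension; inverting \<open>A t\<close> is avoided.\<close>
lemma tendsto_of_near_identity:
  fixes A :: "real \<Rightarrow> 'a::euclidean_space \<Rightarrow> 'a" and q :: "real \<Rightarrow> 'a"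
  assumes lin: "\<And>t. linear (A t)" and A: "\<And>v. ((\<lambda>t. A t v) \<longlongrightarrow> v) F"
    and Aq: "((\<lambda>t. A t (q t)) \<longlongrightarrow> b) F"
  shows "(q \<longlongrightarrow> b) F"
proof -
  define \<eta> where "\<eta> t = (\<Sum>e\<in>Basis. norm (A t e - e))" for t
  have "((\<lambda>t. \<Sum>e\<in>Basis. norm (A t e - e)) \<longlongrightarrow> (\<Sum>e\<in>Basis. norm (e - e :: 'a))) F"
    by (intro tendsto_intros A)
  then have \<eta>: "(\<eta> \<longlongrightarrow> 0) F" by (simp add: \<eta>_def[abs_def])
  have close: "norm (A t v - v) \<le> \<eta> t * norm v" for t v
  proof -
    have "A t v - v = (\<Sum>e\<in>Basis. inner v e *\<^sub>R (A t e - e))"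
      by (subst (1 2) euclidean_representation[symmetric, of v])
        (simp only: linear_sum[OF lin] linear_cmul[OF lin] scaleR_diff_right sum_subtractf)
    also have "norm \<dots> \<le> (\<Sum>e\<in>Basis. norm v * norm (A t e - e))"
      by (rule sum_norm_le) (simp add: Basis_le_norm mult_right_mono)
    finally show ?thesis by (simp add: \<eta>_def sum_distrib_left mult.commute)
  qed
  have "\<forall>\<^sub>F t in F. \<eta> t < 1 / 2" using \<eta> by (rule order_tendstoD) simp
  then have bound: "\<forall>\<^sub>F t in F. norm (A t (q t) - q t) \<le> \<eta> t * (2 * norm (A t (q t)))"
  proof eventually_elim
    case (elim t)
    have \<eta>0: "0 \<le> \<eta> t" by (simp add: \<eta>_def sum_nonneg)
    have "norm (q t) \<le> norm (A t (q t)) + norm (A t (q t) - q t)"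
      by (metis norm_minus_commute norm_triangle_sub)
    also have "norm (A t (q t) - q t) \<le> 1 / 2 * norm (q t)"
      using close[of t "q t"] elim mult_right_mono[of "\<eta> t" "1/2" "norm (q t)"] by simp
    finally have "norm (q t) \<le> 2 * norm (A t (q t))" by simp
    then have "\<eta> t * norm (q t) \<le> \<eta> t * (2 * norm (A t (q t)))" using \<eta>0 by (intro mult_left_mono)
    then show ?case using close[of t "q t"] by linarith
  qed
  have "((\<lambda>t. \<eta> t * (2 * norm (A t (q t)))) \<longlongrightarrow> 0 * (2 * norm b)) F"
    by (intro tendsto_intros \<eta> Aq)
  then have "((\<lambda>t. \<eta> t * (2 * norm (A t (q t)))) \<longlongrightarrow> 0) F" by simp
  then have "((\<lambda>t. A t (q t) - q t) \<longlongrightarrow> 0) F" by (rule Lim_null_comparison[OF bound])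
  from tendsto_diff[OF Aq this] show ?thesis by simp
qed

lemma has_vector_derivative_imp_quotient_tendsto:
  fixes r :: "real \<Rightarrow> 'a::real_normed_vector"
  assumes "(r has_vector_derivative b) (at 0)" "r 0 = 0"
  shows "((\<lambda>t. (1 / t) *\<^sub>R r t) \<longlongrightarrow> b) (at 0)"
proof -
  have "((\<lambda>t. norm (r t - t *\<^sub>R b) / norm t) \<longlongrightarrow> 0) (at 0)"
    using assms by (simp add: has_vector_derivative_def has_derivative_iff_norm)
  moreover have "\<forall>\<^sub>F t in at 0. norm ((1 / t) *\<^sub>R r t - b) \<le> norm (r t - t *\<^sub>R b) / norm t"
  proof -
    have "(1 / t) *\<^sub>R r t - b = (1 / t) *\<^sub>R (r t - t *\<^sub>R b)" if "t \<noteq> 0" for t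
      using that by (simp add: scaleR_diff_right)
    then show ?thesis by (simp add: eventually_at_filter)
  qed
  ultimately have "((\<lambda>t. (1 / t) *\<^sub>R r t - b) \<longlongrightarrow> 0) (at 0)"
    by (rule Lim_null_comparison[rotated])
  then show ?thesis by (rule LIM_zero_cancel)
qed

context euclidean_lie_group
begin

lemma in_carrier [simp]: "x \<in> carrier G"
  by (simp add: carrier_UNIV)

text \<open>The derivative of the group multiplication. Vectors \<open>(v, 0)\<close> and \<open>(0, v)\<close> give the derivatives of the
  right and of the left translations.\<close>
definition mult_deriv :: "real ^ 'n \<Rightarrow> real ^ 'n \<Rightarrow> (real ^ 'n) \<times> (real ^ 'n) \<Rightarrow> real ^ 'n"
  where "mult_deriv x y = frechet_derivative (\<lambda>(x, y). x \<otimes> y) (at (x, y))"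

lemma mult_has_derivative: "((\<lambda>(x, y). x \<otimes> y) has_derivative mult_deriv x y) (at (x, y))"
  unfolding mult_deriv_def by (rule smooth_has_derivative[OF smooth_mult])

lemma linear_mult_deriv: "linear (mult_deriv x y)"
  using mult_has_derivative has_derivative_linear by blast

lemma smooth_mult_deriv: "smooth (\<lambda>z. mult_deriv (fst z) (snd z) v)"
  using smooth_directional_derivative[OF smooth_mult, of v] by (simp add: mult_deriv_def)

lemma left_mult_has_derivative: "((\<lambda>z. x \<otimes> z) has_derivative (\<lambda>v. mult_deriv x y (0, v))) (at y)"
proof -
  have 1: "((\<lambda>z. (x, z)) has_derivative (\<lambda>v. (0, v))) (at y)" by (auto intro!: derivative_eq_intros)
  show ?thesis using has_derivative_compose[OF 1 mult_has_derivative] by simp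
qed

lemma right_mult_has_derivative: "((\<lambda>z. z \<otimes> y) has_derivative (\<lambda>v. mult_deriv x y (v, 0))) (at x)"
proof -
  have 1: "((\<lambda>z. (z, y)) has_derivative (\<lambda>v. (v, 0))) (at x)" by (auto intro!: derivative_eq_intros)
  show ?thesis using has_derivative_compose[OF 1 mult_has_derivative] by simp
qed

lemma mult_deriv_one_right: "mult_deriv x \<one> (v, 0) = v"
proof -
  have "((\<lambda>z. z) has_derivative (\<lambda>v. mult_deriv x \<one> (v, 0))) (at x)"
    using right_mult_has_derivative[of \<one> x] by simp
  then have "(\<lambda>v. mult_deriv x \<one> (v, 0)) = (\<lambda>v. v)"
    using has_derivative_ident has_derivative_unique by blast
  then show ?thesis by metis
qed

lemma continuous_left_mult: "continuous_on S (\<lambda>z. x \<otimes> z)"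
  by (meson continuous_at_imp_continuous_on has_derivative_continuous left_mult_has_derivative)

lemma left_invariant: "Y \<in> lie_algebra G \<Longrightarrow> mult_deriv x y (0, Y y) = Y (x \<otimes> y)"
  unfolding lie_algebra_def using fun_cong[OF frechet_derivative_at[OF left_mult_has_derivative[of x y]], of "Y y"] by auto

lemma lie_algebra_smooth: "Y \<in> lie_algebra G \<Longrightarrow> smooth Y"
  by (simp add: lie_algebra_def)

text \<open>The adjoint action on the tangent space at the identity, as the derivative of conjugation computed by
  the chain rule.\<close>
definition Ad :: "real ^ 'n \<Rightarrow> real ^ 'n \<Rightarrow> real ^ 'n"
  where "Ad g v = mult_deriv g (inv g) (mult_deriv g \<one> (0, v), 0)"

lemma conjugation_has_derivative: "((\<lambda>z. g \<otimes> z \<otimes> inv g) has_derivative Ad g) (at \<one>)"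
proof -
  have "((\<lambda>w. w \<otimes> inv g) has_derivative (\<lambda>v. mult_deriv g (inv g) (v, 0))) (at (g \<otimes> \<one>))"
    using right_mult_has_derivative[of "inv g" g] by simp
  from has_derivative_compose[OF left_mult_has_derivative this]
  show ?thesis unfolding Ad_def[abs_def] .
qed

lemma linear_Ad: "linear (Ad g)"
  using conjugation_has_derivative has_derivative_linear by blast

lemma Ad_one: "Ad \<one> v = v"
proof -
  have "((\<lambda>z. z) has_derivative Ad \<one>) (at \<one>)"
    using conjugation_has_derivative[of \<one>] by simp
  then have "Ad \<one> = (\<lambda>v. v)" using has_derivative_ident has_derivative_unique by blast
  then show ?thesis by simp
qed

lemma Ad_mult: "Ad (g \<otimes> h) v = Ad g (Ad h v)"
proof -
  have "((\<lambda>z. g \<otimes> z \<otimes> inv g) has_derivative Ad g) (at (h \<otimes> \<one> \<otimes> inv h))"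
    using conjugation_has_derivative[of g] by simp
  from has_derivative_compose[OF conjugation_has_derivative this]
  have "((\<lambda>z. g \<otimes> (h \<otimes> z \<otimes> inv h) \<otimes> inv g) has_derivative (\<lambda>v. Ad g (Ad h v))) (at \<one>)" .
  moreover have "g \<otimes> (h \<otimes> z \<otimes> inv h) \<otimes> inv g = (g \<otimes> h) \<otimes> z \<otimes> inv (g \<otimes> h)" for z
    by (simp add: inv_mult_group m_assoc)
  ultimately have "((\<lambda>z. (g \<otimes> h) \<otimes> z \<otimes> inv (g \<otimes> h)) has_derivative (\<lambda>v. Ad g (Ad h v))) (at \<one>)" by simp
  then have "Ad (g \<otimes> h) = (\<lambda>v. Ad g (Ad h v))"
    using conjugation_has_derivative has_derivative_unique by blast
  then show ?thesis by simp
qed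

text \<open>Conjugation by \<open>g\<close> followed by right translation by \<open>g\<close> is left translation by \<open>g\<close>.\<close>
lemma right_mult_deriv_Ad:
  assumes "Z \<in> lie_algebra G"
  shows "mult_deriv \<one> g (Ad g (Z \<one>), 0) = Z g"
proof -
  have "((\<lambda>w. w \<otimes> g) has_derivative (\<lambda>v. mult_deriv \<one> g (v, 0))) (at (g \<otimes> \<one> \<otimes> inv g))"
    using right_mult_has_derivative[of g \<one>] by simp
  from has_derivative_compose[OF conjugation_has_derivative this]
  have "((\<lambda>z. g \<otimes> z \<otimes> inv g \<otimes> g) has_derivative (\<lambda>v. mult_deriv \<one> g (Ad g v, 0))) (at \<one>)" .
  moreover have "g \<otimes> z \<otimes> inv g \<otimes> g = g \<otimes> z" for z by (simp add: m_assoc)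
  ultimately have "((\<lambda>z. g \<otimes> z) has_derivative (\<lambda>v. mult_deriv \<one> g (Ad g v, 0))) (at \<one>)" by simp
  then have "(\<lambda>v. mult_deriv \<one> g (Ad g v, 0)) = (\<lambda>v. mult_deriv g \<one> (0, v))"
    using left_mult_has_derivative has_derivative_unique by blast
  then have "mult_deriv \<one> g (Ad g (Z \<one>), 0) = mult_deriv g \<one> (0, Z \<one>)" by meson
  then show ?thesis using left_invariant[OF assms, of g \<one>] by simp
qed

text \<open>The mixed second derivative of the multiplication at the identity, read in two ways: moving the right
  factor along \<open>Y\<close> after differentiating in the left factor is the same as differentiating
  \<open>Y x = D(x \<otimes> -) Y(\<one>)\<close> in \<open>x\<close>.\<close>
lemma right_translation_deriv_along:
  assumes Y: "Y \<in> lie_algebra G" and E: "(E has_vector_derivative Y \<one>) (at 0)" "E 0 = \<one>"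
  shows "((\<lambda>t. mult_deriv \<one> (E t) (v, 0)) has_vector_derivative frechet_derivative Y (at \<one>) v) (at 0)"
proof -
  let ?\<mu> = "\<lambda>(x, y). x \<otimes> y" and ?e = "(\<one>, \<one>)"
  let ?\<Phi> = "\<lambda>v z. mult_deriv (fst z) (snd z) v"
  have \<Phi>: "(?\<Phi> v has_derivative frechet_derivative (?\<Phi> v) (at z)) (at z)" for v z
    by (rule smooth_has_derivative[OF smooth_mult_deriv])
  have eq: "?\<Phi> v = (\<lambda>z. frechet_derivative ?\<mu> (at z) v)" for v
    by (simp add: mult_deriv_def fun_eq_iff)
  have "((\<lambda>t. (\<one>, E t)) has_derivative (\<lambda>h. (0, h *\<^sub>R Y \<one>))) (at 0)"
    using E(1) by (auto simp: has_vector_derivative_def intro!: derivative_eq_intros)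
  moreover have "(?\<Phi> (v, 0) has_derivative frechet_derivative (?\<Phi> (v, 0)) (at ?e)) (at (\<one>, E 0))"
    using \<Phi>[of "(v, 0)" ?e] E(2) by simp
  ultimately have 1: "((\<lambda>t. ?\<Phi> (v, 0) (\<one>, E t)) has_derivative
      (\<lambda>h. frechet_derivative (?\<Phi> (v, 0)) (at ?e) (0, h *\<^sub>R Y \<one>))) (at 0)"
    by (rule has_derivative_compose)
  have lin: "linear (frechet_derivative (?\<Phi> (v, 0)) (at ?e))" using \<Phi> has_derivative_linear by blast
  have "frechet_derivative (?\<Phi> (v, 0)) (at ?e) (0, h *\<^sub>R Y \<one>) = h *\<^sub>R frechet_derivative (?\<Phi> (v, 0)) (at ?e) (0, Y \<one>)" for h
    using linear_cmul[OF lin, of h "(0, Y \<one>)"] by simp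
  moreover have "frechet_derivative (?\<Phi> (v, 0)) (at ?e) (0, Y \<one>) = frechet_derivative (?\<Phi> (0, Y \<one>)) (at ?e) (v, 0)"
    unfolding eq by (rule smooth_second_derivative_symmetric[OF smooth_mult])
  moreover have "frechet_derivative (?\<Phi> (0, Y \<one>)) (at ?e) (v, 0) = frechet_derivative Y (at \<one>) v"
  proof -
    have "((\<lambda>x. (x, \<one>)) has_derivative (\<lambda>v. (v, 0))) (at \<one>)" by (auto intro!: derivative_eq_intros)
    from has_derivative_compose[OF this \<Phi>]
    have "((\<lambda>x. mult_deriv x \<one> (0, Y \<one>)) has_derivative
        (\<lambda>v. frechet_derivative (?\<Phi> (0, Y \<one>)) (at ?e) (v, 0))) (at \<one>)" by simp
    moreover have "mult_deriv x \<one> (0, Y \<one>) = Y x" for x using left_invariant[OF Y, of x \<one>] by simp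
    ultimately have "(Y has_derivative (\<lambda>v. frechet_derivative (?\<Phi> (0, Y \<one>)) (at ?e) (v, 0))) (at \<one>)" by simp
    then have "(\<lambda>v. frechet_derivative (?\<Phi> (0, Y \<one>)) (at ?e) (v, 0)) = frechet_derivative Y (at \<one>)"
      by (rule frechet_derivative_at)
    then show ?thesis by (rule fun_cong)
  qed
  ultimately show ?thesis using 1 by (simp add: has_vector_derivative_def)
qed

text \<open>In other words, \<open>Ad (E t) Z\<close> has derivative \<open>[Y, Z]\<close> at \<open>t = 0\<close>, so a closed subspace containing
  \<open>Ad (E t) Z\<close> for small \<open>t \<ge> 0\<close> contains the bracket. To avoid differentiating inverses, the relation
  \<open>A t (Ad (E t) Z) = Z (E t)\<close> is differentiated, where \<open>A t\<close> is the derivative of right translation by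
  \<open>E t\<close>: the term \<open>D Z Y\<close> comes from \<open>Z (E t)\<close> and \<open>D Y Z\<close> from \<open>A t\<close>.\<close>
proposition bracket_in_subspace:
  assumes Y: "Y \<in> lie_algebra G" and Z: "Z \<in> lie_algebra G"
    and E: "(E has_vector_derivative Y \<one>) (at 0)" "E 0 = \<one>"
    and W: "subspace W" and \<tau>: "0 < \<tau>" and AdW: "\<And>t. \<lbrakk>0 \<le> t; t < \<tau>\<rbrakk> \<Longrightarrow> Ad (E t) (Z \<one>) \<in> W"
  shows "bracket Y Z \<one> \<in> W"
proof -
  define A where "A t v = mult_deriv \<one> (E t) (v, 0)" for t v
  have linA: "linear (A t)" for t
  proof -
    have "linear (\<lambda>v :: real ^ 'n. (v, 0 :: real ^ 'n))" by (rule linearI) auto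
    from linear_compose[OF this linear_mult_deriv] show ?thesis by (simp add: A_def[abs_def] o_def)
  qed
  have A0: "A 0 v = v" for v using mult_deriv_one_right by (simp add: A_def E(2))
  have Ader: "((\<lambda>t. A t v) has_vector_derivative frechet_derivative Y (at \<one>) v) (at 0)" for v
    unfolding A_def by (rule right_translation_deriv_along[OF Y E])
  have Zder: "((\<lambda>t. Z (E t)) has_vector_derivative frechet_derivative Z (at \<one>) (Y \<one>)) (at 0)"
  proof -
    have "(Z has_derivative frechet_derivative Z (at \<one>)) (at (E 0))"
      using smooth_has_derivative[OF lie_algebra_smooth[OF Z]] by (simp add: E(2))
    from vector_derivative_diff_chain_within[OF E(1) has_derivative_at_withinI[OF this, of "range E"]]
    show ?thesis by (simp add: o_def)
  qed
  define q where "q t = (1 / t) *\<^sub>R (Ad (E t) (Z \<one>) - Z \<one>)" for t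
  have Ad0: "Ad (E 0) (Z \<one>) = Z \<one>" by (simp add: E(2) Ad_one)
  have qW: "q t \<in> W" if "0 < t" "t < \<tau>" for t
    unfolding q_def using AdW[of t] AdW[of 0] Ad0 \<tau> that
    by (intro subspace_scale[OF W] subspace_diff[OF W]) auto
  have Aq: "A t (q t) = (1 / t) *\<^sub>R (Z (E t) - A t (Z \<one>))" for t
    using right_mult_deriv_Ad[OF Z, of "E t"]
    by (simp add: q_def linear_cmul[OF linA] linear_diff[OF linA]) (simp add: A_def)
  have "((\<lambda>t. Z (E t) - A t (Z \<one>)) has_vector_derivative bracket Y Z \<one>) (at 0)"
    unfolding bracket_def by (intro has_vector_derivative_diff Zder Ader)
  then have "((\<lambda>t. (1 / t) *\<^sub>R (Z (E t) - A t (Z \<one>))) \<longlongrightarrow> bracket Y Z \<one>) (at 0)"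
    by (rule has_vector_derivative_imp_quotient_tendsto) (use A0 E(2) in simp)
  then have Aq_lim: "((\<lambda>t. A t (q t)) \<longlongrightarrow> bracket Y Z \<one>) (at_right 0)"
    unfolding Aq by (rule tendsto_within_subset) simp
  have A_lim: "((\<lambda>t. A t v) \<longlongrightarrow> v) (at_right 0)" for v
  proof -
    have "isCont (\<lambda>t. A t v) 0" using Ader has_vector_derivative_continuous by blast
    then have "((\<lambda>t. A t v) \<longlongrightarrow> v) (at 0)" using A0 by (simp add: isCont_def)
    then show ?thesis by (rule tendsto_within_subset) simp
  qed
  have "(q \<longlongrightarrow> bracket Y Z \<one>) (at_right 0)"
    by (rule tendsto_of_near_identity[of A, OF linA A_lim Aq_lim])
  moreover have "\<forall>\<^sub>F t in at_right 0. q t \<in> W"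
    using \<tau> qW by (auto simp: eventually_at_right[OF \<tau>])
  ultimately show ?thesis
    using Lim_in_closed_set[OF closed_subspace[OF W]] by (metis trivial_limit_at_right_real)
qed

end

section \<open>Horizontal curves in a Carnot group\<close>

lemma C1_imp_lipschitz_on_interval:
  fixes E :: "real \<Rightarrow> 'a::euclidean_space"
  assumes E: "\<And>t. (E has_vector_derivative E' t) (at t)" and cont: "continuous_on UNIV E'"
  shows "\<exists>L. L-lipschitz_on {p..q} E"
proof -
  have "{p..q} \<subseteq> cball ((p + q) / 2) (\<bar>q - p\<bar> / 2)" by (auto simp: dist_real_def abs_if field_simps)
  moreover have "\<exists>L. L-lipschitz_on (cball ((p + q) / 2) (\<bar>q - p\<bar> / 2)) E"
  proof (rule continuous_derivative_imp_lipschitz_on_cball)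
    show "(E has_derivative (\<lambda>h. h *\<^sub>R E' t)) (at t)" for t using E by (simp add: has_vector_derivative_def)
    show "continuous_on UNIV (\<lambda>t. h *\<^sub>R E' t)" for h by (intro continuous_intros cont)
  qed
  ultimately show ?thesis using lipschitz_on_subset by blast
qed

context carnot_group
begin

abbreviation Xh :: "'m \<Rightarrow> 'n vfield" where "Xh i \<equiv> X (hor i)"

lemma inj_X: "inj X"
proof (rule injI, rule ccontr)
  fix j k assume eq: "X j = X k" and "j \<noteq> k"
  define c where "c = (axis j 1 - axis k 1 :: real ^ 'n)"
  have "(\<Sum>l\<in>UNIV. c $ l *\<^sub>R X l x) = 0" for x
  proof -
    have "(\<Sum>l\<in>UNIV. c $ l *\<^sub>R X l x) = (\<Sum>l\<in>UNIV. axis j 1 $ l *\<^sub>R X l x) - (\<Sum>l\<in>UNIV. axis k 1 $ l *\<^sub>R X l x)"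
      by (simp add: c_def scaleR_diff_left sum_subtractf)
    also have "\<dots> = X j x - X k x"
      by (simp add: axis_def if_distrib[of "\<lambda>r. r *\<^sub>R _"] cong: if_cong)
    finally show ?thesis using eq by simp
  qed
  then have "c = 0" by (intro basis_indep) auto
  then have "c $ j = 0" by simp
  then show False using \<open>j \<noteq> k\<close> by (simp add: c_def axis_def)
qed

lemma inj_hor: "inj hor"
  using rank by (simp add: bij_betw_def)

lemma range_hor: "range hor = {j. deg j = 1}"
  using rank by (simp add: bij_betw_def)

lemma inj_Xh: "inj Xh"
  using inj_X inj_hor by (auto simp: inj_def)

lemma fields_span_mono: "S \<subseteq> T \<Longrightarrow> fields_span S \<subseteq> fields_span T"
  unfolding fields_span_def by blast

lemma fields_span_base:
  assumes "Y \<in> S"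
  shows "Y \<in> fields_span S"
  unfolding fields_span_def using assms
  by (intro CollectI exI[of _ "{Y}"] exI[of _ "\<lambda>_. 1"]) auto

lemma layer_subset_lie_algebra: "layer X deg i \<subseteq> lie_algebra G"
  unfolding layer_def basis_span[symmetric] by (rule fields_span_mono) auto

lemma X_in_lie_algebra: "X j \<in> lie_algebra G"
  unfolding basis_span[symmetric] by (rule fields_span_base) simp

lemma X_in_layer: "X j \<in> layer X deg (deg j)"
  unfolding layer_def by (rule fields_span_base) simp

lemma continuous_Xh: "continuous_on S (Xh i)"
  by (rule smooth_imp_continuous_on[OF lie_algebra_smooth[OF X_in_lie_algebra]])

lemma continuous_hvec: "continuous_on S (hvec Xh a)"
  unfolding hvec_def by (intro continuous_intros continuous_Xh)

lemma layer_one_hvec: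
  assumes "Y \<in> layer X deg 1"
  obtains a where "Y = hvec Xh a"
proof -
  obtain F c where F: "finite F" "F \<subseteq> X ` {j. deg j = 1}" and Y: "Y = (\<lambda>x. \<Sum>Z\<in>F. c Z *\<^sub>R Z x)"
    using assms unfolding layer_def fields_span_def by blast
  have F': "F \<subseteq> range Xh" using F(2) unfolding range_hor[symmetric] by auto
  have "hvec Xh (\<chi> i. if Xh i \<in> F then c (Xh i) else 0) x = Y x" for x
  proof -
    have "hvec Xh (\<chi> i. if Xh i \<in> F then c (Xh i) else 0) x = (\<Sum>i\<in>UNIV. (if Xh i \<in> F then c (Xh i) else 0) *\<^sub>R Xh i x)"
      by (simp add: hvec_def)
    also have "\<dots> = (\<Sum>Z\<in>range Xh. (if Z \<in> F then c Z else 0) *\<^sub>R Z x)"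
      by (simp add: sum.reindex[OF inj_Xh])
    also have "\<dots> = (\<Sum>Z\<in>F. (if Z \<in> F then c Z else 0) *\<^sub>R Z x)"
      by (rule sum.mono_neutral_right) (use F' in auto)
    also have "\<dots> = Y x" unfolding Y by (rule sum.cong) auto
    finally show ?thesis .
  qed
  then have "hvec Xh (\<chi> i. if Xh i \<in> F then c (Xh i) else 0) = Y" by (rule ext)
  from that[OF this[symmetric]] show ?thesis .
qed

text \<open>Exponential coordinates make the horizontal fields complete: the field is \<open>\<Sum> y\<^sub>j X\<^sub>j\<close>
  with \<open>y\<close> supported on the horizontal labels.\<close>
lemma horizontal_integral_curve:
  obtains E where "E 0 = \<one>" "\<And>t. (E has_vector_derivative hvec Xh a (E t)) (at t)"
proof -
  define y :: "real ^ 'n" where "y = (\<chi> j. if j \<in> range hor then a $ (inv_into UNIV hor j) else 0)"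
  have "(\<Sum>j\<in>UNIV. y $ j *\<^sub>R X j x) = hvec Xh a x" for x
  proof -
    have "(\<Sum>j\<in>UNIV. y $ j *\<^sub>R X j x) = (\<Sum>j\<in>range hor. y $ j *\<^sub>R X j x)"
      by (rule sum.mono_neutral_right) (auto simp: y_def)
    also have "\<dots> = (\<Sum>i\<in>UNIV. y $ hor i *\<^sub>R Xh i x)" by (simp add: sum.reindex[OF inj_hor])
    also have "\<dots> = hvec Xh a x" by (simp add: hvec_def y_def inv_into_f_f[OF inj_hor])
    finally show ?thesis .
  qed
  then have "is_exp G (hvec Xh a) y" using exp_coordinates[of y] by simp
  then show ?thesis using that unfolding is_exp_def by blast
qed

lemma hcurve_integral_curve:
  assumes E: "\<And>t. (E has_vector_derivative hvec Xh a (E t)) (at t)"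
  shows "hcurve Xh UNIV p q E (\<lambda>t. a)"
  unfolding hcurve_def
proof (intro conjI)
  have "continuous_on UNIV E"
    by (meson E continuous_at_imp_continuous_on has_vector_derivative_continuous)
  then have "continuous_on UNIV (\<lambda>t. hvec Xh a (E t))"
    using continuous_on_compose2[OF continuous_hvec] by blast
  then show "\<exists>L. L-lipschitz_on {p..q} E" by (rule C1_imp_lipschitz_on_interval[OF E])
  show "\<exists>N. negligible N \<and> (\<forall>t. p < t \<and> t < q \<and> t \<notin> N \<longrightarrow> (E has_vector_derivative hvec Xh a (E t)) (at t))"
    using E by (intro exI[of _ "{}"]) auto
qed auto

lemma hvec_left_invariant: "mult_deriv x y (0, hvec Xh p y) = hvec Xh p (x \<otimes> y)"
proof -
  have lin: "linear (\<lambda>v. mult_deriv x y (0, v))"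
    using left_mult_has_derivative has_derivative_linear by blast
  show ?thesis
    unfolding hvec_def
    by (simp only: linear_sum[OF lin] linear_cmul[OF lin] left_invariant[OF X_in_lie_algebra])
qed

lemma hcurve_left_translate:
  assumes h: "hcurve Xh UNIV p q \<gamma> a"
  shows "hcurve Xh UNIV p q (\<lambda>t. x \<otimes> \<gamma> t) a"
  unfolding hcurve_def
proof (intro conjI)
  have "compact (\<gamma> ` {p..q})" by (intro compact_continuous_image hcurve_continuous[OF h]) auto
  then have "bounded (\<gamma> ` {p..q})" by (rule compact_imp_bounded)
  then obtain r where "\<forall>y\<in>\<gamma> ` {p..q}. norm y \<le> r" unfolding bounded_iff by blast
  then have r: "\<gamma> ` {p..q} \<subseteq> cball 0 r" by auto
  have "\<exists>L. L-lipschitz_on (cball 0 r) (\<lambda>z. x \<otimes> z)"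
  proof (rule continuous_derivative_imp_lipschitz_on_cball[OF left_mult_has_derivative])
    fix v
    have "continuous_on UNIV (\<lambda>z. mult_deriv (fst z) (snd z) (0, v))"
      by (rule smooth_imp_continuous_on[OF smooth_mult_deriv])
    from continuous_on_compose2[OF this, of UNIV "\<lambda>y. (x, y)"]
    show "continuous_on UNIV (\<lambda>y. mult_deriv x y (0, v))"
      by (simp add: continuous_on_Pair)
  qed
  then obtain L where "L-lipschitz_on (cball 0 r) (\<lambda>z. x \<otimes> z)" by blast
  then have "L-lipschitz_on (\<gamma> ` {p..q}) (\<lambda>z. x \<otimes> z)" using r by (rule lipschitz_on_subset)
  moreover obtain L' where "L'-lipschitz_on {p..q} \<gamma>" using h by (auto simp: hcurve_def)
  ultimately show "\<exists>L. L-lipschitz_on {p..q} (\<lambda>t. x \<otimes> \<gamma> t)" using lipschitz_on_compose2 by blast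
  obtain N where N: "negligible N"
    and der: "\<And>t. \<lbrakk>p < t; t < q; t \<notin> N\<rbrakk> \<Longrightarrow> (\<gamma> has_vector_derivative hvec Xh (a t) (\<gamma> t)) (at t)"
    using h by (auto simp: hcurve_def)
  have "((\<lambda>t. x \<otimes> \<gamma> t) has_vector_derivative hvec Xh (a t) (x \<otimes> \<gamma> t)) (at t)"
    if "p < t" "t < q" "t \<notin> N" for t
  proof -
    have "((\<lambda>z. x \<otimes> z) \<circ> \<gamma> has_vector_derivative mult_deriv x (\<gamma> t) (0, hvec Xh (a t) (\<gamma> t))) (at t)"
      by (rule vector_derivative_diff_chain_within[OF der[OF that]])
        (rule has_derivative_at_withinI[OF left_mult_has_derivative])
    then show ?thesis by (simp add: o_def hvec_left_invariant)
  qed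
  then show "\<exists>N. negligible N \<and> (\<forall>t. p < t \<and> t < q \<and> t \<notin> N \<longrightarrow>
      ((\<lambda>t. x \<otimes> \<gamma> t) has_vector_derivative hvec Xh (a t) (x \<otimes> \<gamma> t)) (at t))"
    using N by blast
  show "\<exists>C. \<forall>t\<in>{p..q}. norm (a t) \<le> C" using h by (simp add: hcurve_def)
qed (use hcurve_measurable[OF h] in auto)

lemma reachable_left_translate:
  assumes "y \<in> reachable Xh UNIV x \<epsilon>"
  shows "z \<otimes> y \<in> reachable Xh UNIV (z \<otimes> x) \<epsilon>"
proof -
  obtain T \<gamma> a where *: "0 < T" "T < \<epsilon>" "hcurve Xh UNIV 0 T \<gamma> a" "\<And>t. \<lbrakk>0 \<le> t; t \<le> T\<rbrakk> \<Longrightarrow> norm (a t) \<le> 1"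
    "\<gamma> 0 = x" "\<gamma> T = y" using reachableE[OF assms] by metis
  from reachableI[OF hcurve_left_translate[OF *(3), of z] *(1,2,4)] show ?thesis using *(5,6) by simp
qed

lemma reachable_mult:
  assumes "g \<in> reachable Xh UNIV \<one> \<epsilon>" "h \<in> reachable Xh UNIV \<one> \<delta>"
  shows "g \<otimes> h \<in> reachable Xh UNIV \<one> (\<epsilon> + \<delta>)"
  using reachable_trans[OF assms(1)] reachable_left_translate[OF assms(2), of g] by simp

lemma reachable_inv:
  assumes "g \<in> reachable Xh UNIV \<one> \<epsilon>"
  shows "inv g \<in> reachable Xh UNIV \<one> \<epsilon>"
  using reachable_left_translate[OF reachable_sym[OF assms], of "inv g"] by simp

lemma reachable_one: "0 < \<epsilon> \<Longrightarrow> \<one> \<in> reachable Xh UNIV \<one> \<epsilon>"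
  by (rule reachable_refl) auto

lemma integral_curve_reachable:
  assumes E: "E 0 = \<one>" "\<And>t. (E has_vector_derivative hvec Xh a (E t)) (at t)"
    and small: "\<bar>t\<bar> * (norm a + 1) < \<epsilon>"
  shows "E t \<in> reachable Xh UNIV \<one> \<epsilon>"
proof (cases "t = 0")
  case True
  then show ?thesis using E small by (simp add: reachable_one)
next
  case False
  define c where "c = sgn t / (norm a + 1)"
  have pos: "0 < norm a + 1" by (simp add: add_nonneg_pos)
  have c: "c \<noteq> 0" using False pos by (simp add: c_def sgn_zero_iff)
  define T where "T = \<bar>t\<bar> * (norm a + 1)"
  have T: "0 < T" "T < \<epsilon>" using False pos small by (simp_all add: T_def)
  have cT: "c * T = t" using pos by (simp add: c_def T_def sgn_mult_abs)
  have h: "hcurve Xh UNIV 0 T (\<lambda>s. E (c * s + 0)) (\<lambda>s. c *\<^sub>R a)"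
  proof (rule hcurve_affine[OF hcurve_integral_curve[OF E(2), of "- (\<bar>c\<bar> * T)" "\<bar>c\<bar> * T"] c])
    fix s assume "0 \<le> s" "s \<le> T"
    then have "\<bar>c * s\<bar> \<le> \<bar>c\<bar> * T" by (simp add: abs_mult mult_left_mono)
    then show "c * s + 0 \<in> {- (\<bar>c\<bar> * T)..\<bar>c\<bar> * T}" by (simp add: abs_le_iff)
  qed
  have "norm (c *\<^sub>R a) \<le> 1"
  proof -
    have "norm (c *\<^sub>R a) = norm a / (norm a + 1)" using False pos by (simp add: c_def abs_sgn_eq abs_mult)
    also have "\<dots> \<le> 1" using pos by simp
    finally show ?thesis .
  qed
  from reachableI[OF h T this] show ?thesis using cT E(1) by simp
qed

text \<open>For fixed \<open>p\<close> the condition says that the functions \<open>f\<^sub>Z(g) = \<langle>p, Ad g Z\<rangle>\<close> vanish on a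
  Carnot-Caratheodory ball for horizontal \<open>Z\<close>. Differentiating \<open>f\<^sub>Z\<close> at \<open>g\<close> along a horizontal field \<open>Y\<close>
  gives \<open>f\<close> of \<open>[Y, Z]\<close>, so the vanishing propagates from each layer to the next. The ball is open-ended:
  \<open>g\<close> can be prolonged by a short piece of an integral curve, and the same radius serves all layers.\<close>
proposition Ad_orbit_detects_layers:
  assumes \<epsilon>: "0 < \<epsilon>"
    and base: "\<And>g i. g \<in> reachable Xh UNIV \<one> \<epsilon> \<Longrightarrow> inner p (Ad g (Xh i \<one>)) = 0"
    and k: "1 \<le> k" "k \<le> step" and Z: "Z \<in> layer X deg k" and g: "g \<in> reachable Xh UNIV \<one> \<epsilon>"
  shows "inner p (Ad g (Z \<one>)) = 0"
  using k Z g
proof (induction k arbitrary: Z g rule: dec_induct)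
  case base
  obtain a where Z: "Z = hvec Xh a" using layer_one_hvec[OF base.prems(2)] .
  have "inner p (Ad g (Z \<one>)) = (\<Sum>i\<in>UNIV. a $ i * inner p (Ad g (Xh i \<one>)))"
    unfolding Z hvec_def by (simp add: linear_sum[OF linear_Ad] linear_cmul[OF linear_Ad] inner_sum_right)
  then show ?case using assms(2)[OF base.prems(3)] by simp
next
  case (step k)
  have "Z \<in> fields_span {bracket Y Z | Y Z. Y \<in> layer X deg 1 \<and> Z \<in> layer X deg k}"
    using generates[of k] step.hyps step.prems by simp
  then obtain F c where F: "F \<subseteq> {bracket Y Z | Y Z. Y \<in> layer X deg 1 \<and> Z \<in> layer X deg k}"
    and Z: "Z = (\<lambda>x. \<Sum>B\<in>F. c B *\<^sub>R B x)"
    unfolding fields_span_def by blast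
  have "inner p (Ad g (B \<one>)) = 0" if "B \<in> F" for B
  proof -
    from subsetD[OF F that] obtain Y Z' where B: "B = bracket Y Z'" and Y: "Y \<in> layer X deg 1"
      and Z': "Z' \<in> layer X deg k" by auto
    obtain a where a: "Y = hvec Xh a" using layer_one_hvec[OF Y] .
    obtain E where E: "E 0 = \<one>" "\<And>t. (E has_vector_derivative hvec Xh a (E t)) (at t)"
      using horizontal_integral_curve by blast
    obtain T \<gamma> b where *: "0 < T" "T < \<epsilon>" "hcurve Xh UNIV 0 T \<gamma> b" "\<And>t. \<lbrakk>0 \<le> t; t \<le> T\<rbrakk> \<Longrightarrow> norm (b t) \<le> 1"
      "\<gamma> 0 = \<one>" "\<gamma> T = g" using reachableE[OF step.prems(3)] by metis
    \<comment> \<open>Half of the time left after reaching \<open>g\<close> in time \<open>T\<close> is available for prolonging the curve.\<close>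
    define \<delta> where "\<delta> = (\<epsilon> - T) / 2"
    have \<delta>: "0 < \<delta>" using * by (simp add: \<delta>_def)
    have g': "g \<in> reachable Xh UNIV \<one> (T + \<delta>)"
      using reachableI[OF *(3,1) _ *(4), of "T + \<delta>"] *(5,6) \<delta> by simp
    have "bracket Y Z' \<one> \<in> {v. inner p (Ad g v) = 0}"
    proof (rule bracket_in_subspace)
      show "Y \<in> lie_algebra G" "Z' \<in> lie_algebra G" using Y Z' layer_subset_lie_algebra by auto
      show "(E has_vector_derivative Y \<one>) (at 0)" using E(2)[of 0] by (simp add: E(1) a)
      show "subspace {v. inner p (Ad g v) = 0}"
        by (auto simp: subspace_def linear_0[OF linear_Ad] linear_add[OF linear_Ad] linear_cmul[OF linear_Ad] inner_add_right)
      show "0 < \<delta> / (norm a + 1)" using \<delta> by (simp add: add_nonneg_pos)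
      show "Ad (E t) (Z' \<one>) \<in> {v. inner p (Ad g v) = 0}" if t: "0 \<le> t" "t < \<delta> / (norm a + 1)" for t
      proof -
        have "0 < norm a + 1" by (simp add: add_nonneg_pos)
        then have "\<bar>t\<bar> * (norm a + 1) < \<delta>" using t by (simp add: pos_less_divide_eq)
        then have "E t \<in> reachable Xh UNIV \<one> \<delta>" by (rule integral_curve_reachable[OF E])
        from reachable_mult[OF g' this] have "g \<otimes> E t \<in> reachable Xh UNIV \<one> \<epsilon>" by (simp add: \<delta>_def)
        then have "inner p (Ad (g \<otimes> E t) (Z' \<one>)) = 0" using step.IH Z' step.prems(1) by simp
        then show ?thesis by (simp add: Ad_mult)
      qed
    qed (rule E(1))
    then show ?thesis by (simp add: B)
  qed
  then show ?case
    unfolding Z by (simp add: linear_sum[OF linear_Ad] linear_cmul[OF linear_Ad] inner_sum_right)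
qed

end

section \<open>Chow's theorem and stability\<close>

context euclidean_lie_group
begin

lemma mult_deriv_one_left: "mult_deriv \<one> y (0, v) = v"
proof -
  have "((\<lambda>z. z) has_derivative (\<lambda>v. mult_deriv \<one> y (0, v))) (at y)"
    using left_mult_has_derivative[of \<one> y] by simp
  then have "(\<lambda>v. mult_deriv \<one> y (0, v)) = (\<lambda>v. v)"
    using has_derivative_ident has_derivative_unique by blast
  then show ?thesis by (rule fun_cong)
qed

lemma mult_deriv_one: "mult_deriv \<one> \<one> (v, w) = v + w"
proof -
  have "mult_deriv \<one> \<one> ((v, 0) + (0, w)) = mult_deriv \<one> \<one> (v, 0) + mult_deriv \<one> \<one> (0, w)"
    by (rule linear_add[OF linear_mult_deriv])
  then show ?thesis by (simp add: mult_deriv_one_left mult_deriv_one_right)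
qed

lemma continuous_on_mult [continuous_intros]:
  assumes "continuous_on S f" "continuous_on S g"
  shows "continuous_on S (\<lambda>t. f t \<otimes> g t)"
  using continuous_on_compose2[OF smooth_imp_continuous_on[OF smooth_mult, of UNIV] continuous_on_Pair[OF assms]]
  by simp

lemma product_has_derivative:
  assumes f: "(f has_derivative f') (at x)" "f x = \<one>" and g: "(g has_derivative g') (at x)" "g x = \<one>"
  shows "((\<lambda>t. f t \<otimes> g t) has_derivative (\<lambda>h. f' h + g' h)) (at x)"
proof -
  have 1: "((\<lambda>t. (f t, g t)) has_derivative (\<lambda>h. (f' h, g' h))) (at x)"
    by (rule has_derivative_Pair[OF f(1) g(1)])
  have "((\<lambda>(x, y). x \<otimes> y) has_derivative mult_deriv \<one> \<one>) (at (f x, g x))"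
    unfolding f(2) g(2) by (rule mult_has_derivative)
  from has_derivative_compose[OF 1 this] show ?thesis by (simp add: mult_deriv_one)
qed

text \<open>Left-invariant fields that are linearly independent as fields are linearly independent at the identity,
  since their values elsewhere are images under left translation. As many of them as the dimension
  therefore span the tangent space there.\<close>
lemma annihilates_basis_at_one_imp_zero:
  assumes Y: "\<And>j. Y j \<in> lie_algebra G"
    and indep: "\<And>c :: real ^ 'n. (\<lambda>x. \<Sum>j\<in>UNIV. c $ j *\<^sub>R Y j x) = (\<lambda>x. 0) \<Longrightarrow> c = 0"
    and p: "\<And>j. inner p (Y j \<one>) = 0"
  shows "p = 0"
proof -
  define \<Lambda> where "\<Lambda> c = (\<Sum>j\<in>UNIV. c $ j *\<^sub>R Y j \<one>)" for c :: "real ^ 'n"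
  have lin: "linear \<Lambda>"
    by (rule linearI) (simp_all add: \<Lambda>_def scaleR_left_distrib sum.distrib scaleR_sum_right)
  have "c = 0" if "\<Lambda> c = 0" for c
  proof (rule indep, rule ext)
    fix x
    have lx: "linear (\<lambda>v. mult_deriv x \<one> (0, v))"
      using left_mult_has_derivative has_derivative_linear by blast
    have "(\<Sum>j\<in>UNIV. c $ j *\<^sub>R Y j x) = mult_deriv x \<one> (0, \<Lambda> c)"
      unfolding \<Lambda>_def using left_invariant[OF Y, of x \<one>]
      by (simp add: linear_sum[OF lx] linear_cmul[OF lx])
    then show "(\<Sum>j\<in>UNIV. c $ j *\<^sub>R Y j x) = 0" using that linear_0[OF lx] by simp
  qed
  then have "inj \<Lambda>" using linear_injective_0[OF lin] by blast
  then have "surj \<Lambda>" by (rule linear_injective_imp_surjective[OF lin _ refl])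
  then obtain c where "p = \<Lambda> c" by (metis surjD)
  then have "inner p p = (\<Sum>j\<in>UNIV. c $ j * inner p (Y j \<one>))"
    by (simp add: \<Lambda>_def inner_sum_right)
  then show ?thesis using p by simp
qed

end

context carnot_group
begin

lemma Ad_orbit_spans:
  assumes "0 < \<epsilon>"
  shows "span {Ad g (Xh i \<one>) | g i. g \<in> reachable Xh UNIV \<one> \<epsilon>} = UNIV" (is "span ?S = UNIV")
proof (rule ccontr)
  assume "span ?S \<noteq> UNIV"
  then obtain p where p: "p \<noteq> 0" "span ?S \<subseteq> {v. inner p v = 0}"
    using span_not_univ_subset_hyperplane by blast
  have base: "inner p (Ad g (Xh i \<one>)) = 0" if "g \<in> reachable Xh UNIV \<one> \<epsilon>" for g i
    using p(2) that span_base[of "Ad g (Xh i \<one>)" ?S] by blast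
  have vanish: "inner p (X j \<one>) = 0" for j
    using Ad_orbit_detects_layers[OF assms base, of "deg j" "X j" \<one>] deg_range[of j]
      X_in_layer reachable_one[OF assms] by (simp add: Ad_one)
  have "p = 0"
    by (rule annihilates_basis_at_one_imp_zero[where Y=X]) (fact X_in_lie_algebra, erule basis_indep, fact vanish)
  then show False using p(1) by simp
qed

text \<open>A product of curves through the identity, each with its own time parameter, has as derivative the sum of
  the velocities. The coordinates of \<open>t\<close> serve as time parameters; products over lists are used because the
  group is not commutative.\<close>
lemma reachable_list_product:
  fixes c :: "'n \<Rightarrow> real \<Rightarrow> real ^ 'n"
  assumes c0: "\<And>j. c j 0 = \<one>" and der: "\<And>j. (c j has_vector_derivative b j) (at 0)"
    and cont: "\<And>j. continuous_on UNIV (c j)"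
    and reach: "\<And>j s. \<bar>s\<bar> < r \<Longrightarrow> c j s \<in> reachable Xh UNIV \<one> \<delta>" and \<delta>: "0 < \<delta>"
  shows "\<exists>\<Phi>. \<Phi> 0 = \<one> \<and> (\<Phi> has_derivative (\<lambda>t. \<Sum>j\<leftarrow>l. t $ j *\<^sub>R b j)) (at 0) \<and>
    continuous_on UNIV \<Phi> \<and> (\<forall>t :: real ^ 'n. norm t < r \<longrightarrow> \<Phi> t \<in> reachable Xh UNIV \<one> (real (length l + 1) * \<delta>))"
proof (induction l)
  case Nil
  then show ?case using reachable_one[OF \<delta>] by (intro exI[of _ "\<lambda>t. \<one>"]) auto
next
  case (Cons j l)
  then obtain \<Phi> where \<Phi>: "\<Phi> 0 = \<one>" "(\<Phi> has_derivative (\<lambda>t. \<Sum>j\<leftarrow>l. t $ j *\<^sub>R b j)) (at 0)"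
    "continuous_on UNIV \<Phi>"
    "\<And>t :: real ^ 'n. norm t < r \<Longrightarrow> \<Phi> t \<in> reachable Xh UNIV \<one> (real (length l + 1) * \<delta>)"
    by blast
  have "((\<lambda>t :: real ^ 'n. t $ j) has_derivative (\<lambda>t. t $ j)) (at 0)"
    by (rule bounded_linear.has_derivative[OF bounded_linear_vec_nth has_derivative_ident])
  moreover have "(c j has_derivative (\<lambda>h. h *\<^sub>R b j)) (at ((0 :: real ^ 'n) $ j))"
    using der by (simp add: has_vector_derivative_def)
  ultimately have cj: "((\<lambda>t :: real ^ 'n. c j (t $ j)) has_derivative (\<lambda>t. t $ j *\<^sub>R b j)) (at 0)"
    by (rule has_derivative_compose)
  let ?\<Psi> = "\<lambda>t. c j (t $ j) \<otimes> \<Phi> t"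
  show ?case
  proof (intro exI[of _ ?\<Psi>] conjI allI impI)
    show "?\<Psi> 0 = \<one>" by (simp add: c0 \<Phi>(1))
    show "(?\<Psi> has_derivative (\<lambda>t. \<Sum>j\<leftarrow>j # l. t $ j *\<^sub>R b j)) (at 0)"
      using product_has_derivative[OF cj _ \<Phi>(2,1)] c0 by simp
    have "continuous_on UNIV (\<lambda>t :: real ^ 'n. c j (t $ j))"
      by (rule continuous_on_compose2[OF cont]) (auto intro!: continuous_intros)
    then show "continuous_on UNIV ?\<Psi>" by (intro continuous_intros \<Phi>(3))
    fix t :: "real ^ 'n" assume t: "norm t < r"
    have "\<bar>t $ j\<bar> < r" using component_le_norm_cart[of t j] t by linarith
    from reachable_mult[OF reach[OF this] \<Phi>(4)[OF t]]
    show "?\<Psi> t \<in> reachable Xh UNIV \<one> (real (length (j # l) + 1) * \<delta>)" by (simp add: algebra_simps)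
  qed
qed

text \<open>The factor 3 accounts for \<open>g\<close>, the integral curve and the inverse of \<open>g\<close>. The coefficient vector of a
  single horizontal field has norm 1, whence the time \<open>\<epsilon> / 2\<close> in \<open>integral_curve_reachable\<close>.\<close>
lemma conjugated_integral_curve:
  assumes g: "g \<in> reachable Xh UNIV \<one> \<epsilon>"
  shows "\<exists>c. c 0 = \<one> \<and> (c has_vector_derivative Ad g (Xh i \<one>)) (at 0) \<and> continuous_on UNIV c \<and>
    (\<forall>s. \<bar>s\<bar> < \<epsilon> / 2 \<longrightarrow> c s \<in> reachable Xh UNIV \<one> (3 * \<epsilon>))"
proof -
  have hvec: "hvec Xh (axis i 1) x = Xh i x" for x
    by (simp add: hvec_def axis_def if_distrib[of "\<lambda>r. r *\<^sub>R _"] cong: if_cong)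
  obtain E where E: "E 0 = \<one>" "\<And>t. (E has_vector_derivative hvec Xh (axis i 1) (E t)) (at t)"
    using horizontal_integral_curve by blast
  let ?c = "\<lambda>s. g \<otimes> E s \<otimes> inv g"
  show ?thesis
  proof (intro exI[of _ ?c] conjI allI impI)
    show "?c 0 = \<one>" by (simp add: E(1))
    have E0: "(E has_vector_derivative Xh i \<one>) (at 0)" using E(2)[of 0] by (simp add: hvec E(1))
    have "((\<lambda>z. g \<otimes> z \<otimes> inv g) has_derivative Ad g) (at (E 0))"
      unfolding E(1) by (rule conjugation_has_derivative)
    from vector_derivative_diff_chain_within[OF E0 has_derivative_at_withinI[OF this]]
    show "(?c has_vector_derivative Ad g (Xh i \<one>)) (at 0)" by (simp add: o_def)
    have "continuous_on UNIV E"
      by (meson E(2) continuous_at_imp_continuous_on has_vector_derivative_continuous)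
    then show "continuous_on UNIV ?c" by (intro continuous_intros)
    fix s :: real assume "\<bar>s\<bar> < \<epsilon> / 2"
    then have "E s \<in> reachable Xh UNIV \<one> \<epsilon>" by (intro integral_curve_reachable[OF E]) (simp add: norm_axis_1)
    from reachable_mult[OF reachable_mult[OF g this] reachable_inv[OF g]]
    show "?c s \<in> reachable Xh UNIV \<one> (3 * \<epsilon>)" by simp
  qed
qed

text \<open>The product of \<open>n\<close> curves whose velocities form a basis has invertible derivative at 0. It is only known
  to be differentiable at 0 and continuous, so the open mapping theorem of Sussmann, based on Brouwer's
  fixed point theorem, takes the place of the inverse function theorem.\<close>
proposition one_interior_reachable:
  assumes \<epsilon>: "0 < \<epsilon>"
  shows "\<one> \<in> interior (reachable Xh UNIV \<one> \<epsilon>)"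
proof -
  \<comment> \<open>Each of the factors takes time less than \<open>3 * \<delta>\<close>; one more is spent at the constant curve of the empty product.\<close>
  define \<delta> where "\<delta> = \<epsilon> / (3 * (real CARD('n) + 1))"
  have \<delta>: "0 < \<delta>" using \<epsilon> by (simp add: \<delta>_def)
  let ?S = "{Ad g (Xh i \<one>) | g i. g \<in> reachable Xh UNIV \<one> \<delta>}"
  obtain B where B: "B \<subseteq> ?S" "independent B" "?S \<subseteq> span B" "card B = dim ?S"
    using basis_exists by blast
  have spanB: "span B = UNIV"
    using span_mono[OF B(3)] Ad_orbit_spans[OF \<delta>] by (simp add: span_span top.extremum_unique)
  have "dim ?S = CARD('n)" using Ad_orbit_spans[OF \<delta>] dim_span[of ?S] by simp
  then have "card B = card (UNIV :: 'n set)" using B(4) by simp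
  moreover have "finite B" using B(2) by (rule independent_imp_finite)
  ultimately obtain b where "bij_betw b (UNIV :: 'n set) B"
    using finite_same_card_bij[of "UNIV :: 'n set" B] by auto
  then have b: "range b = B" by (simp add: bij_betw_def)
  have "\<exists>c. c 0 = \<one> \<and> (c has_vector_derivative b j) (at 0) \<and> continuous_on UNIV c \<and>
    (\<forall>s. \<bar>s\<bar> < \<delta> / 2 \<longrightarrow> c s \<in> reachable Xh UNIV \<one> (3 * \<delta>))" for j
  proof -
    have "b j \<in> ?S" using b B(1) by blast
    then obtain g i where "b j = Ad g (Xh i \<one>)" "g \<in> reachable Xh UNIV \<one> \<delta>" by blast
    then show ?thesis using conjugated_integral_curve[of g \<delta> i] by simp
  qed
  then obtain c where c: "\<And>j. c j 0 = \<one>" "\<And>j. (c j has_vector_derivative b j) (at 0)"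
    "\<And>j. continuous_on UNIV (c j)" "\<And>j s. \<bar>s\<bar> < \<delta> / 2 \<Longrightarrow> c j s \<in> reachable Xh UNIV \<one> (3 * \<delta>)"
    by metis
  obtain l :: "'n list" where l: "set l = UNIV" "distinct l"
    using finite_distinct_list[of "UNIV :: 'n set"] by auto
  have len: "length l = CARD('n)" using distinct_card[OF l(2)] l(1) by simp
  obtain \<Phi> where \<Phi>: "\<Phi> 0 = \<one>" "(\<Phi> has_derivative (\<lambda>t. \<Sum>j\<leftarrow>l. t $ j *\<^sub>R b j)) (at 0)"
    "continuous_on UNIV \<Phi>"
    "\<And>t :: real ^ 'n. norm t < \<delta> / 2 \<Longrightarrow> \<Phi> t \<in> reachable Xh UNIV \<one> (real (length l + 1) * (3 * \<delta>))"
  proof -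
    have "0 < 3 * \<delta>" using \<delta> by simp
    from reachable_list_product[where c=c, OF c this, where l=l] show ?thesis using that by blast
  qed
  let ?D = "\<lambda>t :: real ^ 'n. \<Sum>j\<leftarrow>l. t $ j *\<^sub>R b j"
  have D: "?D t = (\<Sum>j\<in>UNIV. t $ j *\<^sub>R b j)" for t
    using sum.distinct_set_conv_list[OF l(2), of "\<lambda>j. t $ j *\<^sub>R b j"] l(1) by simp
  have lin: "linear ?D" using \<Phi>(2) has_derivative_linear by blast
  have "surj ?D"
  proof -
    have "b j \<in> range ?D" for j
    proof -
      have "?D (axis j 1) = b j"
        unfolding D by (simp add: axis_def if_distrib[of "\<lambda>r. r *\<^sub>R _"] cong: if_cong)
      from range_eqI[where f="?D", OF this[symmetric]] show ?thesis .
    qed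
    then have "span B \<subseteq> range ?D"
      unfolding b[symmetric] by (intro span_minimal linear_subspace_image[OF lin]) auto
    then show ?thesis using spanB by blast
  qed
  then obtain g' where g': "linear g'" "?D \<circ> g' = id"
    using linear_surjective_right_inverse[OF lin] by blast
  have "\<Phi> 0 \<in> interior (\<Phi> ` ball 0 (\<delta> / 2))"
  proof (rule sussmann_open_mapping[OF open_UNIV \<Phi>(3) UNIV_I \<Phi>(2) _ g'(2)])
    show "bounded_linear g'" using g'(1) by (rule linear_conv_bounded_linear[THEN iffD1])
    show "0 \<in> interior (ball 0 (\<delta> / 2) :: (real ^ 'n) set)" using \<delta> by (simp add: interior_open)
  qed simp
  moreover have "\<Phi> ` ball 0 (\<delta> / 2) \<subseteq> reachable Xh UNIV \<one> \<epsilon>"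
  proof -
    have "real (length l + 1) * (3 * \<delta>) = \<epsilon>"
      unfolding len \<delta>_def by (simp add: field_simps add_nonneg_eq_0_iff)
    then show ?thesis using \<Phi>(4) by auto
  qed
  ultimately show ?thesis using interior_mono \<Phi>(1) by (metis subsetD)
qed

text \<open>By left translation it suffices to consider the identity.\<close>
theorem chow:
  assumes "0 < \<epsilon>"
  shows "\<exists>\<delta>>0. ball x \<delta> \<subseteq> reachable Xh UNIV x \<epsilon>"
proof -
  let ?I = "interior (reachable Xh UNIV \<one> \<epsilon>)"
  have "open ((\<lambda>z. inv x \<otimes> z) -` ?I)"
    using continuous_left_mult by (intro open_vimage) auto
  moreover have "x \<in> (\<lambda>z. inv x \<otimes> z) -` ?I" using one_interior_reachable[OF assms] by simp
  ultimately obtain \<delta> where \<delta>: "0 < \<delta>" "ball x \<delta> \<subseteq> (\<lambda>z. inv x \<otimes> z) -` ?I"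
    using open_contains_ball by blast
  have "ball x \<delta> \<subseteq> reachable Xh UNIV x \<epsilon>"
  proof
    fix z assume "z \<in> ball x \<delta>"
    then have "inv x \<otimes> z \<in> reachable Xh UNIV \<one> \<epsilon>" using \<delta>(2) interior_subset by blast
    from reachable_left_translate[OF this, of x] show "z \<in> reachable Xh UNIV x \<epsilon>"
      by (simp add: m_assoc[symmetric])
  qed
  then show ?thesis using \<delta>(1) by blast
qed

end

lemma monge_solution_iff_monge:
  "monge_solution Xh \<Omega> H u \<longleftrightarrow> monge \<Omega> (cc_dist Xh \<Omega>) (optical_length Xh \<Omega> H) u"
  by (simp add: monge_solution_def monge_def)

theorem theorem1p5:
  fixes G :: "(real ^ 'n::finite) monoid"
    and X :: "'n \<Rightarrow> 'n vfield"
    and deg :: "'n \<Rightarrow> nat"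
    and step :: nat
    and hor :: "'m::finite \<Rightarrow> 'n"
    and \<Omega> :: "(real ^ 'n) set"
    and \<alpha> :: real
    and H :: "nat \<Rightarrow> real ^ 'n \<Rightarrow> real ^ 'm \<Rightarrow> real"
    and H_inf :: "real ^ 'n \<Rightarrow> real ^ 'm \<Rightarrow> real"
    and u :: "nat \<Rightarrow> real ^ 'n \<Rightarrow> real"
    and u_inf :: "real ^ 'n \<Rightarrow> real"
  defines "Xh \<equiv> \<lambda>i. X (hor i)"
  assumes "carnot_group G X deg step hor"
    and "is_domain \<Omega>"
    and "\<And>j. hamiltonian \<Omega> \<alpha> (H j)"
    and "hamiltonian \<Omega> \<alpha> H_inf"
    and "\<And>j. monge_solution Xh \<Omega> (H j) (u j)"
    and "locally_uniform_limit (\<Omega> \<times> \<Omega>)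
           (\<lambda>j (x, y). optical_length Xh \<Omega> (H j) x y)
           (\<lambda>(x, y). optical_length Xh \<Omega> H_inf x y)"
    and "continuous_on \<Omega> u_inf"
    and "locally_uniform_limit \<Omega> u u_inf"
  shows "monge_solution Xh \<Omega> H_inf u_inf"
proof -
  interpret carnot_group G X deg step hor by fact
  have cont: "\<And>i. continuous_on UNIV (Xh i)" unfolding Xh_def by (rule continuous_Xh)
  have lengths: "length_structure \<Omega> (cc_dist Xh \<Omega>) (optical_length Xh \<Omega> K) \<alpha>"
    if K: "hamiltonian \<Omega> \<alpha> K" for K
  proof -
    have "optical_length Xh \<Omega> K = (\<lambda>x y. Inf (costs Xh \<Omega> (support_fun K) x y))"
      using optical_length_eq_Inf_costs[of Xh, OF cont K] by blast
    moreover have "length_structure \<Omega> (cc_dist Xh \<Omega>) (\<lambda>x y. Inf (costs Xh \<Omega> (support_fun K) x y)) \<alpha>"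
      by (rule length_structure_Inf_costs[OF cont])
        (use chow assms(3) lagrangian_support_fun[OF K] in \<open>auto simp: is_domain_def Xh_def\<close>)
    ultimately show ?thesis by simp
  qed
  show ?thesis
    using assms(6-9) unfolding monge_solution_iff_monge
    by (intro monge_stable[OF lengths[OF assms(4)] lengths[OF assms(5)]]) auto
qed

end
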